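(* Satisfiability of an $\mathcal{ALC}_{\overline{\forall}}$ concept with respect to an ontology can be decided in polynomial space: there is a deterministic algorithm which, given an $\mathcal{ALC}$ concept $C_0$ and an $\mathcal{ALC}$ ontology $\mathcal{O}$, decides whether $C_0$ is category-theoretically unsatisfiable in $\mathcal{ALC}_{\overline{\forall}}$ with respect to $\mathcal{O}$, using space polynomial in the size of $\langle C_0,\mathcal{O}\rangle$.
   Context: Syntax: fix nonempty sets $\mathbf{C}$ of concept names and $\mathbf{R}$ of role names. Concepts ($\mathcal{ALC}$ syntax, also used for $\mathcal{ALC}_{\overline{\forall}}$) are built from concept names, $\top$, $\bot$ by $C\sqcap D$, $C\sqcup D$, $\neg C$, $\exists R.C$, $\forall R.C$. An ontology $\mathcal{O}$ is a finite set of axioms $E\sqsubseteq F$ between concepts. Categorical framework. A "category" here is a collection of objects with arrows $X\longrightarrow Y$, containing identities and closed under composition; only existence of arrows matters; $X\leftrightarrows Y$ means arrows both ways. An $\mathcal{ALC}_{\overline{\forall}}$ ontology category for $\langle C_0,\mathcal{O}\rangle$ is a pair of a concept category $\mathscr{C}_c$ and a role category $\mathscr{C}_r$ such that: (S1) every role name is an object of $\mathscr{C}_r$; there are objects $R_\bot,R_\top$ with $R_\bot\longrightarrow R\longrightarrow R_\top$ for every role object $R$; (S2) concept names, $\top$, $\bot$ are objects of $\mathscr{C}_c$, with $\bot\longrightarrow C\longrightarrow\top$ for every concept object $C$; (S3) each role object $R$ has concept objects $\mathsf{dom}(R)$, $\mathsf{cod}(R)$, with $\mathsf{dom}(R_\top)=\mathsf{cod}(R_\top)=\top$,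 $\mathsf{dom}(R_\bot)=\mathsf{cod}(R_\bot)=\bot$; $R\longrightarrow R'$ implies $\mathsf{dom}(R)\longrightarrow\mathsf{dom}(R')$ and $\mathsf{cod}(R)\longrightarrow\mathsf{cod}(R')$; $\mathsf{dom}(R)\longrightarrow\bot$ or $\mathsf{cod}(R)\longrightarrow\bot$ implies $R\longrightarrow R_\bot$; (S4) $C_0$ is an object of $\mathscr{C}_c$ and for each axiom $E\sqsubseteq F$ of $\mathcal{O}$, $E\longrightarrow F$ is an arrow. Moreover, whenever the objects mentioned are present ($X$ ranges over concept objects, $R'$ over role objects): (Disj) $C\longrightarrow C\sqcup D$, $D\longrightarrow C\sqcup D$; if $C\longrightarrow X$, $D\longrightarrow X$ then $C\sqcup D\longrightarrow X$. (Conj) $C\sqcap D\longrightarrow C$, $C\sqcap D\longrightarrow D$; if $X\longrightarrow C$, $X\longrightarrow D$ then $X\longrightarrow C\sqcap D$; $C\sqcap(D\sqcup E)\longrightarrow(C\sqcap D)\sqcup(C\sqcap E)$. (Neg) $C\sqcap\neg C\longrightarrow\bot$; $\top\longrightarrow C\sqcup\neg C$; if $C\sqcap X\longrightarrow\bot$ then $X\longrightarrow\neg C$; if $\top\longrightarrow C\sqcup X$ then $\neg C\longrightarrow X$. (Ex) for each object $\exists R.C$ there is a role object $R_{(\exists R.C)}$ with $R_{(\exists R.C)}\longrightarrow R$, $\mathsf{cod}(R_{(\exists R.C)})\longrightarrow C$, $\mathsf{dom}(R_{(\exists R.C)})\leftrightarrows\exists R.C$; and for every $R'$ with $R'\longrightarrow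 R$ and $\mathsf{cod}(R')\longrightarrow C$, $\mathsf{dom}(R')\longrightarrow\mathsf{dom}(R_{(\exists R.C)})$. (All1) $\forall R.C\leftrightarrows\neg\exists R.\neg C$. (In full $\mathcal{ALC}$ one also requires: for every $R'$ with $R'\longrightarrow R$ and $\mathsf{dom}(R')\longrightarrow\forall R.C$, $\mathsf{cod}(R')\longrightarrow C$; the logic $\mathcal{ALC}_{\overline{\forall}}$ is obtained by dropping exactly this requirement.) An ontology category may contain further objects built from the signature, but every arrow is an identity, an axiom arrow, an arrow required by the conditions above, or a composite of such arrows. $C_0$ is category-theoretically unsatisfiable in $\mathcal{ALC}_{\overline{\forall}}$ w.r.t. $\mathcal{O}$ if some $\mathcal{ALC}_{\overline{\forall}}$ ontology category for $\langle C_0,\mathcal{O}\rangle$ has an arrow $C_0\longrightarrow\bot$; otherwise $C_0$ is satisfiable. *)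

theory Defs
  imports "HOL-Computational_Algebra.Polynomial"
begin

section \<open>Concepts and ontologies\<close>

datatype (concept_names: 'c, role_names: 'r) concept =
    Atom 'c
  | CTop
  | CBot
  | CNot "('c, 'r) concept"
  | CAnd "('c, 'r) concept" "('c, 'r) concept"
  | COr "('c, 'r) concept" "('c, 'r) concept"
  | CEx 'r "('c, 'r) concept"
  | CAll 'r "('c, 'r) concept"

text \<open>The pair \<open>(E, F)\<close> stands for the axiom \<open>E \<sqsubseteq> F\<close>.\<close>

type_synonym ('c, 'r) concept_axiom = "('c, 'r) concept \<times> ('c, 'r) concept"

definition over_signature :: "'c set \<Rightarrow> 'r set \<Rightarrow> ('c, 'r) concept \<Rightarrow> bool" where
  "over_signature CN RN C \<longleftrightarrow> concept_names C \<subseteq> CN \<and> role_names C \<subseteq> RN"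


section \<open>Ontology categories\<close>

text \<open>
  The expressions over the signature that may serve as objects.  \<open>REx R C\<close> is the role object
  \<open>R\<close> indexed by \<open>\<exists>R.C\<close>.  The objects \<open>dom R\<close> and \<open>cod R\<close> are new expressions for \<open>R\<close> a role
  name or \<open>REx S D\<close>, but are fixed to be \<open>Top\<close> or \<open>Bot\<close> for \<open>RTop\<close> and \<open>RBot\<close>; having one
  constructor for each of the two former cases makes these equalities hold on the nose.
\<close>

datatype (cobj_concept_names: 'c, cobj_role_names: 'r) cobj =
    CName 'c
  | Top
  | Bot
  | Neg "('c, 'r) cobj"
  | Conj "('c, 'r) cobj" "('c, 'r) cobj"
  | Disj "('c, 'r) cobj" "('c, 'r) cobj"
  | Exists "('c, 'r) robj" "('c, 'r) cobj"
  | Forall "('c, 'r) robj" "('c, 'r) cobj"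
  | DomName 'r
  | CodName 'r
  | DomEx "('c, 'r) robj" "('c, 'r) cobj"
  | CodEx "('c, 'r) robj" "('c, 'r) cobj"
and (robj_concept_names: 'c, robj_role_names: 'r) robj =
    RName 'r
  | RTop
  | RBot
  | REx "('c, 'r) robj" "('c, 'r) cobj"

primrec dom :: "('c, 'r) robj \<Rightarrow> ('c, 'r) cobj" where
  "dom (RName r) = DomName r"
| "dom RTop = Top"
| "dom RBot = Bot"
| "dom (REx R C) = DomEx R C"

primrec cod :: "('c, 'r) robj \<Rightarrow> ('c, 'r) cobj" where
  "cod (RName r) = CodName r"
| "cod RTop = Top"
| "cod RBot = Bot"
| "cod (REx R C) = CodEx R C"

primrec obj_of :: "('c, 'r) concept \<Rightarrow> ('c, 'r) cobj" where
  "obj_of (Atom a) = CName a"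
| "obj_of CTop = Top"
| "obj_of CBot = Bot"
| "obj_of (CNot C) = Neg (obj_of C)"
| "obj_of (CAnd C D) = Conj (obj_of C) (obj_of D)"
| "obj_of (COr C D) = Disj (obj_of C) (obj_of D)"
| "obj_of (CEx r C) = Exists (RName r) (obj_of C)"
| "obj_of (CAll r C) = Forall (RName r) (obj_of C)"

text \<open>
  The arrows on given sets \<open>OC\<close> of concept objects and \<open>OR\<close> of role objects: only those that are
  identities, axiom arrows, composites, or required by one of the conditions on objects that are
  present.  A membership premise is left out where it already follows from the presence of an
  arrow, see \<open>arrow_objects\<close> below.  There is no rule making \<open>cod R' \<longrightarrow> C\<close> follow from
  \<open>R' \<longrightarrow> R\<close> and \<open>dom R' \<longrightarrow> \<forall>R.C\<close>: that is the requirement of full \<open>ALC\<close> dropped in the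
  logic considered here.
\<close>

inductive
  concept_arrow :: "('c, 'r) concept_axiom set \<Rightarrow> ('c, 'r) cobj set \<Rightarrow> ('c, 'r) robj set \<Rightarrow>
      ('c, 'r) cobj \<Rightarrow> ('c, 'r) cobj \<Rightarrow> bool" and
  role_arrow :: "('c, 'r) concept_axiom set \<Rightarrow> ('c, 'r) cobj set \<Rightarrow> ('c, 'r) robj set \<Rightarrow>
      ('c, 'r) robj \<Rightarrow> ('c, 'r) robj \<Rightarrow> bool"
  for Ax :: "('c, 'r) concept_axiom set" and OC :: "('c, 'r) cobj set" and OR :: "('c, 'r) robj set"
where
  concept_id: "C \<in> OC \<Longrightarrow> concept_arrow Ax OC OR C C"
| concept_comp: "\<lbrakk>concept_arrow Ax OC OR C D; concept_arrow Ax OC OR D E\<rbrakk>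
    \<Longrightarrow> concept_arrow Ax OC OR C E"
| role_id: "R \<in> OR \<Longrightarrow> role_arrow Ax OC OR R R"
| role_comp: "\<lbrakk>role_arrow Ax OC OR R S; role_arrow Ax OC OR S T\<rbrakk> \<Longrightarrow> role_arrow Ax OC OR R T"

| role_bot: "R \<in> OR \<Longrightarrow> role_arrow Ax OC OR RBot R"
| role_top: "R \<in> OR \<Longrightarrow> role_arrow Ax OC OR R RTop"
| concept_bot: "C \<in> OC \<Longrightarrow> concept_arrow Ax OC OR Bot C"
| concept_top: "C \<in> OC \<Longrightarrow> concept_arrow Ax OC OR C Top"
| dom_arrow: "role_arrow Ax OC OR R R' \<Longrightarrow> concept_arrow Ax OC OR (dom R) (dom R')"
| cod_arrow: "role_arrow Ax OC OR R R' \<Longrightarrow> concept_arrow Ax OC OR (cod R) (cod R')"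
| dom_bot: "\<lbrakk>R \<in> OR; concept_arrow Ax OC OR (dom R) Bot\<rbrakk> \<Longrightarrow> role_arrow Ax OC OR R RBot"
| cod_bot: "\<lbrakk>R \<in> OR; concept_arrow Ax OC OR (cod R) Bot\<rbrakk> \<Longrightarrow> role_arrow Ax OC OR R RBot"
| axiom_arrow: "(E, F) \<in> Ax \<Longrightarrow> concept_arrow Ax OC OR (obj_of E) (obj_of F)"

| disj_left: "\<lbrakk>C \<in> OC; Disj C D \<in> OC\<rbrakk> \<Longrightarrow> concept_arrow Ax OC OR C (Disj C D)"
| disj_right: "\<lbrakk>D \<in> OC; Disj C D \<in> OC\<rbrakk> \<Longrightarrow> concept_arrow Ax OC OR D (Disj C D)"
| disj_least: "\<lbrakk>Disj C D \<in> OC; concept_arrow Ax OC OR C X; concept_arrow Ax OC OR D X\<rbrakk>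
    \<Longrightarrow> concept_arrow Ax OC OR (Disj C D) X"

| conj_left: "\<lbrakk>C \<in> OC; Conj C D \<in> OC\<rbrakk> \<Longrightarrow> concept_arrow Ax OC OR (Conj C D) C"
| conj_right: "\<lbrakk>D \<in> OC; Conj C D \<in> OC\<rbrakk> \<Longrightarrow> concept_arrow Ax OC OR (Conj C D) D"
| conj_greatest: "\<lbrakk>Conj C D \<in> OC; concept_arrow Ax OC OR X C; concept_arrow Ax OC OR X D\<rbrakk>
    \<Longrightarrow> concept_arrow Ax OC OR X (Conj C D)"
| distrib: "\<lbrakk>Conj C (Disj D E) \<in> OC; Disj (Conj C D) (Conj C E) \<in> OC\<rbrakk>
    \<Longrightarrow> concept_arrow Ax OC OR (Conj C (Disj D E)) (Disj (Conj C D) (Conj C E))"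

| neg_bot: "Conj C (Neg C) \<in> OC \<Longrightarrow> concept_arrow Ax OC OR (Conj C (Neg C)) Bot"
| neg_top: "Disj C (Neg C) \<in> OC \<Longrightarrow> concept_arrow Ax OC OR Top (Disj C (Neg C))"
| neg_greatest: "\<lbrakk>X \<in> OC; Neg C \<in> OC; concept_arrow Ax OC OR (Conj C X) Bot\<rbrakk>
    \<Longrightarrow> concept_arrow Ax OC OR X (Neg C)"
| neg_least: "\<lbrakk>X \<in> OC; Neg C \<in> OC; concept_arrow Ax OC OR Top (Disj C X)\<rbrakk>
    \<Longrightarrow> concept_arrow Ax OC OR (Neg C) X"

| ex_role: "Exists R C \<in> OC \<Longrightarrow> role_arrow Ax OC OR (REx R C) R"
| ex_cod: "Exists R C \<in> OC \<Longrightarrow> concept_arrow Ax OC OR (cod (REx R C)) C"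
| ex_dom1: "Exists R C \<in> OC \<Longrightarrow> concept_arrow Ax OC OR (dom (REx R C)) (Exists R C)"
| ex_dom2: "Exists R C \<in> OC \<Longrightarrow> concept_arrow Ax OC OR (Exists R C) (dom (REx R C))"
| ex_greatest: "\<lbrakk>Exists R C \<in> OC; role_arrow Ax OC OR R' R; concept_arrow Ax OC OR (cod R') C\<rbrakk>
    \<Longrightarrow> concept_arrow Ax OC OR (dom R') (dom (REx R C))"

| all_neg1: "\<lbrakk>Forall R C \<in> OC; Neg (Exists R (Neg C)) \<in> OC\<rbrakk>
    \<Longrightarrow> concept_arrow Ax OC OR (Forall R C) (Neg (Exists R (Neg C)))"
| all_neg2: "\<lbrakk>Forall R C \<in> OC; Neg (Exists R (Neg C)) \<in> OC\<rbrakk>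
    \<Longrightarrow> concept_arrow Ax OC OR (Neg (Exists R (Neg C))) (Forall R C)"

text \<open>
  Which objects must be present; anything else built from the signature may be present or absent.
  An object \<open>Exists R C\<close> forces \<open>REx R C\<close> to exist, and the arrows out of it and its codomain force
  \<open>R\<close> and \<open>C\<close> to exist.
\<close>

definition ontology_objects :: "'c set \<Rightarrow> 'r set \<Rightarrow> ('c, 'r) concept \<Rightarrow>
    ('c, 'r) concept_axiom set \<Rightarrow> ('c, 'r) cobj set \<Rightarrow> ('c, 'r) robj set \<Rightarrow> bool" where
  "ontology_objects CN RN C0 Ax OC OR \<longleftrightarrow>
     (\<forall>C\<in>OC. cobj_concept_names C \<subseteq> CN \<and> cobj_role_names C \<subseteq> RN) \<and>
     (\<forall>R\<in>OR. robj_concept_names R \<subseteq> CN \<and> robj_role_names R \<subseteq> RN) \<and>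
     RName ` RN \<subseteq> OR \<and> RBot \<in> OR \<and> RTop \<in> OR \<and>
     CName ` CN \<subseteq> OC \<and> Top \<in> OC \<and> Bot \<in> OC \<and>
     (\<forall>R\<in>OR. dom R \<in> OC \<and> cod R \<in> OC) \<and>
     obj_of C0 \<in> OC \<and>
     (\<forall>(E, F)\<in>Ax. obj_of E \<in> OC \<and> obj_of F \<in> OC) \<and>
     (\<forall>R C. Exists R C \<in> OC \<longrightarrow> REx R C \<in> OR \<and> R \<in> OR \<and> C \<in> OC)"

lemma arrow_objects:
  assumes "ontology_objects CN RN C0 Ax OC OR"
  shows "concept_arrow Ax OC OR C D \<Longrightarrow> C \<in> OC \<and> D \<in> OC"
    and "role_arrow Ax OC OR R S \<Longrightarrow> R \<in> OR \<and> S \<in> OR"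
proof -
  have dc: "\<And>R. R \<in> OR \<Longrightarrow> dom R \<in> OC" "\<And>R. R \<in> OR \<Longrightarrow> cod R \<in> OC"
    and ax: "\<And>E F. (E, F) \<in> Ax \<Longrightarrow> obj_of E \<in> OC \<and> obj_of F \<in> OC"
    and ex: "\<And>R C. Exists R C \<in> OC \<Longrightarrow> REx R C \<in> OR \<and> R \<in> OR \<and> C \<in> OC"
    and tb: "Top \<in> OC" "Bot \<in> OC" "RTop \<in> OR" "RBot \<in> OR"
    using assms unfolding ontology_objects_def by blast+
  have "(concept_arrow Ax OC OR C D \<longrightarrow> C \<in> OC \<and> D \<in> OC) \<and>
        (role_arrow Ax OC OR R S \<longrightarrow> R \<in> OR \<and> S \<in> OR)"
    by (rule concept_arrow_role_arrow.induct)
      (simp_all add: dc ax ex tb del: dom.simps cod.simps)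
  then show "concept_arrow Ax OC OR C D \<Longrightarrow> C \<in> OC \<and> D \<in> OC"
    and "role_arrow Ax OC OR R S \<Longrightarrow> R \<in> OR \<and> S \<in> OR"
    by blast+
qed

text \<open>
  Only the existence of arrows matters, so a category is a set of objects with a relation.
\<close>

record ('c, 'r) category_pair =
  concept_objects :: "('c, 'r) cobj set"
  role_objects :: "('c, 'r) robj set"
  concept_arrows :: "('c, 'r) cobj \<Rightarrow> ('c, 'r) cobj \<Rightarrow> bool"
  role_arrows :: "('c, 'r) robj \<Rightarrow> ('c, 'r) robj \<Rightarrow> bool"

definition ontology_category :: "'c set \<Rightarrow> 'r set \<Rightarrow> ('c, 'r) concept \<Rightarrow>
    ('c, 'r) concept_axiom set \<Rightarrow> ('c, 'r) category_pair \<Rightarrow> bool" where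
  "ontology_category CN RN C0 Ax K \<longleftrightarrow>
     ontology_objects CN RN C0 Ax (concept_objects K) (role_objects K) \<and>
     concept_arrows K = concept_arrow Ax (concept_objects K) (role_objects K) \<and>
     role_arrows K = role_arrow Ax (concept_objects K) (role_objects K)"

definition cat_unsatisfiable :: "'c set \<Rightarrow> 'r set \<Rightarrow> ('c, 'r) concept \<Rightarrow>
    ('c, 'r) concept_axiom set \<Rightarrow> bool" where
  "cat_unsatisfiable CN RN C0 Ax \<longleftrightarrow>
     (\<exists>K. ontology_category CN RN C0 Ax K \<and> concept_arrows K (obj_of C0) Bot)"


section \<open>Deterministic Turing machines and their space consumption\<close>

text \<open>
  Machines with several tapes.  Tapes are infinite to the right; moving left on cell 0 has no effect.
  Only finitely many symbols \<open>Aux i\<close> and finitely many states belong to a machine.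
\<close>

datatype 'a tape_symbol = Blank | Inp 'a | Aux nat

datatype move = MoveLeft | Stay | MoveRight

type_synonym 'a tape = "(nat \<Rightarrow> 'a tape_symbol) \<times> nat"

type_synonym 'a config = "nat \<times> 'a tape list"

record 'a tm =
  tapes :: nat
  states :: "nat set"
  symbols :: "'a tape_symbol set"
  start :: nat
  accept :: nat
  reject :: nat
  transition :: "nat \<Rightarrow> 'a tape_symbol list \<Rightarrow> nat \<times> ('a tape_symbol \<times> move) list"

definition turing_machine :: "'a tm \<Rightarrow> bool" where
  "turing_machine M \<longleftrightarrow>
     tapes M \<ge> 1 \<and>
     finite (states M) \<and> {start M, accept M, reject M} \<subseteq> states M \<and> accept M \<noteq> reject M \<and>
     finite (symbols M) \<and> Blank \<in> symbols M \<and> range Inp \<subseteq> symbols M \<and>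
     (\<forall>q\<in>states M. \<forall>ss. length ss = tapes M \<and> set ss \<subseteq> symbols M \<longrightarrow>
        fst (transition M q ss) \<in> states M \<and>
        length (snd (transition M q ss)) = tapes M \<and>
        fst ` set (snd (transition M q ss)) \<subseteq> symbols M)"

fun move_head :: "move \<Rightarrow> nat \<Rightarrow> nat" where
  "move_head MoveLeft h = h - 1"
| "move_head Stay h = h"
| "move_head MoveRight h = h + 1"

fun read_tape :: "'a tape \<Rightarrow> 'a tape_symbol" where
  "read_tape (f, h) = f h"

fun act_tape :: "'a tape_symbol \<times> move \<Rightarrow> 'a tape \<Rightarrow> 'a tape" where
  "act_tape (s, m) (f, h) = (f(h := s), move_head m h)"

fun step :: "'a tm \<Rightarrow> 'a config \<Rightarrow> 'a config" where
  "step M (q, ts) =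
     (if q = accept M \<or> q = reject M then (q, ts)
      else (let (q', acts) = transition M q (map read_tape ts) in (q', map2 act_tape acts ts)))"

definition input_tape :: "'a list \<Rightarrow> 'a tape" where
  "input_tape w = ((\<lambda>i. if i < length w then Inp (w ! i) else Blank), 0)"

definition initial_config :: "'a tm \<Rightarrow> 'a list \<Rightarrow> 'a config" where
  "initial_config M w = (start M, input_tape w # replicate (tapes M - 1) (input_tape []))"

definition config_at :: "'a tm \<Rightarrow> 'a list \<Rightarrow> nat \<Rightarrow> 'a config" where
  "config_at M w t = (step M ^^ t) (initial_config M w)"

definition accepts :: "'a tm \<Rightarrow> 'a list \<Rightarrow> bool" where
  "accepts M w \<longleftrightarrow> (\<exists>t. fst (config_at M w t) = accept M)"

definition rejects :: "'a tm \<Rightarrow> 'a list \<Rightarrow> bool" where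
  "rejects M w \<longleftrightarrow> (\<exists>t. fst (config_at M w t) = reject M)"

text \<open>
  Heads start on cell 0 and move by at most one cell at a time, so the following says that at
  most the first \<open>s\<close> cells of each tape are ever visited.
\<close>

definition runs_in_space :: "'a tm \<Rightarrow> 'a list \<Rightarrow> nat \<Rightarrow> bool" where
  "runs_in_space M w s \<longleftrightarrow> (\<forall>t. \<forall>(f, h)\<in>set (snd (config_at M w t)). h < s)"


section \<open>Representation of the input\<close>

text \<open>
  Names are natural numbers, written in binary with the least significant bit first; concepts are
  written in prefix notation.  A numeral is always followed by a token other than a bit (or the
  end of the input), so the representation is unambiguous.
\<close>

datatype token =
    TBit bool | TName | TTop | TBot | TNot | TAnd | TOr | TEx | TAll | TSub

fun encode_name :: "nat \<Rightarrow> token list" where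
  "encode_name n = (if n = 0 then [] else TBit (odd n) # encode_name (n div 2))"

declare encode_name.simps [simp del]

primrec encode_concept :: "(nat, nat) concept \<Rightarrow> token list" where
  "encode_concept (Atom a) = TName # encode_name a"
| "encode_concept CTop = [TTop]"
| "encode_concept CBot = [TBot]"
| "encode_concept (CNot C) = TNot # encode_concept C"
| "encode_concept (CAnd C D) = TAnd # encode_concept C @ encode_concept D"
| "encode_concept (COr C D) = TOr # encode_concept C @ encode_concept D"
| "encode_concept (CEx r C) = TEx # encode_name r @ encode_concept C"
| "encode_concept (CAll r C) = TAll # encode_name r @ encode_concept C"

text \<open>A finite ontology is presented by listing its axioms in any order.\<close>

definition encode_input :: "(nat, nat) concept \<Rightarrow> (nat, nat) concept_axiom list \<Rightarrow> token list" where
  "encode_input C0 axs =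
     encode_concept C0 @ concat (map (\<lambda>(E, F). TSub # encode_concept E @ encode_concept F) axs)"

end

theory Submission
  imports Defs "HOL-Library.Nat_Bijection"
begin

text \<open>
  Interpret a role as a set of pairs of a world \<open>w\<close> and a nonempty set \<open>N\<close> of worlds, and \<open>\<exists>R.C\<close> as
  the set of all \<open>w\<close> with \<open>(w, N) \<in> R\<close> for some \<open>N \<subseteq> C\<close>.  All arrows are sound for these
  neighbourhood models, because \<open>\<exists>R\<close> only has to be monotone and to preserve \<open>\<bottom>\<close>.  Conversely,
  the category of all objects over the signature is a Boolean algebra with monotone operators, and
  its ultrafilters yield a model if \<open>C\<^sub>0 \<longrightarrow> \<bottom>\<close> is not an arrow.  Only the truth values of the
  subconcepts matter, and for each pair of restrictions \<open>\<exists>R.C\<close>, \<open>\<exists>R.D\<close> one needs to know whether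
  some world satisfies \<open>C\<close> but not \<open>D\<close>.  Hence satisfiability is expressed by a second-order
  sentence over the input word with set quantifiers of arity at most 2 (the parse of the input, the
  equality of names, the realised pairs, the worlds).  Such a sentence is evaluated in space
  \<open>O(n\<^sup>2)\<close> by running through all positions and, with binary counters, through all relations.
\<close>

section \<open>Neighbourhood semantics\<close>

text \<open>In full \<open>ALC\<close> a witness of \<exists>R.C must satisfy, all together, the
  arguments of every \<forall>R.D true at its world, and exponentially many such combinations may
  have to be examined. This is why pairs of restrictions suffice and the table of realised pairs
  stays quadratic. The table and the worlds depend on each other, but no recursion results: the
  table is guessed, every truth assignment compatible with it may serve as a world, and checking one
  entry is a search for one assignment. Unsatisfiability asks for some category with an arrow to
  \<bottom>. Soundness must therefore cover every choice of objects, while completeness may use the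
  single category with all objects. The detour through a formula separates the logic from the
  machine: the Turing machine only has to evaluate quantifiers by exhaustive deterministic
  search.\<close>

primrec concept_ext :: "'w set \<Rightarrow> ('c \<Rightarrow> 'w set) \<Rightarrow> ('r \<Rightarrow> ('w \<times> 'w set) set) \<Rightarrow>
      ('c, 'r) cobj \<Rightarrow> 'w set"
  and role_ext :: "'w set \<Rightarrow> ('c \<Rightarrow> 'w set) \<Rightarrow> ('r \<Rightarrow> ('w \<times> 'w set) set) \<Rightarrow>
      ('c, 'r) robj \<Rightarrow> ('w \<times> 'w set) set" where
  "concept_ext W \<nu> \<rho> (CName a) = \<nu> a"
| "concept_ext W \<nu> \<rho> Top = W"
| "concept_ext W \<nu> \<rho> Bot = {}"
| "concept_ext W \<nu> \<rho> (Neg C) = W - concept_ext W \<nu> \<rho> C"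
| "concept_ext W \<nu> \<rho> (Conj C D) = concept_ext W \<nu> \<rho> C \<inter> concept_ext W \<nu> \<rho> D"
| "concept_ext W \<nu> \<rho> (Disj C D) = concept_ext W \<nu> \<rho> C \<union> concept_ext W \<nu> \<rho> D"
| "concept_ext W \<nu> \<rho> (Exists R C) = {w. \<exists>N. (w, N) \<in> role_ext W \<nu> \<rho> R \<and> N \<subseteq> concept_ext W \<nu> \<rho> C}"
| "concept_ext W \<nu> \<rho> (Forall R C) =
     W - {w. \<exists>N. (w, N) \<in> role_ext W \<nu> \<rho> R \<and> N \<subseteq> W - concept_ext W \<nu> \<rho> C}"
| "concept_ext W \<nu> \<rho> (DomName r) = fst ` \<rho> r"
| "concept_ext W \<nu> \<rho> (CodName r) = \<Union>(snd ` \<rho> r)"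
| "concept_ext W \<nu> \<rho> (DomEx R C) =
     fst ` {(w, N). (w, N) \<in> role_ext W \<nu> \<rho> R \<and> N \<subseteq> concept_ext W \<nu> \<rho> C}"
| "concept_ext W \<nu> \<rho> (CodEx R C) =
     \<Union>(snd ` {(w, N). (w, N) \<in> role_ext W \<nu> \<rho> R \<and> N \<subseteq> concept_ext W \<nu> \<rho> C})"
| "role_ext W \<nu> \<rho> (RName r) = \<rho> r"
| "role_ext W \<nu> \<rho> RTop = {(w, N). w \<in> W \<and> N \<subseteq> W \<and> N \<noteq> {}}"
| "role_ext W \<nu> \<rho> RBot = {}"
| "role_ext W \<nu> \<rho> (REx R C) = {(w, N). (w, N) \<in> role_ext W \<nu> \<rho> R \<and> N \<subseteq> concept_ext W \<nu> \<rho> C}"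

text \<open>The codomain of a role is the union of all second components \<open>N\<close>, so its
  inclusion in \<open>C\<close> says that every \<open>N\<close> lies in \<open>C\<close>.
  Nonemptiness of \<open>N\<close> is what makes \<open>cod_bot\<close> sound.\<close>

locale neighbourhood_model =
  fixes W :: "'w set" and \<nu> :: "'c \<Rightarrow> 'w set" and \<rho> :: "'r \<Rightarrow> ('w \<times> 'w set) set"
  assumes val_sub: "\<nu> a \<subseteq> W"
    and nbh_sub: "(w, N) \<in> \<rho> r \<Longrightarrow> w \<in> W \<and> N \<subseteq> W \<and> N \<noteq> {}"
begin

abbreviation "ce \<equiv> concept_ext W \<nu> \<rho>"
abbreviation "re \<equiv> role_ext W \<nu> \<rho>"

lemma ext_sub:
  shows "ce C \<subseteq> W" and "re R \<subseteq> re RTop"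
proof (induction C and R)
  case (CName a)
  show ?case by (simp add: val_sub)
next
  case (DomName r)
  show ?case by (auto dest: nbh_sub)
next
  case (CodName r)
  show ?case by (auto dest!: nbh_sub)
next
  case (RName r)
  show ?case by (auto dest!: nbh_sub)
next
  case (CodEx R C)
  have "N \<subseteq> W" if "(w, N) \<in> re R" for w N
    using CodEx.IH(1) that by auto
  then show ?case by fastforce
next
  case (DomEx R C)
  then show ?case by auto
qed auto

lemma nbh_nonempty: "(w, N) \<in> re R \<Longrightarrow> w \<in> W \<and> N \<subseteq> W \<and> N \<noteq> {}"
  using ext_sub(2) by fastforce

lemma dom_ext: "ce (dom R) = fst ` re R"
  by (cases R) auto

lemma cod_ext: "ce (cod R) = \<Union>(snd ` re R)"
  by (cases R) auto

text \<open>Induction on the arrow rules. \<open>OC\<close> and \<open>OR\<close> stay arbitrary, so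
  that one model refutes an arrow in all categories at once; role inclusion comes along because the
  two kinds of arrows are mutually inductive.\<close>

lemma arrow_sound:
  assumes "\<And>E F. (E, F) \<in> Ax \<Longrightarrow> ce (obj_of E) \<subseteq> ce (obj_of F)"
  shows "concept_arrow Ax OC OR C D \<Longrightarrow> ce C \<subseteq> ce D"
proof -
  have "(concept_arrow Ax OC OR C D \<longrightarrow> ce C \<subseteq> ce D) \<and> (role_arrow Ax OC OR R S \<longrightarrow> re R \<subseteq> re S)"
    for C D :: "('c, 'r) cobj" and R S
  \<comment> \<open>Cases are numbered in the order of the arrow rules; 12 is
    \<open>cod_bot\<close>, 23 is \<open>neg_greatest\<close>, 29 is
    \<open>ex_greatest\<close>.\<close>
  proof (rule concept_arrow_role_arrow.induct, goal_cases)
    case (6 R) then show ?case using ext_sub(2) by blast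
  next
    case (8 C) then show ?case using ext_sub(1) by simp
  next
    case (9 R R') then show ?case unfolding dom_ext by blast
  next
    case (10 R R') then show ?case unfolding cod_ext by blast
  next
    case (11 R) then show ?case unfolding dom_ext by auto
  next
    case (12 R)
    then show ?case unfolding cod_ext using nbh_nonempty by fastforce
  next
    case (13 E F) then show ?case by (rule assms)
  next
    case (23 X C) then show ?case using ext_sub(1)[of X] by auto
  next
    case (26 R C) show ?case unfolding cod_ext by auto
  next
    \<comment> \<open>\<open>cod R'\<close> contains every neighbourhood of \<open>R'\<close>, so a
      pair that witnesses membership in \<open>dom R'\<close> already belongs to
      \<open>REx R C\<close>.\<close>
    case (29 R C R')
    show ?case unfolding dom_ext
    proof
      fix w assume "w \<in> fst ` re R'"
      then obtain N where "(w, N) \<in> re R'" by force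
      moreover then have "N \<subseteq> ce C" using 29 by (force simp: cod_ext)
      ultimately have "(w, N) \<in> re (REx R C)" using 29 by auto
      then show "w \<in> fst ` re (REx R C)" by force
    qed
  next
    case (28 R C) show ?case unfolding dom_ext by force
  next
    case (27 R C) show ?case unfolding dom_ext by auto
  next
    case 20 show ?case by auto
  next
    case 24 then show ?case by auto
  next
    case 25 show ?case by auto
  qed simp_all
  then show "concept_arrow Ax OC OR C D \<Longrightarrow> ce C \<subseteq> ce D" by blast
qed

end

section \<open>The category of all objects over the signature\<close>

locale full_category =
  fixes CN :: "'c set" and RN :: "'r set" and C0 :: "('c, 'r) concept" and Ax :: "('c, 'r) concept_axiom set"
  assumes C0_signature: "over_signature CN RN C0"
    and Ax_signature: "(E, F) \<in> Ax \<Longrightarrow> over_signature CN RN E \<and> over_signature CN RN F"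
begin

text \<open>The largest possible choice of objects: negations, distributed disjunctions and role
  objects that the arrow rules want to be present are then always available.\<close>

definition OC :: "('c, 'r) cobj set" where
  "OC = {C. cobj_concept_names C \<subseteq> CN \<and> cobj_role_names C \<subseteq> RN}"

definition OR :: "('c, 'r) robj set" where
  "OR = {R. robj_concept_names R \<subseteq> CN \<and> robj_role_names R \<subseteq> RN}"

abbreviation carrow (infix "\<leadsto>" 50) where "C \<leadsto> D \<equiv> concept_arrow Ax OC OR C D"
abbreviation rarrow (infix "\<leadsto>\<^sub>r" 50) where "R \<leadsto>\<^sub>r S \<equiv> role_arrow Ax OC OR R S"

lemma obj_of_names:
  "cobj_concept_names (obj_of C) = concept_names C" "cobj_role_names (obj_of C) = role_names C"
  by (induction C) auto

lemma obj_of_OC: "over_signature CN RN C \<Longrightarrow> obj_of C \<in> OC"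
  by (simp add: OC_def over_signature_def obj_of_names)

lemma OC_simps [simp]:
  "Top \<in> OC" "Bot \<in> OC" "Neg C \<in> OC \<longleftrightarrow> C \<in> OC"
  "Conj C D \<in> OC \<longleftrightarrow> C \<in> OC \<and> D \<in> OC" "Disj C D \<in> OC \<longleftrightarrow> C \<in> OC \<and> D \<in> OC"
  "Exists R C \<in> OC \<longleftrightarrow> R \<in> OR \<and> C \<in> OC" "Forall R C \<in> OC \<longleftrightarrow> R \<in> OR \<and> C \<in> OC"
  "REx R C \<in> OR \<longleftrightarrow> R \<in> OR \<and> C \<in> OC" "RName r \<in> OR \<longleftrightarrow> r \<in> RN" "CName a \<in> OC \<longleftrightarrow> a \<in> CN"
  "RTop \<in> OR" "RBot \<in> OR"
  by (auto simp: OC_def OR_def)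

lemma full_objects: "ontology_objects CN RN C0 Ax OC OR"
proof -
  have "dom R \<in> OC \<and> cod R \<in> OC" if "R \<in> OR" for R
    using that by (cases R) (auto simp: OC_def OR_def)
  moreover have "(\<forall>C\<in>OC. cobj_concept_names C \<subseteq> CN \<and> cobj_role_names C \<subseteq> RN) \<and>
      (\<forall>R\<in>OR. robj_concept_names R \<subseteq> CN \<and> robj_role_names R \<subseteq> RN)"
    by (auto simp: OC_def OR_def)
  moreover have "obj_of C0 \<in> OC" "\<And>E F. (E, F) \<in> Ax \<Longrightarrow> obj_of E \<in> OC \<and> obj_of F \<in> OC"
    using obj_of_OC C0_signature Ax_signature by auto
  ultimately show ?thesis
    unfolding ontology_objects_def by auto
qed

lemmas arrow_OC = arrow_objects[OF full_objects]

lemma full_arrow_unsatisfiable: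
  assumes "obj_of C0 \<leadsto> Bot"
  shows "cat_unsatisfiable CN RN C0 Ax"
proof -
  have "ontology_category CN RN C0 Ax \<lparr>concept_objects = OC, role_objects = OR,
      concept_arrows = concept_arrow Ax OC OR, role_arrows = role_arrow Ax OC OR\<rparr>"
    by (simp add: ontology_category_def full_objects)
  then show ?thesis
    using assms unfolding cat_unsatisfiable_def by force
qed

lemma conj_swap: "C \<in> OC \<Longrightarrow> D \<in> OC \<Longrightarrow> Conj C D \<leadsto> Conj D C"
  by (simp add: conj_greatest conj_left conj_right)

text \<open>Excluded middle for \<open>D\<close> splits \<open>C\<close> by \<open>distrib\<close>
  into \<open>Conj C D\<close> and \<open>Conj C (Neg D)\<close>; the second part collapses.\<close>

lemma arrow_conj_Neg_Bot:
  assumes "C \<in> OC" "D \<in> OC" "Conj C (Neg D) \<leadsto> Bot"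
  shows "C \<leadsto> D"
proof -
  have "C \<leadsto> Disj D (Neg D)"
    by (meson OC_simps assms concept_comp concept_top neg_top)
  then have "C \<leadsto> Conj C (Disj D (Neg D))"
    using assms by (simp add: conj_greatest concept_id)
  moreover have "Conj C (Disj D (Neg D)) \<leadsto> Disj (Conj C D) (Conj C (Neg D))"
    using assms by (simp add: distrib)
  moreover have "Disj (Conj C D) (Conj C (Neg D)) \<leadsto> D"
    using assms by (intro disj_least) (auto intro: conj_right concept_comp[OF assms(3)] concept_bot)
  ultimately show ?thesis
    by (blast intro: concept_comp)
qed

text \<open>\<open>REx R C\<close> itself is a candidate in \<open>ex_greatest\<close> for
  \<open>D\<close>: its codomain lies below \<open>C\<close>, hence below \<open>D\<close>.\<close>

lemma Exists_mono:
  assumes "C \<leadsto> D" "R \<in> OR"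
  shows "Exists R C \<leadsto> Exists R D"
proof -
  have OC: "Exists R C \<in> OC" "Exists R D \<in> OC"
    using assms arrow_OC by auto
  have "dom (REx R C) \<leadsto> dom (REx R D)"
    using OC by (intro ex_greatest ex_role concept_comp[OF ex_cod assms(1)])
  with OC show ?thesis
    by (blast intro: concept_comp ex_dom1 ex_dom2)
qed

text \<open>If \<open>C\<close> collapses, so does \<open>cod (REx R C)\<close>, and
  \<open>cod_bot\<close> passes this on to the role and its domain. Together with monotonicity this
  is all that the completeness proof knows about \<exists>R.\<close>

lemma Exists_Bot:
  assumes "C \<leadsto> Bot" "R \<in> OR"
  shows "Exists R C \<leadsto> Bot"
proof -
  have OC: "Exists R C \<in> OC"
    using assms arrow_OC by auto
  have "REx R C \<leadsto>\<^sub>r RBot"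
    using OC by (intro cod_bot concept_comp[OF ex_cod assms(1)]) auto
  then have "dom (REx R C) \<leadsto> Bot"
    using dom_arrow by fastforce
  with OC show ?thesis
    by (blast intro: concept_comp ex_dom2)
qed

section \<open>Ultrafilters of the full category\<close>

definition proper_filter :: "('c, 'r) cobj set \<Rightarrow> bool" where
  "proper_filter F \<longleftrightarrow> F \<subseteq> OC \<and> Top \<in> F \<and> Bot \<notin> F \<and>
     (\<forall>X Y. X \<in> F \<longrightarrow> X \<leadsto> Y \<longrightarrow> Y \<in> F) \<and> (\<forall>X\<in>F. \<forall>Y\<in>F. Conj X Y \<in> F)"

definition ultra :: "('c, 'r) cobj set \<Rightarrow> bool" where
  "ultra F \<longleftrightarrow> proper_filter F \<and> (\<forall>X\<in>OC. X \<in> F \<or> Neg X \<in> F)"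

text \<open>The filter generated by \<open>F\<close> and \<open>X\<close> stays proper:
  \<open>Conj Y X \<leadsto> Bot\<close> with \<open>Y\<close> in \<open>F\<close> would put
  \<open>Neg X\<close> into \<open>F\<close> by \<open>neg_greatest\<close>.\<close>

lemma filter_extend:
  assumes F: "proper_filter F" and X: "X \<in> OC" "Neg X \<notin> F"
  shows "\<exists>G. proper_filter G \<and> F \<subseteq> G \<and> X \<in> G"
proof (intro exI conjI)
  let ?G = "{Z. \<exists>Y\<in>F. Conj Y X \<leadsto> Z}"
  have F_OC: "Y \<in> F \<Longrightarrow> Y \<in> OC" for Y
    using F by (auto simp: proper_filter_def)
  have T: "Top \<in> F" 
    using F by (auto simp: proper_filter_def)
  have nb: "\<not> Conj Y X \<leadsto> Bot" if "Y \<in> F" for Y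
  proof
    assume "Conj Y X \<leadsto> Bot"
    then have "Y \<leadsto> Neg X"
      using X that F_OC by (intro neg_greatest) (auto intro: concept_comp[OF conj_swap])
    then show False
      using F X that by (auto simp: proper_filter_def)
  qed
  have conj: "\<exists>Y\<in>F. Conj Y X \<leadsto> Conj Z Z'"
    if "Y1 \<in> F" "Conj Y1 X \<leadsto> Z" "Y2 \<in> F" "Conj Y2 X \<leadsto> Z'" for Y1 Y2 Z Z'
  proof (intro bexI)
    show Y: "Conj Y1 Y2 \<in> F"
      using F that by (auto simp: proper_filter_def)
    have oc: "Y1 \<in> OC" "Y2 \<in> OC" "Z \<in> OC" "Z' \<in> OC"
      using that F_OC arrow_OC by auto
    have "Conj (Conj Y1 Y2) X \<leadsto> Conj Y1 Y2" "Conj (Conj Y1 Y2) X \<leadsto> X"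
      "Conj Y1 Y2 \<leadsto> Y1" "Conj Y1 Y2 \<leadsto> Y2"
      using oc X by (auto intro: conj_left conj_right)
    then have "Conj (Conj Y1 Y2) X \<leadsto> Y1" "Conj (Conj Y1 Y2) X \<leadsto> Y2" "Conj (Conj Y1 Y2) X \<leadsto> X"
      by (blast intro: concept_comp)+
    then have "Conj (Conj Y1 Y2) X \<leadsto> Conj Y1 X" "Conj (Conj Y1 Y2) X \<leadsto> Conj Y2 X"
      using oc X by (auto intro!: conj_greatest)
    then have "Conj (Conj Y1 Y2) X \<leadsto> Z" "Conj (Conj Y1 Y2) X \<leadsto> Z'"
      using that concept_comp by blast+
    then show "Conj (Conj Y1 Y2) X \<leadsto> Conj Z Z'"
      using oc by (auto intro: conj_greatest)
  qed
  show "proper_filter ?G"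
    unfolding proper_filter_def
  proof (intro conjI allI impI ballI)
    show "Top \<in> ?G"
      using T X by (auto intro!: bexI[of _ Top] concept_top)
  next
    fix Z Z' assume "Z \<in> ?G" "Z' \<in> ?G" then show "Conj Z Z' \<in> ?G" using conj by blast
  qed (use nb arrow_OC concept_comp in blast)+
  show "F \<subseteq> ?G"
    using X F_OC conj_left by fastforce
  show "X \<in> ?G"
    using X T by (auto intro!: bexI[of _ Top] conj_right)
qed

text \<open>Zorn's lemma, started from the principal filter of \<open>C\<close>, which is proper
  because \<open>C\<close> has no arrow to \<open>Bot\<close>. By \<open>filter_extend\<close>, a
  maximal filter decides every object.\<close>

lemma ultra_exists:
  assumes "C \<in> OC" "\<not> C \<leadsto> Bot"
  shows "\<exists>F. ultra F \<and> C \<in> F"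
proof -
  let ?A = "{F. proper_filter F \<and> C \<in> F}"
  have "proper_filter {X. C \<leadsto> X}"
    unfolding proper_filter_def
  proof (intro conjI allI impI ballI)
    fix X Y assume "X \<in> {X. C \<leadsto> X}" "Y \<in> {X. C \<leadsto> X}"
    then show "Conj X Y \<in> {X. C \<leadsto> X}"
      using arrow_OC by (auto intro!: conj_greatest)
  qed (use assms arrow_OC in \<open>auto intro: concept_top concept_comp\<close>)
  then have ne: "?A \<noteq> {}"
    using assms concept_id by fastforce
  have "\<Union>K \<in> ?A" if "K \<noteq> {}" "subset.chain ?A K" for K
  proof -
    have ch: "\<And>F. F \<in> K \<Longrightarrow> proper_filter F \<and> C \<in> F" "\<And>F G. F \<in> K \<Longrightarrow> G \<in> K \<Longrightarrow> F \<subseteq> G \<or> G \<subseteq> F"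
      using that by (auto simp: subset_chain_def)
    have "Conj X Y \<in> \<Union>K" if "X \<in> F" "F \<in> K" "Y \<in> G" "G \<in> K" for X Y F G
      using that ch unfolding proper_filter_def by (meson UnionI subsetD)
    moreover obtain F0 where "F0 \<in> K"
      using \<open>K \<noteq> {}\<close> by blast
    then have "Top \<in> \<Union>K" "C \<in> \<Union>K"
      using ch(1)[of F0] by (auto simp: proper_filter_def)
    moreover have "\<Union>K \<subseteq> OC" "Bot \<notin> \<Union>K"
      using ch(1) unfolding proper_filter_def by blast+
    moreover have "Y \<in> \<Union>K" if "X \<in> \<Union>K" "X \<leadsto> Y" for X Y
      using that ch(1) unfolding proper_filter_def by blast
    ultimately show ?thesis
      unfolding proper_filter_def by blast
  qed
  from subset_Zorn_nonempty[OF ne this] obtain F where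
    F: "proper_filter F" "C \<in> F" and max: "\<And>G. proper_filter G \<Longrightarrow> C \<in> G \<Longrightarrow> F \<subseteq> G \<Longrightarrow> G = F"
    by blast
  have "X \<in> F \<or> Neg X \<in> F" if "X \<in> OC" for X
    using filter_extend[OF F(1) that] max F(2) by blast
  then show ?thesis
    using F by (auto simp: ultra_def)
qed

lemma ultra_separates:
  assumes "C \<in> OC" "D \<in> OC" "\<not> C \<leadsto> D"
  shows "\<exists>F. ultra F \<and> C \<in> F \<and> Neg D \<in> F"
proof -
  have "\<not> Conj C (Neg D) \<leadsto> Bot"
    using arrow_conj_Neg_Bot assms by blast
  then obtain F where F: "ultra F" "Conj C (Neg D) \<in> F"
    using ultra_exists[of "Conj C (Neg D)"] assms by auto
  have "Conj C (Neg D) \<leadsto> C" "Conj C (Neg D) \<leadsto> Neg D"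
    using assms by (auto intro: conj_left conj_right)
  with F show ?thesis
    by (auto simp: ultra_def proper_filter_def)
qed

context
  fixes F assumes F: "ultra F"
begin

lemma ultra_up: "X \<in> F \<Longrightarrow> X \<leadsto> Y \<Longrightarrow> Y \<in> F"
  using F by (auto simp: ultra_def proper_filter_def)

lemma ultra_Top: "Top \<in> F" and ultra_Bot: "Bot \<notin> F"
  using F by (auto simp: ultra_def proper_filter_def)

lemma ultra_Neg: 
  assumes "X \<in> OC"
  shows "Neg X \<in> F \<longleftrightarrow> X \<notin> F"
proof -
  have "Conj X (Neg X) \<leadsto> Bot"
    using assms by (intro neg_bot) auto
  then have "\<not> (X \<in> F \<and> Neg X \<in> F)"
    using F by (auto simp: ultra_def proper_filter_def)
  then show ?thesis
    using F assms by (auto simp: ultra_def)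
qed

lemma ultra_Conj:
  assumes "X \<in> OC" "Y \<in> OC"
  shows "Conj X Y \<in> F \<longleftrightarrow> X \<in> F \<and> Y \<in> F"
proof -
  have "Conj X Y \<leadsto> X" "Conj X Y \<leadsto> Y"
    using assms by (auto intro: conj_left conj_right)
  then show ?thesis
    using F by (auto simp: ultra_def proper_filter_def)
qed

lemma ultra_Disj:
  assumes "X \<in> OC" "Y \<in> OC"
  shows "Disj X Y \<in> F \<longleftrightarrow> X \<in> F \<or> Y \<in> F"
proof
  assume "X \<in> F \<or> Y \<in> F"
  then show "Disj X Y \<in> F"
    using assms ultra_up by (meson OC_simps disj_left disj_right)
next
  \<comment> \<open>If neither disjunct were in \<open>F\<close>, then \<open>?Z\<close> would be;
    distributing it over the disjunction leaves two contradictions.\<close>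
  let ?Z = "Conj (Neg X) (Neg Y)"
  assume D: "Disj X Y \<in> F"
  have "\<not> ?Z \<in> F"
  proof
    assume "?Z \<in> F"
    with D have "Conj ?Z (Disj X Y) \<in> F"
      using assms by (auto simp: ultra_Conj)
    moreover have "Conj ?Z (Disj X Y) \<leadsto> Disj (Conj ?Z X) (Conj ?Z Y)"
      using assms by (intro distrib) auto
    moreover have "Conj ?Z X \<leadsto> ?Z" "Conj ?Z Y \<leadsto> ?Z" "?Z \<leadsto> Neg X" "?Z \<leadsto> Neg Y"
        "Conj ?Z X \<leadsto> X" "Conj ?Z Y \<leadsto> Y"
      using assms by (auto intro: conj_left conj_right)
    then have "Conj ?Z X \<leadsto> Conj X (Neg X)" "Conj ?Z Y \<leadsto> Conj Y (Neg Y)"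
      using assms by (auto intro!: conj_greatest intro: concept_comp)
    then have "Disj (Conj ?Z X) (Conj ?Z Y) \<leadsto> Bot"
      using assms by (intro disj_least) (auto intro: concept_comp[OF _ neg_bot])
    ultimately show False
      using ultra_up ultra_Bot by blast
  qed
  then show "X \<in> F \<or> Y \<in> F"
    using assms by (auto simp: ultra_Conj ultra_Neg)
qed

lemma ultra_Forall:
  assumes "R \<in> OR" "C \<in> OC"
  shows "Forall R C \<in> F \<longleftrightarrow> Exists R (Neg C) \<notin> F"
proof -
  have "Forall R C \<leadsto> Neg (Exists R (Neg C))" "Neg (Exists R (Neg C)) \<leadsto> Forall R C"
    using assms by (auto intro: all_neg1 all_neg2)
  then have "Forall R C \<in> F \<longleftrightarrow> Neg (Exists R (Neg C)) \<in> F"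
    using ultra_up by blast
  then show ?thesis
    using assms ultra_Neg by simp
qed

end

end

section \<open>While programs on several tapes\<close>

type_synonym test = "(nat \<times> token tape_symbol set) list"

text \<open>Tests inspect only the symbols under the heads and there are no procedures, so a command
  needs only finitely many control states.\<close>

datatype com =
    Move nat move
  | Write nat "token tape_symbol"
  | Seq com com  (infixr ";;" 60)
  | If test com com
  | While test com

text \<open>The contents of the tapes and the positions of the heads.\<close>

type_synonym mem = "(nat \<Rightarrow> nat \<Rightarrow> token tape_symbol) \<times> (nat \<Rightarrow> nat)"

definition holds :: "test \<Rightarrow> (nat \<Rightarrow> token tape_symbol) \<Rightarrow> bool" where
  "holds b ss \<longleftrightarrow> (\<forall>(i, A)\<in>set b. ss i \<in> A)"

definition scan :: "mem \<Rightarrow> nat \<Rightarrow> token tape_symbol" where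
  "scan m i = fst m i (snd m i)"

definition fits :: "nat \<Rightarrow> mem \<Rightarrow> bool" where
  "fits s m \<longleftrightarrow> (\<forall>i. snd m i < s)"

text \<open>Big-step semantics with the space bound built in: a derivation exists only if the run
  terminates and no head ever leaves the first \<open>s\<close> cells.\<close>

inductive exec :: "nat \<Rightarrow> com \<Rightarrow> mem \<Rightarrow> mem \<Rightarrow> bool" for s where
  Move: "fits s (C, h) \<Longrightarrow> h' = h(i := move_head d (h i)) \<Longrightarrow> fits s (C, h') \<Longrightarrow>
    exec s (Move i d) (C, h) (C, h')"
| Write: "fits s (C, h) \<Longrightarrow> C' = C(i := (C i)(h i := a)) \<Longrightarrow> exec s (Write i a) (C, h) (C', h)"
| Seq: "exec s c m m' \<Longrightarrow> exec s d m' m'' \<Longrightarrow> exec s (c ;; d) m m''"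
| IfTrue: "fits s m \<Longrightarrow> holds b (scan m) \<Longrightarrow> exec s c m m' \<Longrightarrow> exec s (If b c d) m m'"
| IfFalse: "fits s m \<Longrightarrow> \<not> holds b (scan m) \<Longrightarrow> exec s d m m' \<Longrightarrow> exec s (If b c d) m m'"
| WhileTrue: "fits s m \<Longrightarrow> holds b (scan m) \<Longrightarrow> exec s c m m' \<Longrightarrow> exec s (While b c) m' m'' \<Longrightarrow>
    exec s (While b c) m m''"
| WhileFalse: "fits s m \<Longrightarrow> \<not> holds b (scan m) \<Longrightarrow> exec s (While b c) m m"

lemma exec_fits: "exec s c m m' \<Longrightarrow> fits s m \<and> fits s m'"
  by (induction rule: exec.induct) (auto simp: fits_def)

primrec tapes_below :: "nat \<Rightarrow> com \<Rightarrow> bool" where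
  "tapes_below K (Move i d) \<longleftrightarrow> i < K"
| "tapes_below K (Write i a) \<longleftrightarrow> i < K"
| "tapes_below K (c ;; d) \<longleftrightarrow> tapes_below K c \<and> tapes_below K d"
| "tapes_below K (If b c d) \<longleftrightarrow> (\<forall>(i, A)\<in>set b. i < K) \<and> tapes_below K c \<and> tapes_below K d"
| "tapes_below K (While b c) \<longleftrightarrow> (\<forall>(i, A)\<in>set b. i < K) \<and> tapes_below K c"

primrec written :: "com \<Rightarrow> token tape_symbol set" where
  "written (Move i d) = {}"
| "written (Write i a) = {a}"
| "written (c ;; d) = written c \<union> written d"
| "written (If b c d) = written c \<union> written d"
| "written (While b c) = written c"

lemma finite_written: "finite (written c)"
  by (induction c) auto

section \<open>Compilation to Turing machines\<close>

text \<open>A control state is the list of commands that remain to be executed.\<close>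

fun control :: "com list \<Rightarrow> (nat \<Rightarrow> token tape_symbol) \<Rightarrow> com list" where
  "control [] ss = []"
| "control (Move i d # k) ss = k"
| "control (Write i a # k) ss = k"
| "control ((c ;; d) # k) ss = c # d # k"
| "control (If b c d # k) ss = (if holds b ss then c # k else d # k)"
| "control (While b c # k) ss = (if holds b ss then c # While b c # k else k)"

fun action :: "com list \<Rightarrow> (nat \<Rightarrow> token tape_symbol) \<Rightarrow> nat \<Rightarrow> token tape_symbol \<times> move" where
  "action (Move i d # k) ss j = (ss j, if j = i then d else Stay)"
| "action (Write i a # k) ss j = (if j = i then a else ss j, Stay)"
| "action _ ss j = (ss j, Stay)"

text \<open>The small-step counterpart on a memory with infinitely many tapes. The empty list is a
  fixed point, so a run may be continued beyond its end.\<close>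

definition mstep :: "com list \<times> mem \<Rightarrow> com list \<times> mem" where
  "mstep = (\<lambda>(k, C, h). (control k (scan (C, h)),
     (\<lambda>i. (C i)(h i := fst (action k (scan (C, h)) i))),
     (\<lambda>i. move_head (snd (action k (scan (C, h)) i)) (h i))))"

lemma mstep_simps [simp]:
  "mstep (Move i mv # k, C, h) = (k, C, h(i := move_head mv (h i)))"
  "mstep (Write i a # k, C, h) = (k, C(i := (C i)(h i := a)), h)"
  "mstep ((c ;; d) # k, m) = (c # d # k, m)"
  "mstep (If b c d # k, m) = (if holds b (scan m) then c # k else d # k, m)"
  "mstep (While b c # k, m) = (if holds b (scan m) then c # While b c # k else k, m)"
  "mstep ([], m) = ([], m)"
  by (cases m; auto simp: mstep_def scan_def fun_eq_iff)+

inductive reaches :: "nat \<Rightarrow> com list \<times> mem \<Rightarrow> com list \<times> mem \<Rightarrow> bool" for s where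
  reaches_refl: "fits s (snd x) \<Longrightarrow> reaches s x x"
| reaches_step: "fits s (snd x) \<Longrightarrow> reaches s (mstep x) y \<Longrightarrow> reaches s x y"

lemma reaches_trans: "reaches s x y \<Longrightarrow> reaches s y z \<Longrightarrow> reaches s x z"
  by (induction rule: reaches.induct) (auto intro: reaches_step)

lemma reaches_funpow:
  "reaches s x y \<Longrightarrow> \<exists>t. (mstep ^^ t) x = y \<and> (\<forall>u\<le>t. fits s (snd ((mstep ^^ u) x)))"
proof (induction rule: reaches.induct)
  case (reaches_refl x)
  then show ?case by (intro exI[of _ 0]) auto
next
  case (reaches_step x y)
  then obtain t where t: "(mstep ^^ t) (mstep x) = y" "\<forall>u\<le>t. fits s (snd ((mstep ^^ u) (mstep x)))"
    by blast
  have "fits s (snd ((mstep ^^ u) x))" if "u \<le> Suc t" for u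
  proof (cases u)
    case (Suc v)
    then have "(mstep ^^ u) x = (mstep ^^ v) (mstep x)"
      by (simp add: funpow_swap1)
    then show ?thesis using t(2) Suc that by auto
  qed (use reaches_step.hyps in auto)
  then show ?case
    using t(1) by (intro exI[of _ "Suc t"]) (simp add: funpow_swap1)
qed

lemma exec_reaches: "exec s c m m' \<Longrightarrow> reaches s (c # k, m) (k, m')"
proof (induction arbitrary: k rule: exec.induct)
  case (Seq c m m' d m'')
  have "reaches s (c # d # k, m) (k, m'')"
    using Seq.IH reaches_trans by blast
  with exec_fits[OF Seq(1)] show ?case
    by (simp add: reaches_step)
next
  case (WhileTrue m b c m' m'')
  have "reaches s (c # While b c # k, m) (k, m'')"
    using WhileTrue.IH reaches_trans by blast
  with WhileTrue show ?case
    by (simp add: reaches_step)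
qed (rule reaches_step; simp add: reaches_refl fits_def)+

text \<open>All control lists that can occur while \<open>c\<close> runs on top of \<open>k\<close>,
  except \<open>k\<close> itself. The set is finite because a loop pushes itself back onto an
  unchanged \<open>k\<close>.\<close>

fun conts :: "com \<Rightarrow> com list \<Rightarrow> com list set" where
  "conts (c ;; d) k = insert ((c ;; d) # k) (conts c (d # k) \<union> conts d k)"
| "conts (If b c d) k = insert (If b c d # k) (conts c k \<union> conts d k)"
| "conts (While b c) k = insert (While b c # k) (conts c (While b c # k))"
| "conts c k = {c # k}"

lemma finite_conts: "finite (conts c k)"
  by (induction c k rule: conts.induct) auto

lemma conts_start: "c # k \<in> conts c k"
  by (cases c) auto

lemma control_conts: "l \<in> conts c k \<Longrightarrow> control l ss \<in> insert k (conts c k)"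
  by (induction c k rule: conts.induct) (auto simp: conts_start split: if_splits)

lemma action_written:
  "l \<in> conts c k \<Longrightarrow> fst (action l ss j) \<in> insert (ss j) (written c)"
  by (induction c k rule: conts.induct) auto

lemma holds_cong:
  "\<forall>(i, A)\<in>set b. i < K \<Longrightarrow> (\<And>i. i < K \<Longrightarrow> ss i = ss' i) \<Longrightarrow> holds b ss = holds b ss'"
  unfolding holds_def by (fastforce split: prod.splits)

lemma action_conts_below:
  "l \<in> conts c k \<Longrightarrow> tapes_below K c \<Longrightarrow> (\<And>i. i < K \<Longrightarrow> ss i = ss' i) \<Longrightarrow>
    control l ss = control l ss' \<and> (\<forall>j<K. action l ss j = action l ss' j)"
  by (induction c k rule: conts.induct) (auto simp: holds_cong[where ss = ss and ss' = ss'])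

definition tm_states :: "com \<Rightarrow> com list set" where
  "tm_states c = insert [] (conts c [])"

definition code :: "com \<Rightarrow> com list \<Rightarrow> nat" where
  "code c = (SOME f. bij_betw f (tm_states c) {..<card (tm_states c)})"

lemma finite_tm_states: "finite (tm_states c)"
  by (simp add: tm_states_def finite_conts)

lemma code_bij: "bij_betw (code c) (tm_states c) {..<card (tm_states c)}"
proof -
  obtain f where "bij_betw f (tm_states c) {0..<card (tm_states c)}"
    using ex_bij_betw_finite_nat[OF finite_tm_states] by blast
  then have "\<exists>f. bij_betw f (tm_states c) {..<card (tm_states c)}"
    by (auto simp: lessThan_atLeast0)
  then show ?thesis
    unfolding code_def by (rule someI_ex)
qed

definition decode :: "com \<Rightarrow> nat \<Rightarrow> com list" where
  "decode c = the_inv_into (tm_states c) (code c)"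

lemma decode_code: "k \<in> tm_states c \<Longrightarrow> decode c (code c k) = k"
  using code_bij[of c] by (simp add: decode_def bij_betw_def the_inv_into_f_f)

lemma decode_in: "q < card (tm_states c) \<Longrightarrow> decode c q \<in> tm_states c"
  using code_bij[of c] by (auto simp: decode_def bij_betw_def intro: the_inv_into_into)

lemma code_less: "k \<in> tm_states c \<Longrightarrow> code c k < card (tm_states c)"
  using code_bij[of c] by (auto simp: bij_betw_def)

lemma control_tm_states: "l \<in> tm_states c \<Longrightarrow> control l ss \<in> tm_states c"
  using control_conts unfolding tm_states_def by fastforce

text \<open>Turns the list read by the machine into a function on all tapes;
  \<open>action_conts_below\<close> shows that padding with \<open>Blank\<close> is safe.\<close>

definition cut :: "token tape_symbol list \<Rightarrow> nat \<Rightarrow> token tape_symbol" where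
  "cut ss i = (if i < length ss then ss ! i else Blank)"

text \<open>Codes of control lists are below \<open>N\<close>, which leaves \<open>N\<close> and
  \<open>N + 1\<close> for the halting states. The convention for the answer is \<open>Aux 1\<close>
  under the head of tape 1 once no command is left.\<close>

definition compile :: "nat \<Rightarrow> com \<Rightarrow> token tm" where
  "compile K c = (let N = card (tm_states c) in
     \<lparr>tapes = K, states = {..N + 1}, symbols = {Blank, Aux 1} \<union> range Inp \<union> written c,
      start = code c [c], accept = N, reject = N + 1,
      transition = (\<lambda>q ss.
        if q < N \<and> decode c q \<noteq> []
        then (code c (control (decode c q) (cut ss)), map (action (decode c q) (cut ss)) [0..<K])
        else (if cut ss 1 = Aux 1 then N else N + 1, map (\<lambda>a. (a, Stay)) ss))\<rparr>)"

lemma finite_tokens: "finite (UNIV :: token set)"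
proof -
  have "(UNIV :: token set) \<subseteq> range TBit \<union> {TName, TTop, TBot, TNot, TAnd, TOr, TEx, TAll, TSub}"
  proof
    fix x :: token
    show "x \<in> range TBit \<union> {TName, TTop, TBot, TNot, TAnd, TOr, TEx, TAll, TSub}"
      by (cases x) auto
  qed
  then show ?thesis
    by (rule finite_subset) auto
qed

lemma turing_machine_compile:
  assumes "K \<ge> 1"
  shows "turing_machine (compile K c)"
  unfolding turing_machine_def
proof (intro conjI ballI allI impI; (elim conjE)?)
  let ?N = "card (tm_states c)"
  have c: "[c] \<in> tm_states c"
    by (simp add: tm_states_def conts_start)
  show "{start (compile K c), accept (compile K c), reject (compile K c)} \<subseteq> states (compile K c)"
    using code_less[OF c] by (auto simp: compile_def Let_def)
  show "finite (symbols (compile K c))"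
    using finite_tokens by (auto simp: compile_def Let_def finite_written)
  fix q ss
  assume q: "q \<in> states (compile K c)" and ss: "length ss = tapes (compile K c)" "set ss \<subseteq> symbols (compile K c)"
  show "fst (transition (compile K c) q ss) \<in> states (compile K c)"
    using code_less[OF control_tm_states[OF decode_in], of q c "cut ss"]
    by (auto simp: compile_def Let_def)
  show "length (snd (transition (compile K c) q ss)) = tapes (compile K c)"
    using ss by (auto simp: compile_def Let_def)
  have "fst (action (decode c q) (cut ss) j) \<in> symbols (compile K c)" if "j < K" "q < ?N" for j
  proof -
    have "fst (action (decode c q) (cut ss) j) \<in> insert (cut ss j) (written c)"
      using decode_in[OF that(2)] action_written[of "decode c q" c "[]" "cut ss" j]
      by (auto simp: tm_states_def)
    moreover have "cut ss j \<in> symbols (compile K c)"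
      using ss that nth_mem[of j ss] by (auto simp: cut_def compile_def Let_def simp del: nth_mem)
    ultimately show ?thesis
      by (auto simp: compile_def Let_def)
  qed
  moreover have "fst ` (\<lambda>a. (a, Stay)) ` set ss = set ss"
    by force
  moreover have "snd (transition (compile K c) q ss) = map (action (decode c q) (cut ss)) [0..<K] \<and> q < ?N \<or>
      snd (transition (compile K c) q ss) = map (\<lambda>a. (a, Stay)) ss"
    by (auto simp: compile_def Let_def)
  ultimately show "fst ` set (snd (transition (compile K c) q ss)) \<subseteq> symbols (compile K c)"
    using ss(2) by auto (metis fst_conv)
qed (use assms in \<open>auto simp: compile_def Let_def\<close>)

definition config_of :: "nat \<Rightarrow> com \<Rightarrow> com list \<times> mem \<Rightarrow> token config" where
  "config_of K c = (\<lambda>(k, C, h). (code c k, map (\<lambda>i. (C i, h i)) [0..<K]))"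

lemma step_config_of:
  assumes K: "tapes_below K c" and k: "k \<in> tm_states c" "k \<noteq> []"
  shows "step (compile K c) (config_of K c (k, C, h)) = config_of K c (mstep (k, C, h))"
proof -
  let ?ss = "map (\<lambda>i. C i (h i)) [0..<K]"
  have "k \<in> conts c []"
    using k by (auto simp: tm_states_def)
  then have eq: "control k (cut ?ss) = control k (scan (C, h)) \<and>
      (\<forall>j<K. action k (cut ?ss) j = action k (scan (C, h)) j)"
    by (rule action_conts_below[OF _ K]) (simp add: cut_def scan_def)
  have read: "map read_tape (map (\<lambda>i. (C i, h i)) [0..<K]) = ?ss"
    by simp
  have act: "map2 act_tape (map (action k (cut ?ss)) [0..<K]) (map (\<lambda>i. (C i, h i)) [0..<K]) =
      map (\<lambda>i. ((C i)(h i := fst (action k (scan (C, h)) i)), move_head (snd (action k (scan (C, h)) i)) (h i))) [0..<K]"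
  proof (rule nth_equalityI)
    fix i assume "i < length (map2 act_tape (map (action k (cut ?ss)) [0..<K]) (map (\<lambda>i. (C i, h i)) [0..<K]))"
    with eq show "map2 act_tape (map (action k (cut ?ss)) [0..<K]) (map (\<lambda>i. (C i, h i)) [0..<K]) ! i =
        map (\<lambda>i. ((C i)(h i := fst (action k (scan (C, h)) i)), move_head (snd (action k (scan (C, h)) i)) (h i))) [0..<K] ! i"
      by (cases "action k (scan (C, h)) i") simp
  qed simp
  show ?thesis
    using code_less[OF k(1)] k(2) eq decode_code[OF k(1)] act
    by (simp add: config_of_def compile_def Let_def mstep_def read del: map_map)
qed

theorem compile_correct:
  assumes K: "tapes_below K c" "K \<ge> 2"
    and init: "initial_config (compile K c) w = config_of K c ([c], m)"
    and ex: "exec s c m m'"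
  shows "accepts (compile K c) w \<longleftrightarrow> scan m' 1 = Aux 1"
    and "rejects (compile K c) w \<longleftrightarrow> scan m' 1 \<noteq> Aux 1"
    and "runs_in_space (compile K c) w s"
proof -
  let ?M = "compile K c" and ?N = "card (tm_states c)"
  obtain T where T: "(mstep ^^ T) ([c], m) = ([], m')" "\<forall>u\<le>T. fits s (snd ((mstep ^^ u) ([c], m)))"
    using reaches_funpow[OF exec_reaches[OF ex]] by blast
  \<comment> \<open>The simulation works only while commands remain, so it is followed up to the
    first empty list. The memory does not change afterwards and hence is \<open>m'\<close> already
    at \<open>t0\<close>.\<close>
  define t0 where "t0 = (LEAST t. fst ((mstep ^^ t) ([c], m)) = [])"
  have t0: "fst ((mstep ^^ t0) ([c], m)) = []" and le: "t0 \<le> T"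
    using LeastI[of "\<lambda>t. fst ((mstep ^^ t) ([c], m)) = []" T] T(1) 
      Least_le[of "\<lambda>t. fst ((mstep ^^ t) ([c], m)) = []" T] by (auto simp: t0_def)
  have ne: "fst ((mstep ^^ t) ([c], m)) \<noteq> []" if "t < t0" for t
    using that not_less_Least by (auto simp: t0_def)
  have halted: "(mstep ^^ d) ([], m'') = ([], m'')" for d m''
    by (induction d) auto
  obtain d where "T = d + t0"
    using le by (metis add.commute le_iff_add)
  then have "(mstep ^^ T) ([c], m) = (mstep ^^ d) ((mstep ^^ t0) ([c], m))"
    by (simp add: funpow_add)
  also have "\<dots> = (mstep ^^ t0) ([c], m)"
    using t0 halted by (cases "(mstep ^^ t0) ([c], m)") simp
  finally have fin: "(mstep ^^ t0) ([c], m) = ([], m')"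
    using T by simp
  have st: "fst ((mstep ^^ t) ([c], m)) \<in> tm_states c" for t
  proof (induction t)
    case (Suc t)
    then show ?case
      by (cases "(mstep ^^ t) ([c], m)") (auto simp: mstep_def control_tm_states)
  qed (simp add: tm_states_def conts_start)
  have sim: "config_at ?M w t = config_of K c ((mstep ^^ t) ([c], m))" if "t \<le> t0" for t
    using that
  proof (induction t)
    case (Suc t)
    then have "config_at ?M w (Suc t) = step ?M (config_of K c ((mstep ^^ t) ([c], m)))"
      by (simp add: config_at_def)
    also have "\<dots> = config_of K c (mstep ((mstep ^^ t) ([c], m)))"
      using step_config_of[OF K(1) st[of t] ne[of t], of "fst (snd ((mstep ^^ t) ([c], m)))" "snd (snd ((mstep ^^ t) ([c], m)))"]
        Suc.prems by simp
    finally show ?case by simp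
  qed (simp add: config_at_def init)
  define q where "q = (if scan m' 1 = Aux 1 then accept ?M else reject ?M)"
  obtain C h where m': "m' = (C, h)" by (cases m')
  \<comment> \<open>One additional step is spent on reading tape 1 and entering a halting
    state.\<close>
  have last: "config_at ?M w (Suc t0) = (q, snd (config_of K c ([], m')))"
  proof -
    have nil: "[] \<in> tm_states c" by (simp add: tm_states_def)
    have "config_at ?M w (Suc t0) = step ?M (config_of K c ([], m'))"
      using sim[of t0] fin by (simp add: config_at_def)
    also have "\<dots> = (q, snd (config_of K c ([], m')))"
      using code_less[OF nil] decode_code[OF nil] K(2)
      by (auto simp: q_def m' config_of_def compile_def Let_def cut_def scan_def zip_map1 zip_map2 zip_same_conv_map)
    finally show ?thesis .
  qed
  have "config_at ?M w (Suc t0 + d) = (q, snd (config_of K c ([], m')))" for d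
  proof (induction d)
    case (Suc d)
    then show ?case by (auto simp: config_at_def q_def)
  qed (simp add: last)
  then have late: "config_at ?M w t = (q, snd (config_of K c ([], m')))" if "t > t0" for t
    using that by (metis Suc_leI le_iff_add)
  have early: "fst (config_at ?M w t) \<noteq> accept ?M \<and> fst (config_at ?M w t) \<noteq> reject ?M" if "t \<le> t0" for t
    using sim[OF that] code_less[OF st[of t]]
    by (auto simp: config_of_def compile_def Let_def case_prod_beta)
  have dist: "accept ?M \<noteq> reject ?M"
    by (simp add: compile_def Let_def)
  have reach: "(\<exists>t. fst (config_at ?M w t) = x) \<longleftrightarrow> q = x" if "x = accept ?M \<or> x = reject ?M" for x
    using early late that by (metis fst_conv gt_ex leI)
  show "accepts ?M w \<longleftrightarrow> scan m' 1 = Aux 1" "rejects ?M w \<longleftrightarrow> scan m' 1 \<noteq> Aux 1"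
    unfolding accepts_def rejects_def using reach dist by (auto simp: q_def)
  have heads: "h < s" if "(f, h) \<in> set (snd (config_of K c x))" "fits s (snd x)" for f h x
    using that by (cases x) (auto simp: config_of_def fits_def)
  show "runs_in_space ?M w s"
    unfolding runs_in_space_def
  proof (intro allI ballI, clarify)
    fix t f h assume fh: "(f, h) \<in> set (snd (config_at ?M w t))"
    show "h < s"
    proof (cases "t \<le> t0")
      case True
      moreover have "fits s (snd ((mstep ^^ t) ([c], m)))"
        using T(2) True le by auto
      ultimately show ?thesis
        using heads fh sim by metis
    next
      case False
      then show ?thesis
        using heads[of f h "([], m')"] fh late[of t] exec_fits[OF ex] by simp
    qed
  qed
qed

section \<open>Head movements\<close>

text \<open>\<open>LE\<close> and \<open>RE\<close> mark the two ends of the used part of a tape.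
  The left mark is essential: moving left on cell 0 has no effect, so the end can be noticed only by
  its symbol. \<open>One\<close> is both the binary digit 1 and the positive answer.\<close>

abbreviation LE :: "token tape_symbol" where "LE \<equiv> Aux 2"
abbreviation RE :: "token tape_symbol" where "RE \<equiv> Aux 3"
abbreviation One :: "token tape_symbol" where "One \<equiv> Aux 1"

abbreviation skip :: com where "skip \<equiv> Move 0 Stay"

primrec moves :: "move \<Rightarrow> nat list \<Rightarrow> com" where
  "moves d [] = skip"
| "moves d (t # ts) = Move t d ;; moves d ts"

text \<open>Head positions serve as unary counters: the value of \<open>a\<close> is added to the
  counters \<open>us\<close>, subtracted from the counters \<open>ds\<close>, and \<open>a\<close>
  is reset.\<close>

definition shift :: "nat \<Rightarrow> nat list \<Rightarrow> nat list \<Rightarrow> com" where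
  "shift a us ds = While [(a, -{LE})] (Move a MoveLeft ;; moves MoveRight us ;; moves MoveLeft ds)"

lemma exec_Move:
  "\<forall>j. h j < s \<Longrightarrow> move_head d (h i) < s \<Longrightarrow> h' = h(i := move_head d (h i)) \<Longrightarrow>
    exec s (Move i d) (C, h) (C, h')"
  by (rule exec.Move) (auto simp: fits_def)

lemma exec_skip: "\<forall>j. h j < s \<Longrightarrow> exec s skip (C, h) (C, h)"
  by (rule exec_Move) auto

lemma exec_Write:
  "\<forall>j. h j < s \<Longrightarrow> C' = C(i := (C i)(h i := a)) \<Longrightarrow> exec s (Write i a) (C, h) (C', h)"
  by (rule exec.Write) (auto simp: fits_def)

lemma exec_moves_right:
  "\<forall>j. h j < s \<Longrightarrow> distinct ts \<Longrightarrow> \<forall>i\<in>set ts. Suc (h i) < s \<Longrightarrow>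
    exec s (moves MoveRight ts) (C, h) (C, \<lambda>i. if i \<in> set ts then Suc (h i) else h i)"
proof (induction ts arbitrary: h)
  case Nil
  then show ?case by (simp add: exec_skip)
next
  case (Cons t ts)
  have "exec s (moves MoveRight ts) (C, h(t := Suc (h t)))
      (C, \<lambda>i. if i \<in> set ts then Suc ((h(t := Suc (h t))) i) else (h(t := Suc (h t))) i)"
    using Cons.prems by (intro Cons.IH) auto
  moreover have "(\<lambda>i. if i \<in> set ts then Suc ((h(t := Suc (h t))) i) else (h(t := Suc (h t))) i) =
      (\<lambda>i. if i \<in> set (t # ts) then Suc (h i) else h i)"
    using Cons.prems by auto
  ultimately show ?case
    using Cons.prems by (auto intro!: exec.Seq exec_Move)
qed

lemma exec_moves_left:
  "\<forall>j. h j < s \<Longrightarrow> distinct ts \<Longrightarrow>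
    exec s (moves MoveLeft ts) (C, h) (C, \<lambda>i. if i \<in> set ts then h i - 1 else h i)"
proof (induction ts arbitrary: h)
  case Nil
  then show ?case by (simp add: exec_skip)
next
  case (Cons t ts)
  have lt: "\<forall>j. (h(t := h t - 1)) j < s"
    using Cons.prems(1) by (simp add: less_imp_diff_less)
  have "exec s (moves MoveLeft ts) (C, h(t := h t - 1))
      (C, \<lambda>i. if i \<in> set ts then (h(t := h t - 1)) i - 1 else (h(t := h t - 1)) i)"
    using Cons.prems lt by (intro Cons.IH) auto
  moreover have "(\<lambda>i. if i \<in> set ts then (h(t := h t - 1)) i - 1 else (h(t := h t - 1)) i) =
      (\<lambda>i. if i \<in> set (t # ts) then h i - 1 else h i)"
    using Cons.prems by auto
  moreover have "exec s (Move t MoveLeft) (C, h) (C, h(t := h t - 1))"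
    using Cons.prems(1) lt by (intro exec_Move) (auto dest: spec[of _ t])
  ultimately show ?case
    by (auto intro: exec.Seq)
qed

definition left_marked :: "(nat \<Rightarrow> token tape_symbol) \<Rightarrow> bool" where
  "left_marked f \<longleftrightarrow> (\<forall>p. f p = LE \<longleftrightarrow> p = 0)"

lemma exec_shift:
  assumes "left_marked (C a)" "distinct (a # us @ ds)" "\<forall>j. h j < s" "\<forall>i\<in>set us. h i + h a < s"
    and "h' = (\<lambda>i. if i = a then 0 else if i \<in> set us then h i + h a else if i \<in> set ds then h i - h a else h i)"
  shows "exec s (shift a us ds) (C, h) (C, h')"
  using assms(3-)
proof (induction "h a" arbitrary: h)
  case 0
  then have "h' = h" by auto
  then show ?case
    unfolding shift_def using 0 assms(1)
    by (auto intro!: exec.WhileFalse simp: fits_def holds_def scan_def left_marked_def)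
next
  case (Suc k)
  let ?h1 = "h(a := k)"
  let ?h2 = "\<lambda>i. if i \<in> set us then Suc (?h1 i) else ?h1 i"
  let ?h3 = "\<lambda>i. if i \<in> set ds then ?h2 i - 1 else ?h2 i"
  have a: "a \<notin> set us" "a \<notin> set ds" and disj: "set us \<inter> set ds = {}"
    using assms(2) by auto
  have lt1: "\<forall>j. ?h1 j < s"
    using Suc by (auto dest: spec[of _ a])
  have lt_us: "\<forall>i\<in>set us. Suc (?h1 i) < s"
    using Suc.prems(2) a Suc.hyps(2)[symmetric] by fastforce
  have lt2: "\<forall>j. ?h2 j < s"
    using lt1 lt_us by simp
  have lt3: "\<forall>j. ?h3 j < s"
    using lt2 by (simp add: less_imp_diff_less)
  have 1: "exec s (Move a MoveLeft) (C, h) (C, ?h1)"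
    using Suc lt1 by (intro exec_Move) (auto dest: spec[of _ a] simp: Suc.hyps(2)[symmetric])
  have 2: "exec s (moves MoveRight us) (C, ?h1) (C, ?h2)"
    using lt1 assms(2) lt_us by (intro exec_moves_right) auto
  have 3: "exec s (moves MoveLeft ds) (C, ?h2) (C, ?h3)"
    using lt2 assms(2) by (intro exec_moves_left) auto
  have 4: "exec s (shift a us ds) (C, ?h3) (C, h')"
  proof (rule Suc.hyps(1))
    show "h' = (\<lambda>i. if i = a then 0 else if i \<in> set us then ?h3 i + ?h3 a else if i \<in> set ds then ?h3 i - ?h3 a else ?h3 i)"
      using Suc.prems(3) Suc.hyps(2) a disj by (auto simp: fun_eq_iff)
    show "\<forall>i\<in>set us. ?h3 i + ?h3 a < s"
      using Suc.prems(2) Suc.hyps(2) a disj by auto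
  qed (use a lt3 in auto)
  have "holds [(a, - {LE})] (scan (C, h))"
    using assms(1) Suc.hyps(2) by (auto simp: holds_def scan_def left_marked_def)
  with Suc.prems(1) 1 2 3 4 show ?case
    unfolding shift_def by (blast intro: exec.WhileTrue exec.Seq fits_def[THEN iffD2, of "(C, h)" s, simplified])
qed

section \<open>Addressing the cells of an array\<close>

text \<open>
  Tapes 2 and 3 are scratch rulers resting at cell 0; the head of tape 4, the yardstick, rests at
  cell \<open>n\<close>.  \<open>goto T x y\<close> moves the head of \<open>T\<close> by \<open>p * (n + 1) + q\<close> cells, where \<open>p\<close> and \<open>q\<close> are
  the positions of the heads of \<open>x\<close> and \<open>y\<close>, which are saved on the scratch rulers.
\<close>

definition advance :: "nat \<Rightarrow> com" where
  "advance T = shift 4 [3, T] [] ;; shift 3 [4] [] ;; Move T MoveRight"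

definition retreat :: "nat \<Rightarrow> com" where
  "retreat T = shift 4 [3] [T] ;; shift 3 [4] [] ;; Move T MoveLeft"

definition goto :: "nat \<Rightarrow> nat \<Rightarrow> nat \<Rightarrow> com" where
  "goto T x y = While [(x, -{LE})] (Move x MoveLeft ;; Move 2 MoveRight ;; advance T) ;; shift y [3, T] []"

definition goback :: "nat \<Rightarrow> nat \<Rightarrow> nat \<Rightarrow> com" where
  "goback T x y = shift 3 [y] [T] ;; While [(2, -{LE})] (Move 2 MoveLeft ;; Move x MoveRight ;; retreat T)"

context
  fixes C :: "nat \<Rightarrow> nat \<Rightarrow> token tape_symbol" and T x y n s :: nat
  assumes marked: "left_marked (C 2)" "left_marked (C 3)" "left_marked (C 4)"
      "left_marked (C x)" "left_marked (C y)"
    and dist: "distinct [2, 3, 4, x, y, T]"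
begin

lemma exec_advance:
  assumes "\<forall>j. h j < s" "h 3 = 0" "h 4 = n" "h T + n + 1 < s"
  shows "exec s (advance T) (C, h) (C, h(T := h T + n + 1))"
proof -
  let ?h1 = "h(4 := 0, 3 := n, T := h T + n)"
  have n: "n < s" using assms by auto
  have 1: "exec s (shift 4 [3, T] []) (C, h) (C, ?h1)"
    using assms dist marked n by (intro exec_shift) auto
  have 2: "exec s (shift 3 [4] []) (C, ?h1) (C, h(T := h T + n))"
    using assms dist marked n by (intro exec_shift) auto
  have 3: "exec s (Move T MoveRight) (C, h(T := h T + n)) (C, h(T := h T + n + 1))"
    using assms by (intro exec_Move) auto
  show ?thesis
    unfolding advance_def using 1 2 3 by (blast intro: exec.Seq)
qed

lemma exec_retreat:
  assumes "\<forall>j. h j < s" "h 3 = 0" "h 4 = n"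
  shows "exec s (retreat T) (C, h) (C, h(T := h T - (n + 1)))"
proof -
  let ?h1 = "h(4 := 0, 3 := n, T := h T - n)"
  have n: "n < s" using assms by auto
  have lt: "h T - n < s" "h T - (n + 1) < s" using assms(1) by (simp_all add: less_imp_diff_less)
  have 1: "exec s (shift 4 [3] [T]) (C, h) (C, ?h1)"
    using assms dist marked n by (intro exec_shift) auto
  have 2: "exec s (shift 3 [4] []) (C, ?h1) (C, h(T := h T - n))"
    using assms dist marked n lt by (intro exec_shift) auto
  have 3: "exec s (Move T MoveLeft) (C, h(T := h T - n)) (C, h(T := h T - (n + 1)))"
    using assms lt by (intro exec_Move) auto
  show ?thesis
    unfolding retreat_def using 1 2 3 by (blast intro: exec.Seq)
qed

lemma exec_goto_rows:
  assumes "\<forall>j. h j < s" "h 3 = 0" "h 4 = n" "h T + h x * (n + 1) < s" "h 2 + h x < s"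
  shows "exec s (While [(x, -{LE})] (Move x MoveLeft ;; Move 2 MoveRight ;; advance T)) (C, h)
     (C, h(x := 0, 2 := h 2 + h x, T := h T + h x * (n + 1)))" (is "exec s ?W _ _")
  using assms
proof (induction "h x" arbitrary: h)
  case 0
  then have eq: "h(x := 0, 2 := h 2 + h x, T := h T + h x * (n + 1)) = h"
    by auto
  have "\<not> holds [(x, - {LE})] (scan (C, h))" "fits s (C, h)"
    using marked 0 by (auto simp: fits_def holds_def scan_def left_marked_def)
  then show ?case
    unfolding eq by (rule exec.WhileFalse[rotated])
next
  case (Suc k)
  let ?h2 = "h(x := k, 2 := Suc (h 2))"
  let ?h3 = "?h2(T := h T + n + 1)"
  have lt: "\<forall>j. (h(x := k)) j < s" "\<forall>j. ?h2 j < s"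
    using Suc.prems(1,5) Suc.hyps(2) by (auto dest: spec[of _ x])
  have T: "h T + n + 1 + k * (n + 1) < s"
    using Suc.prems(4) Suc.hyps(2)[symmetric] by (simp add: algebra_simps)
  then have T1: "h T + n + 1 < s"
    by linarith
  have 1: "exec s (Move x MoveLeft) (C, h) (C, h(x := k))"
    using lt Suc.prems(1) by (intro exec_Move) (auto dest: spec[of _ x] simp: Suc.hyps(2)[symmetric])
  have 2: "exec s (Move 2 MoveRight) (C, h(x := k)) (C, ?h2)"
    using lt dist by (intro exec_Move) (auto dest: spec[of _ 2])
  have 3: "exec s (advance T) (C, ?h2) (C, ?h2(T := ?h2 T + n + 1))"
    using lt dist Suc.prems T1 by (intro exec_advance) auto
  have eq: "?h2(T := ?h2 T + n + 1) = ?h3"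
    using dist by auto
  have 4: "exec s ?W (C, ?h3)
     (C, ?h3(x := 0, 2 := ?h3 2 + ?h3 x, T := ?h3 T + ?h3 x * (n + 1)))"
    using Suc.prems Suc.hyps(2) dist lt T by (intro Suc.hyps(1)) (auto simp: algebra_simps)
  have eq2: "?h3(x := 0, 2 := ?h3 2 + ?h3 x, T := ?h3 T + ?h3 x * (n + 1)) =
      h(x := 0, 2 := h 2 + h x, T := h T + h x * (n + 1))"
    using dist Suc.hyps(2)[symmetric] by (auto simp: fun_eq_iff algebra_simps)
  have "holds [(x, - {LE})] (scan (C, h))" "fits s (C, h)"
    using marked Suc.hyps(2) Suc.prems(1) by (auto simp: holds_def scan_def left_marked_def fits_def)
  with 1 2 3 4 show ?case
    unfolding eq eq2 by (blast intro: exec.WhileTrue exec.Seq)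
qed

text \<open>Ruler 3 is lent to \<open>advance\<close> in every row and comes back empty; only after
  the last row does it take over the position of \<open>y\<close>.\<close>

lemma exec_goto:
  assumes "\<forall>j. h j < s" "h 2 = 0" "h 3 = 0" "h 4 = n" "h T + h x * (n + 1) + h y < s"
  shows "exec s (goto T x y) (C, h)
     (C, h(x := 0, y := 0, 2 := h x, 3 := h y, T := h T + h x * (n + 1) + h y))"
proof -
  let ?h1 = "h(x := 0, 2 := h 2 + h x, T := h T + h x * (n + 1))"
  have 1: "exec s (While [(x, -{LE})] (Move x MoveLeft ;; Move 2 MoveRight ;; advance T)) (C, h) (C, ?h1)"
    using assms by (intro exec_goto_rows) auto
  have lt: "\<forall>j. ?h1 j < s"
    using assms by (auto dest: spec[of _ x])
  have 2: "exec s (shift y [3, T] []) (C, ?h1)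
     (C, h(x := 0, y := 0, 2 := h x, 3 := h y, T := h T + h x * (n + 1) + h y))"
    using lt marked dist assms by (intro exec_shift) (auto simp: fun_eq_iff)
  show ?thesis
    unfolding goto_def using 1 2 by (blast intro: exec.Seq)
qed

lemma exec_goback_rows:
  assumes "\<forall>j. h j < s" "h 3 = 0" "h 4 = n" "h x + h 2 < s"
  shows "exec s (While [(2, -{LE})] (Move 2 MoveLeft ;; Move x MoveRight ;; retreat T)) (C, h)
     (C, h(2 := 0, x := h x + h 2, T := h T - h 2 * (n + 1)))" (is "exec s ?W _ _")
  using assms
proof (induction "h 2" arbitrary: h)
  case 0
  then have eq: "h(2 := 0, x := h x + h 2, T := h T - h 2 * (n + 1)) = h"
    by auto
  have "\<not> holds [(2, - {LE})] (scan (C, h))" "fits s (C, h)"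
    using marked 0 by (auto simp: fits_def holds_def scan_def left_marked_def)
  then show ?case
    unfolding eq by (rule exec.WhileFalse[rotated])
next
  case (Suc k)
  let ?h2 = "h(2 := k, x := Suc (h x))"
  let ?h3 = "?h2(T := h T - (n + 1))"
  have lt: "\<forall>j. (h(2 := k)) j < s" "\<forall>j. ?h2 j < s" "\<forall>j. ?h3 j < s"
    using Suc.prems(1,4) Suc.hyps(2) by (auto dest: spec[of _ 2] simp: less_imp_diff_less)
  have 1: "exec s (Move 2 MoveLeft) (C, h) (C, h(2 := k))"
    using lt Suc.prems(1) by (intro exec_Move) (auto dest: spec[of _ 2] simp: Suc.hyps(2)[symmetric])
  have 2: "exec s (Move x MoveRight) (C, h(2 := k)) (C, ?h2)"
    using lt dist by (intro exec_Move) (auto dest: spec[of _ x])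
  have 3: "exec s (retreat T) (C, ?h2) (C, ?h2(T := ?h2 T - (n + 1)))"
    using lt dist Suc.prems by (intro exec_retreat) auto
  have eq: "?h2(T := ?h2 T - (n + 1)) = ?h3"
    using dist by auto
  have 4: "exec s ?W (C, ?h3)
     (C, ?h3(2 := 0, x := ?h3 x + ?h3 2, T := ?h3 T - ?h3 2 * (n + 1)))"
    using Suc.prems Suc.hyps(2) dist lt by (intro Suc.hyps(1)) auto
  have eq2: "?h3(2 := 0, x := ?h3 x + ?h3 2, T := ?h3 T - ?h3 2 * (n + 1)) =
      h(2 := 0, x := h x + h 2, T := h T - h 2 * (n + 1))"
    using dist Suc.hyps(2)[symmetric] by (auto simp: fun_eq_iff algebra_simps)
  have "holds [(2, - {LE})] (scan (C, h))" "fits s (C, h)"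
    using marked Suc.hyps(2) Suc.prems(1) by (auto simp: holds_def scan_def left_marked_def fits_def)
  with 1 2 3 4 show ?case
    unfolding eq eq2 by (blast intro: exec.WhileTrue exec.Seq)
qed

text \<open>The position of \<open>y\<close> is restored first, because \<open>retreat\<close> needs
  ruler 3 to be empty. After a \<open>goto\<close> the truncated subtraction is exact.\<close>

lemma exec_goback:
  assumes "\<forall>j. h j < s" "h 4 = n" "h x = 0" "h y = 0"
  shows "exec s (goback T x y) (C, h)
     (C, h(2 := 0, 3 := 0, x := h 2, y := h 3, T := h T - (h 2 * (n + 1) + h 3)))"
proof -
  let ?h1 = "h(3 := 0, y := h 3, T := h T - h 3)"
  have lt: "\<forall>j. ?h1 j < s"
    using assms by (auto simp: less_imp_diff_less)
  have 1: "exec s (shift 3 [y] [T]) (C, h) (C, ?h1)"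
    using marked dist assms by (intro exec_shift) (auto simp: fun_eq_iff)
  have "exec s (While [(2, -{LE})] (Move 2 MoveLeft ;; Move x MoveRight ;; retreat T)) (C, ?h1)
     (C, ?h1(2 := 0, x := ?h1 x + ?h1 2, T := ?h1 T - ?h1 2 * (n + 1)))"
    using lt dist assms by (intro exec_goback_rows) (auto dest: spec[of _ 2])
  moreover have "?h1(2 := 0, x := ?h1 x + ?h1 2, T := ?h1 T - ?h1 2 * (n + 1)) =
     h(2 := 0, 3 := 0, x := h 2, y := h 3, T := h T - (h 2 * (n + 1) + h 3))"
    using dist assms by (auto simp: fun_eq_iff add.commute)
  ultimately show ?thesis
    unfolding goback_def using 1 by (auto intro: exec.Seq)
qed

end

section \<open>Second-order formulas over words\<close>

text \<open>
  First-order variables range over the positions \<open>0, \<dots>, n\<close> of a word of length \<open>n\<close>, the end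
  included.  A binary relation \<open>R\<close> on positions is stored as the set of all \<open>p * (n + 1) + q\<close> with
  \<open>R p q\<close>.
\<close>

datatype fmla =
    Letter token nat
  | Less nat nat
  | Rel nat nat nat
  | FNot fmla
  | FAnd fmla fmla
  | ExF nat fmla
  | ExR nat fmla

abbreviation cells :: "token list \<Rightarrow> nat" where
  "cells w \<equiv> (length w + 1)\<^sup>2"

primrec sat :: "token list \<Rightarrow> (nat \<Rightarrow> nat) \<Rightarrow> (nat \<Rightarrow> nat set) \<Rightarrow> fmla \<Rightarrow> bool" where
  "sat w e \<rho> (Letter a x) \<longleftrightarrow> e x < length w \<and> w ! e x = a"
| "sat w e \<rho> (Less x y) \<longleftrightarrow> e x < e y"
| "sat w e \<rho> (Rel R x y) \<longleftrightarrow> e x * (length w + 1) + e y \<in> \<rho> R"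
| "sat w e \<rho> (FNot \<phi>) \<longleftrightarrow> \<not> sat w e \<rho> \<phi>"
| "sat w e \<rho> (FAnd \<phi> \<psi>) \<longleftrightarrow> sat w e \<rho> \<phi> \<and> sat w e \<rho> \<psi>"
| "sat w e \<rho> (ExF x \<phi>) \<longleftrightarrow> (\<exists>v\<le>length w. sat w (e(x := v)) \<rho> \<phi>)"
| "sat w e \<rho> (ExR R \<phi>) \<longleftrightarrow> (\<exists>B\<subseteq>{..<cells w}. sat w e (\<rho>(R := B)) \<phi>)"

primrec bound_vars :: "fmla \<Rightarrow> nat set" where
  "bound_vars (Letter a x) = {}"
| "bound_vars (Less x y) = {}"
| "bound_vars (Rel R x y) = {}"
| "bound_vars (FNot \<phi>) = bound_vars \<phi>"
| "bound_vars (FAnd \<phi> \<psi>) = bound_vars \<phi> \<union> bound_vars \<psi>"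
| "bound_vars (ExF x \<phi>) = insert x (bound_vars \<phi>)"
| "bound_vars (ExR R \<phi>) = bound_vars \<phi>"

primrec bound_rels :: "fmla \<Rightarrow> nat set" where
  "bound_rels (Letter a x) = {}"
| "bound_rels (Less x y) = {}"
| "bound_rels (Rel R x y) = {}"
| "bound_rels (FNot \<phi>) = bound_rels \<phi>"
| "bound_rels (FAnd \<phi> \<psi>) = bound_rels \<phi> \<union> bound_rels \<psi>"
| "bound_rels (ExF x \<phi>) = bound_rels \<phi>"
| "bound_rels (ExR R \<phi>) = insert R (bound_rels \<phi>)"

text \<open>Every variable has one tape, so quantifiers for the same variable must not be nested.\<close>

primrec wf_fmla :: "nat \<Rightarrow> fmla \<Rightarrow> bool" where
  "wf_fmla m (Letter a x) \<longleftrightarrow> x < m"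
| "wf_fmla m (Less x y) \<longleftrightarrow> x < m \<and> y < m \<and> x \<noteq> y"
| "wf_fmla m (Rel R x y) \<longleftrightarrow> R < m \<and> x < m \<and> y < m \<and> x \<noteq> y"
| "wf_fmla m (FNot \<phi>) \<longleftrightarrow> wf_fmla m \<phi>"
| "wf_fmla m (FAnd \<phi> \<psi>) \<longleftrightarrow> wf_fmla m \<phi> \<and> wf_fmla m \<psi>"
| "wf_fmla m (ExF x \<phi>) \<longleftrightarrow> x < m \<and> x \<notin> bound_vars \<phi> \<and> wf_fmla m \<phi>"
| "wf_fmla m (ExR R \<phi>) \<longleftrightarrow> R < m \<and> R \<notin> bound_rels \<phi> \<and> wf_fmla m \<phi>"

section \<open>Evaluating formulas\<close>

text \<open>Tape layout: 0 input, 1 answer, 2 and 3 scratch rulers, 4 yardstick; from 5 on, odd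
  tapes hold first-order variables as head positions and even tapes hold relations as bit
  arrays.\<close>

abbreviation var :: "nat \<Rightarrow> nat" where "var x \<equiv> 5 + 2 * x"
abbreviation rel :: "nat \<Rightarrow> nat" where "rel R \<equiv> 6 + 2 * R"

abbreviation answer :: "test \<Rightarrow> com" where
  "answer b \<equiv> If b (Write 1 One) (Write 1 Blank)"

text \<open>
  Adds 1 to the binary number on the tape, least significant digit first.  On overflow the digits
  become 0 and tape 1 is set to \<open>LE\<close>.
\<close>

definition incr :: "nat \<Rightarrow> com" where
  "incr T = While [(T, {One})] (Write T Blank ;; Move T MoveRight) ;;
     If [(T, {RE})] (Write 1 LE) (Write T One) ;; shift T [] [] ;; Move T MoveRight"

definition clear :: "nat \<Rightarrow> com" where
  "clear T = While [(T, -{RE})] (Write T Blank ;; Move T MoveRight) ;; shift T [] [] ;; Move T MoveRight"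

text \<open>Everything except the answer on tape 1 is restored, so a subformula can be evaluated
  again and again. An existential search begins at position 0 or at the empty relation and stops at
  the first witness. In the search over relations, \<open>LE\<close> on tape 1 signals that the
  counter has overflowed: it ends the loop and then becomes a negative answer.\<close>

primrec eval_com :: "fmla \<Rightarrow> com" where
  "eval_com (Letter a x) = shift (var x) [2, 0] [] ;; answer [(0, {Inp a})] ;; shift 2 [var x] [0]"
| "eval_com (Less x y) =
     While [(var x, -{LE}), (var y, -{LE})]
       (Move (var x) MoveLeft ;; Move (var y) MoveLeft ;; Move 2 MoveRight) ;;
     answer [(var x, {LE}), (var y, -{LE})] ;; shift 2 [var x, var y] []"
| "eval_com (Rel R x y) = goto (rel R) (var x) (var y) ;; answer [(rel R, {One})] ;; goback (rel R) (var x) (var y)"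
| "eval_com (FNot \<phi>) = eval_com \<phi> ;; If [(1, {One})] (Write 1 Blank) (Write 1 One)"
| "eval_com (FAnd \<phi> \<psi>) = eval_com \<phi> ;; If [(1, {One})] (eval_com \<psi>) skip"
| "eval_com (ExF x \<phi>) = eval_com \<phi> ;;
     While [(1, -{One}), (var x, -{RE})] (Move (var x) MoveRight ;; eval_com \<phi>) ;; shift (var x) [] []"
| "eval_com (ExR R \<phi>) = eval_com \<phi> ;;
     While [(1, {Blank})] (incr (rel R) ;; If [(1, {Blank})] (eval_com \<phi>) skip) ;;
     If [(1, {One})] (clear (rel R)) (Write 1 Blank)"

text \<open>For \<open>n = 0\<close> there would be no right mark, and a loop looking for it would
  not stop. This is why the evaluation is confined to nonempty words.\<close>

definition ruler :: "nat \<Rightarrow> nat \<Rightarrow> token tape_symbol" where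
  "ruler n p = (if p = 0 then LE else if p = n then RE else Blank)"

text \<open>Element \<open>i\<close> is stored in cell \<open>i + 1\<close>, since cell 0 carries
  the left mark. With the right mark in cell \<open>N + 1\<close> this gives the space bound
  \<open>N + 2\<close>.\<close>

definition bits :: "nat \<Rightarrow> nat set \<Rightarrow> nat \<Rightarrow> token tape_symbol" where
  "bits N B p = (if p = 0 then LE else if p = N + 1 then RE else if p - 1 \<in> B then One else Blank)"

definition contents :: "token list \<Rightarrow> (nat \<Rightarrow> nat set) \<Rightarrow> token tape_symbol \<Rightarrow> nat \<Rightarrow> nat \<Rightarrow> token tape_symbol" where
  "contents w \<rho> b i =
     (if i = 0 then fst (input_tape w) else if i = 1 then (\<lambda>_. Blank)(0 := b)
      else if i \<ge> 6 \<and> even i then bits (cells w) (\<rho> ((i - 6) div 2)) else ruler (length w))"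

text \<open>The resting positions between commands: a relation tape waits on its lowest digit in
  cell 1, the yardstick on its right mark.\<close>

definition heads :: "nat \<Rightarrow> (nat \<Rightarrow> nat) \<Rightarrow> nat \<Rightarrow> nat" where
  "heads n e i = (if i < 4 then 0 else if i = 4 then n else if even i then 1 else e ((i - 5) div 2))"

lemma left_marked_ruler: "left_marked (ruler n)"
  by (simp add: left_marked_def ruler_def)

lemma left_marked_bits: "left_marked (bits N B)"
  by (simp add: left_marked_def bits_def)

lemma contents_simps [simp]:
  "contents w \<rho> b 0 = fst (input_tape w)" "contents w \<rho> b 1 = (\<lambda>_. Blank)(0 := b)"
  "contents w \<rho> b (Suc 0) = (\<lambda>_. Blank)(0 := b)"
  "contents w \<rho> b 2 = ruler (length w)" "contents w \<rho> b 3 = ruler (length w)"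
  "contents w \<rho> b 4 = ruler (length w)" "contents w \<rho> b (var x) = ruler (length w)"
  "contents w \<rho> b (rel R) = bits (cells w) (\<rho> R)"
  by (auto simp: contents_def)

lemma heads_simps [simp]:
  "heads n e 0 = 0" "heads n e 1 = 0" "heads n e (Suc 0) = 0" "heads n e 2 = 0" "heads n e 3 = 0"
  "heads n e 4 = n" "heads n e (var x) = e x" "heads n e (rel R) = 1"
  by (auto simp: heads_def)

lemma var_rel_neq [simp]: "var x \<noteq> rel R" "rel R \<noteq> var x"
  by presburger+

lemma contents_answer: "(contents w \<rho> b)(1 := (contents w \<rho> b 1)(0 := b')) = contents w \<rho> b'"
  by (auto simp: contents_def fun_eq_iff)

lemma contents_rel: "(contents w \<rho> b)(rel R := bits (cells w) B) = contents w (\<rho>(R := B)) b"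
  by (auto simp: contents_def fun_eq_iff) presburger?

lemma heads_var: "(heads n e)(var x := v) = heads n (e(x := v))"
  by (auto simp: heads_def fun_eq_iff) presburger?

text \<open>Binary increment of the number whose digits 1 are at the given positions: clearing the
  run of low ones subtracts \<open>2 ^ j - 1\<close>, and setting digit \<open>j\<close> adds
  \<open>2 ^ j\<close>.\<close>

lemma incr_set_decode:
  assumes "{..<j} \<subseteq> set_decode k" "j \<notin> set_decode k"
  shows "insert j (set_decode k - {..<j}) = set_decode (Suc k)"
proof -
  have "set_encode (set_decode k - {..<j}) + set_encode {..<j} = k"
    using sum.subset_diff[OF assms(1) finite_set_decode, of "(^) (2::nat)"] set_decode_inverse[of k]
    by (simp add: set_encode_def)
  moreover have "set_encode {..<j} + 1 = 2 ^ j"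
    by (simp add: set_encode_def) (induction j; simp)
  ultimately have "set_encode (insert j (set_decode k - {..<j})) = Suc k"
    using assms(2) by (simp add: set_encode_insert)
  then show ?thesis
    by (metis finite.insertI finite_Diff finite_set_decode set_encode_inverse)
qed

text \<open>The largest subset has the code \<open>2 ^ N - 1\<close>. Counting from 0 up to it
  therefore visits precisely the relations on positions.\<close>

lemma set_decode_bounded: "set_decode k \<subseteq> {..<N} \<longleftrightarrow> k < 2 ^ N"
proof
  assume "set_decode k \<subseteq> {..<N}"
  then have "set_encode (set_decode k) \<le> set_encode {..<N}"
    unfolding set_encode_def by (intro sum_mono2) auto
  also have "\<dots> < 2 ^ N"
    by (simp add: set_encode_def) (induction N; simp)
  finally show "k < 2 ^ N" by simp
next
  assume "k < 2 ^ N"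
  show "set_decode k \<subseteq> {..<N}"
  proof
    fix i assume "i \<in> set_decode k"
    then have "2 ^ i \<le> k"
      by (metis div_less even_zero mem_Collect_eq not_le set_decode_def)
    then have "(2::nat) ^ i < 2 ^ N"
      using \<open>k < 2 ^ N\<close> by (rule le_less_trans)
    then show "i \<in> {..<N}" by simp
  qed
qed

text \<open>The common loop of \<open>incr\<close> and \<open>clear\<close>. \<open>j\<close> is the
  first digit at which the loop test fails; \<open>i\<close> is the progress made so far and is what
  the induction varies.\<close>

lemma exec_erase:
  assumes s: "N + 1 < s" and j: "j \<le> N" "bits N (B - {..<j}) (Suc j) \<notin> X"
    and X: "\<And>k. k < j \<Longrightarrow> bits N (B - {..<k}) (Suc k) \<in> X"
  shows "i \<le> j \<Longrightarrow> C T = bits N (B - {..<i}) \<Longrightarrow> h T = Suc i \<Longrightarrow> \<forall>j. h j < s \<Longrightarrow>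
    exec s (While [(T, X)] (Write T Blank ;; Move T MoveRight)) (C, h)
      (C(T := bits N (B - {..<j})), h(T := Suc j))"
proof (induction "j - i" arbitrary: i C h)
  case 0
  then have "i = j" by simp
  with 0 have eq: "C(T := bits N (B - {..<j})) = C" "h(T := Suc j) = h" by auto
  have "\<not> holds [(T, X)] (scan (C, h))" "fits s (C, h)"
    using 0 j \<open>i = j\<close> by (auto simp: fits_def holds_def scan_def)
  then show ?case
    unfolding eq by (rule exec.WhileFalse[rotated])
next
  case (Suc d)
  then have i: "i < j" by simp
  have test: "holds [(T, X)] (scan (C, h))" "fits s (C, h)"
    using Suc.prems X i by (auto simp: fits_def holds_def scan_def)
  have bits: "(bits N (B - {..<i}))(Suc i := Blank) = bits N (B - {..<Suc i})"
    using j i by (auto simp: bits_def fun_eq_iff)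
  let ?C = "C(T := bits N (B - {..<Suc i}))"
  have 1: "exec s (Write T Blank) (C, h) (?C, h)"
    using Suc.prems bits by (intro exec_Write) auto
  have 2: "exec s (Move T MoveRight) (?C, h) (?C, h(T := Suc (Suc i)))"
    using Suc.prems s j i by (intro exec_Move) auto
  have "exec s (While [(T, X)] (Write T Blank ;; Move T MoveRight)) (?C, h(T := Suc (Suc i)))
      (?C(T := bits N (B - {..<j})), (h(T := Suc (Suc i)))(T := Suc j))"
    using Suc.prems Suc.hyps(2) s j i by (intro Suc.hyps(1)) auto
  then show ?case
    using test 1 2 by (auto intro: exec.WhileTrue exec.Seq)
qed

lemma exec_rewind:
  assumes "left_marked (C T)" "\<forall>j. h j < s" "1 < s"
  shows "exec s (shift T [] [] ;; Move T MoveRight) (C, h) (C, h(T := 1))"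
proof -
  have 1: "exec s (shift T [] []) (C, h) (C, h(T := 0))"
    using assms by (intro exec_shift) auto
  have 2: "exec s (Move T MoveRight) (C, h(T := 0)) (C, h(T := 1))"
    using assms by (intro exec_Move) auto
  show ?thesis
    using 1 2 by (rule exec.Seq)
qed

context
  fixes w :: "token list" and n s N
  assumes n: "n = length w" and N: "N = cells w" and s: "s = N + 2" and n0: "n > 0"
begin

lemma n_le_N: "n < N"
  by (simp add: n N power2_eq_square)

lemma heads_less: "\<forall>x. e x \<le> n \<Longrightarrow> \<forall>i. heads n e i < s"
  using n_le_N n0 s by (auto simp: heads_def intro: le_less_trans)

lemma exec_answer:
  assumes "\<forall>i. h i < s" "h 1 = 0" "holds b (scan (contents w \<rho> a, h)) \<longleftrightarrow> P"
  shows "exec s (answer b) (contents w \<rho> a, h) (contents w \<rho> (if P then One else Blank), h)"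
proof -
  have "exec s (Write 1 c) (contents w \<rho> a, h) (contents w \<rho> c, h)" for c
    using assms contents_answer[of w \<rho> a c] by (intro exec_Write) auto
  then show ?thesis
    using assms by (cases P) (auto intro: exec.IfTrue exec.IfFalse simp: fits_def)
qed

lemma exec_incr:
  assumes e: "\<forall>x. e x \<le> n" and k: "k < 2 ^ N"
  shows "exec s (incr (rel R)) (contents w (\<rho>(R := set_decode k)) Blank, heads n e)
    (if Suc k < 2 ^ N then contents w (\<rho>(R := set_decode (Suc k))) Blank
     else contents w (\<rho>(R := {})) LE, heads n e)"
proof -
  let ?B = "set_decode k" and ?T = "rel R" and ?h = "heads n e"
  \<comment> \<open>The lowest digit 0. Since \<open>N\<close> is not in \<open>?B\<close>, it
    exists with \<open>j \<le> N\<close>, and \<open>j = N\<close> means that all digits are 1 and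
    the head has run into the right mark.\<close>
  define j where "j = (LEAST i. i \<notin> ?B)"
  have B: "?B \<subseteq> {..<N}"
    using k set_decode_bounded by blast
  then have "N \<notin> ?B" by auto
  then have j: "j \<notin> ?B" "{..<j} \<subseteq> ?B" "j \<le> N"
    unfolding j_def using not_less_Least[of _ "\<lambda>i. i \<notin> ?B"] LeastI[of "\<lambda>i. i \<notin> ?B" N]
      Least_le[of "\<lambda>i. i \<notin> ?B" N] by auto
  let ?C1 = "contents w (\<rho>(R := ?B - {..<j})) Blank"
  let ?h1 = "?h(?T := Suc j)"
  have lt: "\<forall>i. ?h i < s" "\<forall>i. ?h1 i < s"
    using heads_less[OF e] j(3) s by auto
  have 1: "exec s (While [(?T, {One})] (Write ?T Blank ;; Move ?T MoveRight))
      (contents w (\<rho>(R := ?B)) Blank, ?h) (?C1, ?h1)"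
  proof -
    have "exec s (While [(?T, {One})] (Write ?T Blank ;; Move ?T MoveRight))
        (contents w (\<rho>(R := ?B)) Blank, ?h)
        ((contents w (\<rho>(R := ?B)) Blank)(?T := bits N (?B - {..<j})), ?h1)"
      using j lt s N by (intro exec_erase[where i = 0]) (auto simp: bits_def)
    then show ?thesis
      by (simp only: N contents_rel fun_upd_upd)
  qed
  have "scan (?C1, ?h1) ?T = (if j = N then RE else Blank)"
    using j N by (auto simp: scan_def bits_def)
  then have test: "holds [(?T, {RE})] (scan (?C1, ?h1)) \<longleftrightarrow> j = N"
    by (simp add: holds_def)
  have fits: "fits s (?C1, ?h1)"
    using lt by (simp add: fits_def)
  have step: "insert j (?B - {..<j}) = set_decode (Suc k)"
    using j incr_set_decode by blast
  define C2 where "C2 = (if Suc k < 2 ^ N then contents w (\<rho>(R := set_decode (Suc k))) Blank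
     else contents w (\<rho>(R := {})) LE)"
  have 2: "exec s (If [(?T, {RE})] (Write 1 LE) (Write ?T One)) (?C1, ?h1) (C2, ?h1)"
  proof (cases "j = N")
    case True
    then have full: "\<not> Suc k < 2 ^ N" and empty: "?B - {..<j} = {}"
      using step B set_decode_bounded[of "Suc k" N] by auto
    have "exec s (Write 1 LE) (?C1, ?h1) (contents w (\<rho>(R := ?B - {..<j})) LE, ?h1)"
      using lt contents_answer[of w "\<rho>(R := ?B - {..<j})" Blank LE] by (intro exec_Write) auto
    also have "contents w (\<rho>(R := ?B - {..<j})) LE = C2"
      using full by (simp only: empty C2_def if_False)
    finally show ?thesis
      using fits test True by (blast intro: exec.IfTrue)
  next
    case False
    have "set_decode (Suc k) \<subseteq> {..<N}"
      unfolding step[symmetric] using B j False by auto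
    then have k': "Suc k < 2 ^ N"
      using set_decode_bounded by blast
    have "(bits N (?B - {..<j}))(Suc j := One) = bits N (set_decode (Suc k))"
      using False j by (auto simp: bits_def fun_eq_iff simp flip: step)
    then have "?C1(?T := (?C1 ?T)(?h1 ?T := One)) = contents w (\<rho>(R := set_decode (Suc k))) Blank"
      using contents_rel[of w "\<rho>(R := ?B - {..<j})" Blank R "set_decode (Suc k)"] N by simp
    then have "exec s (Write ?T One) (?C1, ?h1) (contents w (\<rho>(R := set_decode (Suc k))) Blank, ?h1)"
      using lt by (intro exec_Write) auto
    then show ?thesis
      unfolding C2_def if_P[OF k'] using fits test False by (blast intro: exec.IfFalse)
  qed
  have "left_marked (C2 ?T)"
    by (auto simp: C2_def left_marked_bits)
  then have 3: "exec s (shift ?T [] [] ;; Move ?T MoveRight) (C2, ?h1) (C2, ?h1(?T := 1))"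
    using lt s by (intro exec_rewind) auto
  have "?h1(?T := 1) = ?h" by (auto simp: fun_eq_iff)
  with exec.Seq[OF 1 exec.Seq[OF 2 3]] show ?thesis
    by (simp only: incr_def C2_def)
qed

lemma exec_clear:
  assumes e: "\<forall>x. e x \<le> n" and B: "B \<subseteq> {..<N}"
  shows "exec s (clear (rel R)) (contents w (\<rho>(R := B)) b, heads n e) (contents w (\<rho>(R := {})) b, heads n e)"
proof -
  let ?T = "rel R" and ?h = "heads n e"
  let ?h1 = "?h(?T := Suc N)"
  have lt: "\<forall>i. ?h i < s" "\<forall>i. ?h1 i < s"
    using heads_less[OF e] s by auto
  have empty: "B - {..<N} = {}"
    using B by auto
  have "exec s (While [(?T, -{RE})] (Write ?T Blank ;; Move ?T MoveRight))
      (contents w (\<rho>(R := B)) b, ?h) ((contents w (\<rho>(R := B)) b)(?T := bits N (B - {..<N})), ?h1)"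
    using lt s N by (intro exec_erase[where i = 0]) (auto simp: bits_def)
  then have 1: "exec s (While [(?T, -{RE})] (Write ?T Blank ;; Move ?T MoveRight))
      (contents w (\<rho>(R := B)) b, ?h) (contents w (\<rho>(R := {})) b, ?h1)"
    unfolding empty by (simp only: N contents_rel fun_upd_upd)
  have 2: "exec s (shift ?T [] [] ;; Move ?T MoveRight) (contents w (\<rho>(R := {})) b, ?h1)
      (contents w (\<rho>(R := {})) b, ?h1(?T := 1))"
    using lt s by (intro exec_rewind) (auto simp: left_marked_bits)
  have "?h1(?T := 1) = ?h" by (auto simp: fun_eq_iff)
  with exec.Seq[OF 1 2] show ?thesis
    by (simp only: clear_def)
qed

lemma exec_Letter:
  assumes e: "\<forall>x. e x \<le> n"
  shows "exec s (eval_com (Letter a x)) (contents w \<rho> b, heads n e)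
    (contents w \<rho> (if sat w e \<rho> (Letter a x) then One else Blank), heads n e)"
proof -
  let ?h = "heads n e" and ?b = "if sat w e \<rho> (Letter a x) then One else Blank"
  let ?h1 = "?h(var x := 0, 2 := e x, 0 := e x)"
  have ex: "e x < s"
    using e n_le_N s by (metis le_less_trans less_trans less_add_same_cancel1 zero_less_numeral)
  have lt: "\<forall>i. ?h i < s" "\<forall>i. ?h1 i < s"
    using heads_less[OF e] ex s by auto
  have 1: "exec s (shift (var x) [2, 0] []) (contents w \<rho> b, ?h) (contents w \<rho> b, ?h1)"
    using lt ex by (intro exec_shift) (auto simp: left_marked_ruler fun_eq_iff)
  have 2: "exec s (answer [(0, {Inp a})]) (contents w \<rho> b, ?h1) (contents w \<rho> ?b, ?h1)"
    using lt by (intro exec_answer) (auto simp: holds_def scan_def input_tape_def)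
  have 3: "exec s (shift 2 [var x] [0]) (contents w \<rho> ?b, ?h1) (contents w \<rho> ?b, ?h)"
    using lt ex by (intro exec_shift) (auto simp: left_marked_ruler fun_eq_iff)
  show ?thesis
    using exec.Seq[OF 1 exec.Seq[OF 2 3]] by (simp only: eval_com.simps)
qed

text \<open>Both heads move left together until one is at the mark, so the smaller position is the
  one that has become 0. Ruler 2 counts the rounds, from which both positions are restored.\<close>

lemma exec_Less_loop:
  assumes "x \<noteq> y" "\<forall>i. h i < s" "h 2 + h (var x) < s"
  shows "exec s (While [(var x, -{LE}), (var y, -{LE})]
       (Move (var x) MoveLeft ;; Move (var y) MoveLeft ;; Move 2 MoveRight)) (contents w \<rho> b, h)
     (contents w \<rho> b, h(var x := h (var x) - min (h (var x)) (h (var y)),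
        var y := h (var y) - min (h (var x)) (h (var y)), 2 := h 2 + min (h (var x)) (h (var y))))" (is "exec s ?W _ _")
  using assms(2,3)
proof (induction "h (var x)" arbitrary: h rule: less_induct)
  case less
  let ?C = "contents w \<rho> b"
  show ?case
  proof (cases "h (var x) = 0 \<or> h (var y) = 0")
    case True
    then have eq: "h(var x := h (var x) - min (h (var x)) (h (var y)),
        var y := h (var y) - min (h (var x)) (h (var y)), 2 := h 2 + min (h (var x)) (h (var y))) = h"
      by (auto simp: fun_eq_iff)
    have "\<not> holds [(var x, -{LE}), (var y, -{LE})] (scan (?C, h))" "fits s (?C, h)"
      using True less by (auto simp: holds_def scan_def ruler_def fits_def)
    then show ?thesis
      unfolding eq by (rule exec.WhileFalse[rotated])
  next
    case False
    let ?h1 = "h(var x := h (var x) - 1)"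
    let ?h2 = "?h1(var y := h (var y) - 1)"
    let ?h3 = "?h2(2 := Suc (h 2))"
    have lt: "\<forall>i. ?h1 i < s" "\<forall>i. ?h2 i < s" "\<forall>i. ?h3 i < s"
      using less.prems False by (auto simp: less_imp_diff_less)
    have 1: "exec s (Move (var x) MoveLeft) (?C, h) (?C, ?h1)"
      using less.prems by (intro exec_Move) (auto simp: less_imp_diff_less)
    have 2: "exec s (Move (var y) MoveLeft) (?C, ?h1) (?C, ?h2)"
      using less.prems lt assms(1) by (intro exec_Move) (auto simp: less_imp_diff_less)
    have 3: "exec s (Move 2 MoveRight) (?C, ?h2) (?C, ?h3)"
      using less.prems lt False by (intro exec_Move) auto
    have 4: "exec s ?W (?C, ?h3)
     (?C, ?h3(var x := ?h3 (var x) - min (?h3 (var x)) (?h3 (var y)),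
        var y := ?h3 (var y) - min (?h3 (var x)) (?h3 (var y)), 2 := ?h3 2 + min (?h3 (var x)) (?h3 (var y))))"
      using less.prems lt False assms(1) by (intro less.hyps) auto
    have eq: "?h3(var x := ?h3 (var x) - min (?h3 (var x)) (?h3 (var y)),
        var y := ?h3 (var y) - min (?h3 (var x)) (?h3 (var y)), 2 := ?h3 2 + min (?h3 (var x)) (?h3 (var y))) =
      h(var x := h (var x) - min (h (var x)) (h (var y)),
        var y := h (var y) - min (h (var x)) (h (var y)), 2 := h 2 + min (h (var x)) (h (var y)))"
      using False assms(1) by (auto simp: fun_eq_iff)
    have "holds [(var x, -{LE}), (var y, -{LE})] (scan (?C, h))" "fits s (?C, h)"
      using False less.prems by (auto simp: holds_def scan_def ruler_def fits_def)
    then show ?thesis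
      using exec.WhileTrue[OF _ _ exec.Seq[OF 1 exec.Seq[OF 2 3]] 4] by (simp only: eq)
  qed
qed

lemma exec_Less:
  assumes e: "\<forall>x. e x \<le> n" and xy: "x \<noteq> y"
  shows "exec s (eval_com (Less x y)) (contents w \<rho> b, heads n e)
    (contents w \<rho> (if sat w e \<rho> (Less x y) then One else Blank), heads n e)"
proof -
  let ?h = "heads n e" and ?b = "if sat w e \<rho> (Less x y) then One else Blank"
  let ?k = "min (e x) (e y)"
  let ?h1 = "?h(var x := e x - ?k, var y := e y - ?k, 2 := ?k)"
  have ex: "e x < s" "e y < s"
    using e n_le_N s by (metis le_less_trans less_trans less_add_same_cancel1 zero_less_numeral)+
  have lt: "\<forall>i. ?h i < s" "\<forall>i. ?h1 i < s"
    using heads_less[OF e] ex s by (auto simp: less_imp_diff_less)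
  have 1: "exec s (While [(var x, -{LE}), (var y, -{LE})]
       (Move (var x) MoveLeft ;; Move (var y) MoveLeft ;; Move 2 MoveRight)) (contents w \<rho> b, ?h) (contents w \<rho> b, ?h1)"
    using exec_Less_loop[OF xy lt(1), of \<rho> b] ex by simp
  have 2: "exec s (answer [(var x, {LE}), (var y, -{LE})]) (contents w \<rho> b, ?h1) (contents w \<rho> ?b, ?h1)"
    using lt xy by (intro exec_answer) (auto simp: holds_def scan_def ruler_def)
  have 3: "exec s (shift 2 [var x, var y] []) (contents w \<rho> ?b, ?h1) (contents w \<rho> ?b, ?h)"
    using lt ex xy by (intro exec_shift) (auto simp: left_marked_ruler fun_eq_iff)
  show ?thesis
    using exec.Seq[OF 1 exec.Seq[OF 2 3]] by (simp only: eval_com.simps)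
qed

lemma exec_Rel:
  assumes e: "\<forall>x. e x \<le> n" and xy: "x \<noteq> y"
  shows "exec s (eval_com (Rel R x y)) (contents w \<rho> b, heads n e)
    (contents w \<rho> (if sat w e \<rho> (Rel R x y) then One else Blank), heads n e)"
proof -
  let ?h = "heads n e" and ?b = "if sat w e \<rho> (Rel R x y) then One else Blank"
  let ?i = "e x * (n + 1) + e y"
  \<comment> \<open>The head of \<open>rel R\<close> starts on cell 1, so it arrives exactly at the
    cell of element \<open>?i\<close>.\<close>
  let ?h1 = "?h(var x := 0, var y := 0, 2 := e x, 3 := e y, rel R := Suc ?i)"
  have "?i \<le> n * (n + 1) + n"
    using e by (intro add_mono mult_mono) auto
  also have "\<dots> < N"
    by (simp add: N n power2_eq_square)
  finally have i: "?i < N" .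
  have ex: "e x < s" "e y < s"
    using e n_le_N s by (metis le_less_trans less_trans less_add_same_cancel1 zero_less_numeral)+
  have lt: "\<forall>i. ?h i < s" "\<forall>i. ?h1 i < s"
    using heads_less[OF e] ex s i by auto
  have 1: "exec s (goto (rel R) (var x) (var y)) (contents w \<rho> b, ?h) (contents w \<rho> b, ?h1)"
    using exec_goto[of "contents w \<rho> b" "var x" "var y" "rel R" ?h s n] lt i s xy
    by (simp add: left_marked_ruler n)
  have "scan (contents w \<rho> b, ?h1) (rel R) = One \<longleftrightarrow> ?i \<in> \<rho> R"
    using i by (auto simp: scan_def bits_def N)
  then have 2: "exec s (answer [(rel R, {One})]) (contents w \<rho> b, ?h1) (contents w \<rho> ?b, ?h1)"
    using lt by (intro exec_answer) (auto simp: holds_def n)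
  have "exec s (goback (rel R) (var x) (var y)) (contents w \<rho> ?b, ?h1)
      (contents w \<rho> ?b, ?h1(2 := 0, 3 := 0, var x := ?h1 2, var y := ?h1 3, rel R := ?h1 (rel R) - (?h1 2 * (n + 1) + ?h1 3)))"
    using lt xy by (intro exec_goback) (auto simp: left_marked_ruler)
  moreover have "?h1(2 := 0, 3 := 0, var x := ?h1 2, var y := ?h1 3, rel R := ?h1 (rel R) - (?h1 2 * (n + 1) + ?h1 3)) = ?h"
    using xy by (auto simp: fun_eq_iff)
  ultimately have 3: "exec s (goback (rel R) (var x) (var y)) (contents w \<rho> ?b, ?h1) (contents w \<rho> ?b, ?h)"
    by simp
  show ?thesis
    using exec.Seq[OF 1 exec.Seq[OF 2 3]] by (simp only: eval_com.simps)
qed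

lemma exec_If_answer:
  assumes "\<forall>i. h i < s" "h 1 = 0"
  shows "exec s c (contents w \<rho> One, h) m \<Longrightarrow> exec s (If [(1, {One})] c d) (contents w \<rho> One, h) m"
    and "b \<noteq> One \<Longrightarrow> exec s d (contents w \<rho> b, h) m \<Longrightarrow> exec s (If [(1, {One})] c d) (contents w \<rho> b, h) m"
proof -
  have "fits s (contents w \<rho> b, h)" for b
    using assms by (simp add: fits_def)
  moreover have "holds [(1, {One})] (scan (contents w \<rho> b, h)) \<longleftrightarrow> b = One" for b
    using assms by (auto simp: holds_def scan_def)
  ultimately show "exec s c (contents w \<rho> One, h) m \<Longrightarrow> exec s (If [(1, {One})] c d) (contents w \<rho> One, h) m"
    "b \<noteq> One \<Longrightarrow> exec s d (contents w \<rho> b, h) m \<Longrightarrow> exec s (If [(1, {One})] c d) (contents w \<rho> b, h) m"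
    by (blast intro: exec.IfTrue exec.IfFalse)+
qed

lemma exec_Write_answer:
  assumes "\<forall>i. h i < s" "h 1 = 0"
  shows "exec s (Write 1 b') (contents w \<rho> b, h) (contents w \<rho> b', h)"
  using assms contents_answer[of w \<rho> b b'] by (intro exec_Write) auto

text \<open>Invariant: tape 1 holds the answer for the current position \<open>v\<close>. Where the
  search stops depends on \<open>P\<close>, hence the existential \<open>u\<close>; the caller moves
  the head back in any case.\<close>

lemma exec_ExF_loop:
  assumes e: "\<forall>x. e x \<le> n"
    and body: "\<And>v b. v \<le> n \<Longrightarrow> exec s c (contents w \<rho> b, heads n (e(x := v)))
      (contents w \<rho> (if P v then One else Blank), heads n (e(x := v)))"
  shows "v \<le> n \<Longrightarrow> \<exists>u\<le>n. exec s (While [(1, -{One}), (var x, -{RE})] (Move (var x) MoveRight ;; c))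
      (contents w \<rho> (if P v then One else Blank), heads n (e(x := v)))
      (contents w \<rho> (if \<exists>u\<ge>v. u \<le> n \<and> P u then One else Blank), heads n (e(x := u)))"
proof (induction "n - v" arbitrary: v rule: less_induct)
  case less
  let ?W = "While [(1, -{One}), (var x, -{RE})] (Move (var x) MoveRight ;; c)"
  let ?test = "holds [(1, -{One}), (var x, -{RE})]
      (scan (contents w \<rho> (if P v then One else Blank), heads n (e(x := v))))"
  have lt: "\<forall>i. heads n (e(x := u)) i < s" if "u \<le> n" for u
    using that e by (intro heads_less) auto
  have fits: "fits s (contents w \<rho> (if P v then One else Blank), heads n (e(x := v)))"
    using lt less.prems by (auto simp: fits_def)
  have test: "?test \<longleftrightarrow> \<not> P v \<and> v \<noteq> n"
    using n0 n by (auto simp: holds_def scan_def ruler_def)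
  show ?case
  proof (cases "P v \<or> v = n")
    case True
    then have "(\<exists>u\<ge>v. u \<le> n \<and> P u) \<longleftrightarrow> P v"
      using less.prems by auto
    then show ?thesis
      using exec.WhileFalse[OF fits] test True less.prems by auto
  next
    case False
    then have v: "Suc v \<le> n" using less.prems by auto
    have 1: "exec s (Move (var x) MoveRight) (contents w \<rho> (if P v then One else Blank), heads n (e(x := v)))
        (contents w \<rho> (if P v then One else Blank), heads n (e(x := Suc v)))"
      using lt[OF v] lt[OF less.prems] heads_var[of n "e(x := v)" x "Suc v"]
      by (intro exec_Move) (auto dest: spec[of _ "var x"])
    have 2: "exec s c (contents w \<rho> (if P v then One else Blank), heads n (e(x := Suc v)))
        (contents w \<rho> (if P (Suc v) then One else Blank), heads n (e(x := Suc v)))"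
      using v by (rule body)
    obtain u where u: "u \<le> n" "exec s ?W (contents w \<rho> (if P (Suc v) then One else Blank), heads n (e(x := Suc v)))
      (contents w \<rho> (if \<exists>u\<ge>Suc v. u \<le> n \<and> P u then One else Blank), heads n (e(x := u)))"
      using less.hyps[of "Suc v"] v diff_less_mono2[OF lessI, of v n] by (auto simp: Suc_le_eq)
    have "(\<exists>u\<ge>v. u \<le> n \<and> P u) \<longleftrightarrow> (\<exists>u\<ge>Suc v. u \<le> n \<and> P u)"
      using False by (metis Suc_leD le_antisym not_less_eq_eq)
    moreover have ?test
      using test False by blast
    ultimately show ?thesis
      using exec.WhileTrue[OF fits _ exec.Seq[OF 1 2] u(2)] u(1) by (intro exI[of _ u]) (simp only:)
  qed
qed

text \<open>Two outcomes: a witness \<open>B\<close> is left on the tape with answer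
  \<open>One\<close>, or the counter has overflowed, which leaves \<open>LE\<close> and an already
  empty relation. Only the first needs a \<open>clear\<close> afterwards.\<close>

lemma exec_ExR_loop:
  assumes e: "\<forall>x. e x \<le> n"
    and body: "\<And>k b. k < 2 ^ N \<Longrightarrow> exec s c (contents w (\<rho>(R := set_decode k)) b, heads n e)
      (contents w (\<rho>(R := set_decode k)) (if P k then One else Blank), heads n e)"
  shows "k < 2 ^ N \<Longrightarrow> \<exists>B b. exec s (While [(1, {Blank})] (incr (rel R) ;; If [(1, {Blank})] c skip))
      (contents w (\<rho>(R := set_decode k)) (if P k then One else Blank), heads n e)
      (contents w (\<rho>(R := B)) b, heads n e) \<and> B \<subseteq> {..<N} \<and>
      (if \<exists>k'\<ge>k. k' < 2 ^ N \<and> P k' then b = One else b = LE \<and> B = {})"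
proof (induction "2 ^ N - k" arbitrary: k rule: less_induct)
  case less
  let ?W = "While [(1, {Blank})] (incr (rel R) ;; If [(1, {Blank})] c skip)" and ?h = "heads n e"
  let ?C = "\<lambda>k. contents w (\<rho>(R := set_decode k))"
  have lt: "\<forall>i. ?h i < s"
    using heads_less[OF e] .
  then have fits: "fits s (C, ?h)" for C
    by (simp add: fits_def)
  show ?case
  proof (cases "P k")
    case True
    then have "\<exists>k'\<ge>k. k' < 2 ^ N \<and> P k'"
      using less.prems by auto
    moreover have "exec s ?W (?C k One, ?h) (?C k One, ?h)"
      using fits by (intro exec.WhileFalse) (auto simp: holds_def scan_def)
    ultimately show ?thesis
      using True less.prems set_decode_bounded by auto
  next
    case False
    have test: "holds [(1, {Blank})] (scan (contents w \<rho>' b, ?h)) \<longleftrightarrow> b = Blank" for \<rho>' b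
      by (auto simp: holds_def scan_def)
    show ?thesis
    proof (cases "Suc k < 2 ^ N")
      case True
      have 1: "exec s (incr (rel R)) (?C k Blank, ?h) (?C (Suc k) Blank, ?h)"
        using exec_incr[OF e less.prems] True by simp
      have 2: "exec s (If [(1, {Blank})] c skip) (?C (Suc k) Blank, ?h)
          (?C (Suc k) (if P (Suc k) then One else Blank), ?h)"
        using test fits body[OF True] by (intro exec.IfTrue) auto
      obtain B b where Bb: "exec s ?W (?C (Suc k) (if P (Suc k) then One else Blank), ?h) (contents w (\<rho>(R := B)) b, ?h)"
          "B \<subseteq> {..<N}" "if \<exists>k'\<ge>Suc k. k' < 2 ^ N \<and> P k' then b = One else b = LE \<and> B = {}"
        using less.hyps[of "Suc k"] True diff_less_mono2[OF lessI less.prems] by blast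
      have "(\<exists>k'\<ge>k. k' < 2 ^ N \<and> P k') \<longleftrightarrow> (\<exists>k'\<ge>Suc k. k' < 2 ^ N \<and> P k')"
        using False by (metis Suc_leD le_antisym not_less_eq_eq)
      moreover have "exec s ?W (?C k Blank, ?h) (contents w (\<rho>(R := B)) b, ?h)"
        using exec.WhileTrue[OF fits _ exec.Seq[OF 1 2] Bb(1)] test by blast
      ultimately show ?thesis
        using Bb(2,3) by (intro exI[of _ B] exI[of _ b]) (simp only: False if_False simp_thms)
    next
      case k: False
      let ?E = "contents w (\<rho>(R := {})) LE"
      have 1: "exec s (incr (rel R)) (?C k Blank, ?h) (?E, ?h)"
        using exec_incr[OF e less.prems] k by simp
      \<comment> \<open>After the overflow the counter is back at 0; the inner test prevents the
        empty relation from being tried once more.\<close>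
      have 2: "exec s (If [(1, {Blank})] c skip) (?E, ?h) (?E, ?h)"
        using test fits exec_skip[OF lt] by (intro exec.IfFalse) auto
      have 3: "exec s ?W (?E, ?h) (?E, ?h)"
        using test fits by (intro exec.WhileFalse) auto
      have "exec s ?W (?C k Blank, ?h) (?E, ?h)"
        using exec.WhileTrue[OF fits _ exec.Seq[OF 1 2] 3] test by blast
      moreover have "k' = k" if "k' \<ge> k" "k' < 2 ^ N" for k'
        using that k by linarith
      then have "\<not> (\<exists>k'\<ge>k. k' < 2 ^ N \<and> P k')"
        using False by blast
      ultimately show ?thesis
        using False by auto
    qed
  qed
qed

text \<open>A quantifier starts its search from whatever its tape holds, so bound variables must be
  0 and bound relations empty on entry. No inner quantifier uses the same tape, so the search is not
  disturbed.\<close>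

lemma exec_eval_com:
  assumes "wf_fmla m \<phi>" "\<forall>x. e x \<le> n" "\<forall>R. \<rho> R \<subseteq> {..<N}" "\<forall>x\<in>bound_vars \<phi>. e x = 0"
    "\<forall>R\<in>bound_rels \<phi>. \<rho> R = {}"
  shows "exec s (eval_com \<phi>) (contents w \<rho> b, heads n e)
    (contents w \<rho> (if sat w e \<rho> \<phi> then One else Blank), heads n e)"
  using assms
proof (induction \<phi> arbitrary: e \<rho> b)
  case (Letter a x)
  then show ?case by (intro exec_Letter)
next
  case (Less x y)
  then show ?case by (intro exec_Less) auto
next
  case (Rel R x y)
  then show ?case by (intro exec_Rel) auto
next
  case (FNot \<phi>)
  let ?b = "if sat w e \<rho> \<phi> then One else Blank" and ?h = "heads n e"
  have lt: "\<forall>i. ?h i < s"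
    using FNot.prems heads_less by auto
  have 1: "exec s (eval_com \<phi>) (contents w \<rho> b, ?h) (contents w \<rho> ?b, ?h)"
    using FNot.prems by (intro FNot.IH) auto
  have 2: "exec s (If [(1, {One})] (Write 1 Blank) (Write 1 One)) (contents w \<rho> ?b, ?h)
      (contents w \<rho> (if sat w e \<rho> (FNot \<phi>) then One else Blank), ?h)"
    using exec_If_answer[OF lt] exec_Write_answer[OF lt] by auto
  show ?case
    using exec.Seq[OF 1 2] by (simp only: eval_com.simps)
next
  case (FAnd \<phi> \<psi>)
  let ?b = "if sat w e \<rho> \<phi> then One else Blank" and ?h = "heads n e"
  have lt: "\<forall>i. ?h i < s"
    using FAnd.prems heads_less by auto
  have 1: "exec s (eval_com \<phi>) (contents w \<rho> b, ?h) (contents w \<rho> ?b, ?h)"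
    using FAnd.prems by (intro FAnd.IH) auto
  have "exec s (eval_com \<psi>) (contents w \<rho> One, ?h) (contents w \<rho> (if sat w e \<rho> \<psi> then One else Blank), ?h)"
    using FAnd.prems by (intro FAnd.IH) auto
  then have 2: "exec s (If [(1, {One})] (eval_com \<psi>) skip) (contents w \<rho> ?b, ?h)
      (contents w \<rho> (if sat w e \<rho> (FAnd \<phi> \<psi>) then One else Blank), ?h)"
    using exec_If_answer[OF lt] exec_skip[OF lt] by auto
  show ?case
    using exec.Seq[OF 1 2] by (simp only: eval_com.simps)
next
  case (ExF x \<phi>)
  let ?P = "\<lambda>v. sat w (e(x := v)) \<rho> \<phi>"
  have e: "\<forall>x. e x \<le> n" using ExF.prems by auto
  have e0: "e(x := 0) = e" using ExF.prems by auto
  have body: "exec s (eval_com \<phi>) (contents w \<rho> b, heads n (e(x := v)))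
      (contents w \<rho> (if ?P v then One else Blank), heads n (e(x := v)))" if "v \<le> n" for v b
    using ExF.prems that by (intro ExF.IH) auto
  have 1: "exec s (eval_com \<phi>) (contents w \<rho> b, heads n e) (contents w \<rho> (if ?P 0 then One else Blank), heads n (e(x := 0)))"
    using body[of 0] e0 by simp
  obtain u where u: "u \<le> n" and 2: "exec s (While [(1, -{One}), (var x, -{RE})] (Move (var x) MoveRight ;; eval_com \<phi>))
      (contents w \<rho> (if ?P 0 then One else Blank), heads n (e(x := 0)))
      (contents w \<rho> (if \<exists>u\<ge>0. u \<le> n \<and> ?P u then One else Blank), heads n (e(x := u)))"
    using exec_ExF_loop[OF e body, of 0] by blast
  let ?b = "if \<exists>u\<ge>0. u \<le> n \<and> ?P u then One else Blank"
  have 3: "exec s (shift (var x) [] []) (contents w \<rho> ?b, heads n (e(x := u))) (contents w \<rho> ?b, heads n e)"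
  proof (rule exec_shift)
    have "heads n e = (heads n (e(x := u)))(var x := 0)"
      using e0 by (simp add: heads_var)
    then show "heads n e = (\<lambda>i. if i = var x then 0 else if i \<in> set [] then heads n (e(x := u)) i + heads n (e(x := u)) (var x)
        else if i \<in> set [] then heads n (e(x := u)) i - heads n (e(x := u)) (var x) else heads n (e(x := u)) i)"
      by (auto simp: fun_eq_iff)
    show "\<forall>j. heads n (e(x := u)) j < s"
      using e u by (intro heads_less) auto
  qed (auto simp: left_marked_ruler)
  have "(\<exists>u\<ge>0. u \<le> n \<and> ?P u) \<longleftrightarrow> sat w e \<rho> (ExF x \<phi>)"
    by (simp add: n)
  with exec.Seq[OF 1 exec.Seq[OF 2 3]] show ?case
    by (simp only: eval_com.simps)
next
  case (ExR R \<phi>)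
  let ?P = "\<lambda>k. sat w e (\<rho>(R := set_decode k)) \<phi>" and ?h = "heads n e"
  have e: "\<forall>x. e x \<le> n" using ExR.prems by auto
  have \<rho>0: "\<rho>(R := set_decode 0) = \<rho>" "\<rho>(R := {}) = \<rho>"
    using ExR.prems by (auto simp: fun_upd_idem)
  have lt: "\<forall>i. ?h i < s"
    using heads_less[OF e] .
  have body: "exec s (eval_com \<phi>) (contents w (\<rho>(R := set_decode k)) b, ?h)
      (contents w (\<rho>(R := set_decode k)) (if ?P k then One else Blank), ?h)" if "k < 2 ^ N" for k b
    using ExR.prems that set_decode_bounded[of k N] by (intro ExR.IH) auto
  have 1: "exec s (eval_com \<phi>) (contents w \<rho> b, ?h)
      (contents w (\<rho>(R := set_decode 0)) (if ?P 0 then One else Blank), ?h)"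
    using body[of 0] \<rho>0 by simp
  obtain B b' where 2: "exec s (While [(1, {Blank})] (incr (rel R) ;; If [(1, {Blank})] (eval_com \<phi>) skip))
      (contents w (\<rho>(R := set_decode 0)) (if ?P 0 then One else Blank), ?h)
      (contents w (\<rho>(R := B)) b', ?h)" and B: "B \<subseteq> {..<N}"
      "if \<exists>k'\<ge>0. k' < 2 ^ N \<and> ?P k' then b' = One else b' = LE \<and> B = {}"
    using exec_ExR_loop[OF e body, of 0] by auto
  have "(\<exists>B\<subseteq>{..<N}. sat w e (\<rho>(R := B)) \<phi>) \<longleftrightarrow> (\<exists>k. k < 2 ^ N \<and> ?P k)"
    by (metis finite_lessThan finite_subset set_decode_bounded set_encode_inverse)
  then have B': "if sat w e \<rho> (ExR R \<phi>) then b' = One else b' = LE \<and> B = {}"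
    using B(2) by (simp add: N)
  have 3: "exec s (If [(1, {One})] (clear (rel R)) (Write 1 Blank)) (contents w (\<rho>(R := B)) b', ?h)
      (contents w \<rho> (if sat w e \<rho> (ExR R \<phi>) then One else Blank), ?h)"
  proof (cases "sat w e \<rho> (ExR R \<phi>)")
    case True
    then have b': "b' = One" using B' by (simp only: if_True)
    have "exec s (clear (rel R)) (contents w (\<rho>(R := B)) One, ?h) (contents w \<rho> One, ?h)"
      using exec_clear[OF e B(1), of R \<rho> One] \<rho>0 by simp
    then show ?thesis
      using exec_If_answer(1)[OF lt, of "clear (rel R)" "\<rho>(R := B)"] True b' by (simp only: if_True heads_simps)
  next
    case False
    then have b': "b' = LE" "B = {}" using B' by (simp_all only: if_False)
    have "exec s (If [(1, {One})] (clear (rel R)) (Write 1 Blank)) (contents w \<rho> LE, ?h) (contents w \<rho> Blank, ?h)"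
      using exec_If_answer(2)[OF lt] exec_Write_answer[OF lt] by auto
    then show ?thesis
      using False b' \<rho>0 by (simp only: if_False)
  qed
  show ?case
    using exec.Seq[OF 1 exec.Seq[OF 2 3]] by (simp only: eval_com.simps)
qed

end

section \<open>Preparing the tapes\<close>

primrec seqs :: "(nat \<Rightarrow> com) \<Rightarrow> nat list \<Rightarrow> com" where
  "seqs f [] = skip"
| "seqs f (t # ts) = f t ;; seqs f ts"

text \<open>The length is found by walking to the first blank of the input. The input tape has no
  left mark, so its head is brought back by counting down on the marked tape
  \<open>t\<close>.\<close>

definition make_ruler :: "nat \<Rightarrow> com" where
  "make_ruler t = Write t LE ;; While [(0, -{Blank})] (Move 0 MoveRight ;; Move t MoveRight) ;;
     Write t RE ;; shift t [] [0]"

definition park :: "nat \<Rightarrow> com" where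
  "park t = While [(t, -{RE})] (Move t MoveRight)"

text \<open>Expects the heads of the tapes 5 and 7 to be parked, so that \<open>goto\<close> finds the last cell.\<close>

definition make_array :: "nat \<Rightarrow> com" where
  "make_array t = Write t LE ;; Move t MoveRight ;; goto t 5 7 ;; Move t MoveRight ;;
     Write t RE ;; Move t MoveLeft ;; goback t 5 7"

definition prepare :: "nat \<Rightarrow> com" where
  "prepare m = seqs make_ruler ([2, 3, 4] @ map var [0..<m]) ;; park 4 ;; park 5 ;; park 7 ;;
     seqs make_array (map rel [0..<m]) ;; shift 5 [] [] ;; shift 7 [] []"

text \<open>Tapes from \<open>5 + 2 * m\<close> on do not exist in the machine. They are declared to
  be in their final state, so that memories can be compared on all tapes.\<close>

definition start_contents :: "token list \<Rightarrow> nat \<Rightarrow> nat \<Rightarrow> nat \<Rightarrow> token tape_symbol" where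
  "start_contents w m i = (if i = 0 then fst (input_tape w)
     else if i < 5 + 2 * m then (\<lambda>_. Blank) else contents w (\<lambda>_. {}) Blank i)"

definition start_heads :: "nat \<Rightarrow> nat \<Rightarrow> nat \<Rightarrow> nat" where
  "start_heads n m i = (if i < 5 + 2 * m then 0 else heads n (\<lambda>_. 0) i)"

context
  fixes w :: "token list" and n s N
  assumes n: "n = length w" and N: "N = cells w" and s: "s = N + 2" and n0: "n > 0"
begin

lemma N_eq: "N = n * (n + 1) + n + 1"
  by (simp add: N n power2_eq_square)

lemma n_less_s: "n < s"
  by (simp add: s N_eq)

lemma exec_copy_length:
  assumes "C 0 = fst (input_tape w)" "t \<noteq> 0"
  shows "h 0 = i \<Longrightarrow> h t = i \<Longrightarrow> i \<le> n \<Longrightarrow> \<forall>j. h j < s \<Longrightarrow>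
    exec s (While [(0, -{Blank})] (Move 0 MoveRight ;; Move t MoveRight)) (C, h) (C, h(0 := n, t := n))"
proof (induction "n - i" arbitrary: i h)
  case 0
  then have i: "i = n" by simp
  then have eq: "h(0 := n, t := n) = h" using 0 by auto
  have "\<not> holds [(0, -{Blank})] (scan (C, h))" "fits s (C, h)"
    using 0 i assms by (auto simp: holds_def scan_def fits_def input_tape_def n)
  then show ?case
    unfolding eq by (rule exec.WhileFalse[rotated])
next
  case (Suc k)
  then have i: "Suc i \<le> n" by simp
  let ?h1 = "h(0 := Suc i)"
  let ?h2 = "?h1(t := Suc i)"
  have lt: "\<forall>j. ?h1 j < s" "\<forall>j. ?h2 j < s"
    using Suc.prems i n_less_s by auto
  have 1: "exec s (Move 0 MoveRight) (C, h) (C, ?h1)"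
    using Suc.prems lt i n_less_s by (intro exec_Move) auto
  have 2: "exec s (Move t MoveRight) (C, ?h1) (C, ?h2)"
    using Suc.prems lt i n_less_s assms by (intro exec_Move) auto
  have 3: "exec s (While [(0, -{Blank})] (Move 0 MoveRight ;; Move t MoveRight)) (C, ?h2) (C, ?h2(0 := n, t := n))"
    using Suc.hyps(2) i lt assms by (intro Suc.hyps(1)[of "Suc i"]) auto
  have eq: "?h2(0 := n, t := n) = h(0 := n, t := n)"
    by (auto simp: fun_eq_iff)
  have "holds [(0, -{Blank})] (scan (C, h))" "fits s (C, h)"
    using Suc.prems i assms by (auto simp: holds_def scan_def fits_def input_tape_def n)
  then show ?case
    using exec.WhileTrue[OF _ _ exec.Seq[OF 1 2] 3] unfolding eq by blast
qed

lemma exec_make_ruler: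
  assumes "C 0 = fst (input_tape w)" "t \<noteq> 0" "C t = (\<lambda>_. Blank)" "h 0 = 0" "h t = 0" "\<forall>j. h j < s"
  shows "exec s (make_ruler t) (C, h) (C(t := ruler n), h)"
proof -
  let ?C1 = "C(t := (\<lambda>_. Blank)(0 := LE))" and ?h1 = "h(0 := n, t := n)"
  have lt: "\<forall>j. ?h1 j < s"
    using assms n_less_s by auto
  have 1: "exec s (Write t LE) (C, h) (?C1, h)"
    using assms by (intro exec_Write) auto
  have 2: "exec s (While [(0, -{Blank})] (Move 0 MoveRight ;; Move t MoveRight)) (?C1, h) (?C1, ?h1)"
    using assms by (intro exec_copy_length) auto
  have "ruler n = ((\<lambda>_. Blank)(0 := LE))(n := RE)"
    using n0 by (auto simp: ruler_def)
  then have 3: "exec s (Write t RE) (?C1, ?h1) (C(t := ruler n), ?h1)"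
    using lt by (intro exec_Write) auto
  have 4: "exec s (shift t [] [0]) (C(t := ruler n), ?h1) (C(t := ruler n), h)"
    using lt assms by (intro exec_shift) (auto simp: left_marked_ruler)
  show ?thesis
    unfolding make_ruler_def using exec.Seq[OF 1 exec.Seq[OF 2 exec.Seq[OF 3 4]]] .
qed

lemma exec_make_rulers:
  "C 0 = fst (input_tape w) \<Longrightarrow> 0 \<notin> set ts \<Longrightarrow> distinct ts \<Longrightarrow> \<forall>t\<in>set ts. C t = (\<lambda>_. Blank) \<and> h t = 0 \<Longrightarrow>
   h 0 = 0 \<Longrightarrow> \<forall>j. h j < s \<Longrightarrow>
   exec s (seqs make_ruler ts) (C, h) (\<lambda>i. if i \<in> set ts then ruler n else C i, h)"
proof (induction ts arbitrary: C)
  case Nil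
  then show ?case by (simp add: exec_skip)
next
  case (Cons t ts)
  let ?C = "C(t := ruler n)"
  have 1: "exec s (make_ruler t) (C, h) (?C, h)"
    using Cons.prems by (intro exec_make_ruler) auto
  have 2: "exec s (seqs make_ruler ts) (?C, h) (\<lambda>i. if i \<in> set ts then ruler n else ?C i, h)"
    using Cons.prems by (intro Cons.IH) auto
  have "(\<lambda>i. if i \<in> set ts then ruler n else ?C i) = (\<lambda>i. if i \<in> set (t # ts) then ruler n else C i)"
    by auto
  with exec.Seq[OF 1 2] show ?case by simp
qed

lemma exec_park:
  "C t = ruler n \<Longrightarrow> h t \<le> n \<Longrightarrow> \<forall>j. h j < s \<Longrightarrow> exec s (park t) (C, h) (C, h(t := n))"
proof (induction "n - h t" arbitrary: h)
  case 0
  then have eq: "h(t := n) = h" by auto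
  have "\<not> holds [(t, -{RE})] (scan (C, h))" "fits s (C, h)"
    using 0 n0 by (auto simp: holds_def scan_def fits_def ruler_def)
  then show ?case
    unfolding eq park_def by (rule exec.WhileFalse[rotated])
next
  case (Suc k)
  then have i: "Suc (h t) \<le> n" by simp
  let ?h1 = "h(t := Suc (h t))"
  have lt: "\<forall>j. ?h1 j < s"
    using Suc.prems i n_less_s by auto
  have 1: "exec s (Move t MoveRight) (C, h) (C, ?h1)"
    using Suc.prems lt i n_less_s by (intro exec_Move) auto
  have 2: "exec s (park t) (C, ?h1) (C, ?h1(t := n))"
    using Suc.hyps(2) Suc.prems i lt by (intro Suc.hyps(1)) auto
  have "holds [(t, -{RE})] (scan (C, h))" "fits s (C, h)"
    using Suc.prems i by (auto simp: holds_def scan_def fits_def ruler_def)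
  then show ?case
    using exec.WhileTrue[OF _ _ 1 2[unfolded park_def]] by (simp add: park_def)
qed

lemma exec_make_array:
  assumes t: "t > 5" "t \<noteq> 7" and C: "C 2 = ruler n" "C 3 = ruler n" "C 4 = ruler n" "C 5 = ruler n" "C 7 = ruler n"
    "C t = (\<lambda>_. Blank)"
    and h: "h 2 = 0" "h 3 = 0" "h 4 = n" "h 5 = n" "h 7 = n" "h t = 0" and lt: "\<forall>j. h j < s"
  shows "exec s (make_array t) (C, h) (C(t := bits N {}), h(t := 1))"
proof -
  let ?C1 = "C(t := (\<lambda>_. Blank)(0 := LE))" and ?C2 = "C(t := bits N {})"
  let ?h1 = "h(t := 1)"
  \<comment> \<open>From cell 1, \<open>n * (n + 1) + n\<close> moves lead to cell \<open>N\<close>,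
    the last digit; the right mark goes into the cell after it.\<close>
  let ?h2 = "?h1(5 := 0, 7 := 0, 2 := n, 3 := n, t := N)"
  let ?h3 = "?h2(t := N + 1)"
  have ls: "\<forall>j. ?h1 j < s" "\<forall>j. ?h2 j < s" "\<forall>j. ?h3 j < s"
    using lt n_less_s s by auto
  have 1: "exec s (Write t LE) (C, h) (?C1, h)"
    using lt C h by (intro exec_Write) auto
  have 2: "exec s (Move t MoveRight) (?C1, h) (?C1, ?h1)"
    using lt h s by (intro exec_Move) auto
  have "exec s (goto t 5 7) (?C1, ?h1)
     (?C1, ?h1(5 := 0, 7 := 0, 2 := ?h1 5, 3 := ?h1 7, t := ?h1 t + ?h1 5 * (n + 1) + ?h1 7))"
    using ls C h t by (intro exec_goto) (auto simp: left_marked_ruler s N_eq)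
  moreover have "?h1(5 := 0, 7 := 0, 2 := ?h1 5, 3 := ?h1 7, t := ?h1 t + ?h1 5 * (n + 1) + ?h1 7) = ?h2"
    using h t by (auto simp: fun_eq_iff N_eq)
  ultimately have 3: "exec s (goto t 5 7) (?C1, ?h1) (?C1, ?h2)"
    by simp
  have 4: "exec s (Move t MoveRight) (?C1, ?h2) (?C1, ?h3)"
    using ls s by (intro exec_Move) auto
  have "bits N {} = ((\<lambda>_. Blank)(0 := LE))(N + 1 := RE)"
    by (auto simp: bits_def)
  then have 5: "exec s (Write t RE) (?C1, ?h3) (?C2, ?h3)"
    using ls by (intro exec_Write) auto
  have 6: "exec s (Move t MoveLeft) (?C2, ?h3) (?C2, ?h2)"
    using ls s by (intro exec_Move) auto
  have "exec s (goback t 5 7) (?C2, ?h2)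
     (?C2, ?h2(2 := 0, 3 := 0, 5 := ?h2 2, 7 := ?h2 3, t := ?h2 t - (?h2 2 * (n + 1) + ?h2 3)))"
    using ls C h t by (intro exec_goback) (auto simp: left_marked_ruler)
  moreover have "?h2(2 := 0, 3 := 0, 5 := ?h2 2, 7 := ?h2 3, t := ?h2 t - (?h2 2 * (n + 1) + ?h2 3)) = ?h1"
    using h t by (auto simp: fun_eq_iff N_eq)
  ultimately have 7: "exec s (goback t 5 7) (?C2, ?h2) (?C2, ?h1)"
    by simp
  show ?thesis
    unfolding make_array_def
    using exec.Seq[OF 1 exec.Seq[OF 2 exec.Seq[OF 3 exec.Seq[OF 4 exec.Seq[OF 5 exec.Seq[OF 6 7]]]]]] .
qed

lemma exec_make_arrays:
  "\<forall>t\<in>set ts. t > 5 \<and> t \<noteq> 7 \<and> C t = (\<lambda>_. Blank) \<and> h t = 0 \<Longrightarrow> distinct ts \<Longrightarrow>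
   C 2 = ruler n \<Longrightarrow> C 3 = ruler n \<Longrightarrow> C 4 = ruler n \<Longrightarrow> C 5 = ruler n \<Longrightarrow> C 7 = ruler n \<Longrightarrow>
   h 2 = 0 \<Longrightarrow> h 3 = 0 \<Longrightarrow> h 4 = n \<Longrightarrow> h 5 = n \<Longrightarrow> h 7 = n \<Longrightarrow> \<forall>j. h j < s \<Longrightarrow>
   exec s (seqs make_array ts) (C, h)
     (\<lambda>i. if i \<in> set ts then bits N {} else C i, \<lambda>i. if i \<in> set ts then 1 else h i)"
proof (induction ts arbitrary: C h)
  case Nil
  then show ?case by (simp add: exec_skip)
next
  case (Cons t ts)
  let ?C = "C(t := bits N {})" and ?h = "h(t := 1)"
  have 1: "exec s (make_array t) (C, h) (?C, ?h)"
    using Cons.prems by (intro exec_make_array) auto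
  have 2: "exec s (seqs make_array ts) (?C, ?h)
      (\<lambda>i. if i \<in> set ts then bits N {} else ?C i, \<lambda>i. if i \<in> set ts then 1 else ?h i)"
    using Cons.prems s by (intro Cons.IH) auto
  have "(\<lambda>i. if i \<in> set ts then bits N {} else ?C i) = (\<lambda>i. if i \<in> set (t # ts) then bits N {} else C i)"
    "(\<lambda>i. if i \<in> set ts then 1 else ?h i) = (\<lambda>i. if i \<in> set (t # ts) then 1 else h i)"
    by auto
  with exec.Seq[OF 1 2] show ?case by simp
qed

lemma tape_cases:
  fixes i m :: nat
  assumes "i < 5 + 2 * m"
  obtains "i = 0" | "i = 1" | "i \<in> set ([2, 3, 4] @ map var [0..<m])" | "i \<in> set (map rel [0..<m])"
proof -
  consider "i < 5" | "i \<ge> 5" "even i" | "i \<ge> 5" "odd i" by linarith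
  then show thesis
  proof cases
    case 1
    then have "i = 0 \<or> i = 1 \<or> i = 2 \<or> i = 3 \<or> i = 4" by linarith
    then show thesis using that by auto
  next
    case 2
    then have "i = rel ((i - 6) div 2)" "(i - 6) div 2 < m" using assms by presburger+
    then have "i \<in> set (map rel [0..<m])" unfolding set_map by (intro image_eqI[of _ _ "(i - 6) div 2"]) auto
    then show thesis using that by blast
  next
    case 3
    then have "i = var ((i - 5) div 2)" "(i - 5) div 2 < m" using assms by presburger+
    then have "i \<in> set (map var [0..<m])" unfolding set_map by (intro image_eqI[of _ _ "(i - 5) div 2"]) auto
    then show thesis using that by auto
  qed
qed

text \<open>\<open>m \<ge> 2\<close> provides the variable tapes 5 and 7, whose parked heads address
  the last array cell.\<close>

lemma exec_prepare:
  assumes m: "m \<ge> 2"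
  shows "exec s (prepare m) (start_contents w m, start_heads n m) (contents w (\<lambda>_. {}) Blank, heads n (\<lambda>_. 0))"
proof -
  let ?R = "[2, 3, 4] @ map var [0..<m]" and ?A = "map rel [0..<m]"
  let ?C0 = "start_contents w m" and ?h0 = "start_heads n m"
  let ?C1 = "\<lambda>i. if i \<in> set ?R then ruler n else ?C0 i"
  let ?C2 = "\<lambda>i. if i \<in> set ?A then bits N {} else ?C1 i"
  let ?h1 = "?h0(4 := n, 5 := n, 7 := n)"
  let ?h2 = "\<lambda>i. if i \<in> set ?A then 1 else ?h1 i"
  have R5: "var 0 \<in> set ?R" "var 1 \<in> set ?R"
    using m by (auto simp del: mult_Suc_right)
  then have R: "2 \<in> set ?R" "3 \<in> set ?R" "4 \<in> set ?R" "5 \<in> set ?R" "7 \<in> set ?R"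
    by auto
  have A: "t \<notin> set ?R \<and> 5 < t \<and> t \<noteq> 7 \<and> t < 5 + 2 * m" if "t \<in> set ?A" for t
    using that by auto
  have Rb: "0 < t \<and> t < 5 + 2 * m" if "t \<in> set ?R" for t
    using that by auto
  have lt0: "\<forall>i. ?h0 i < s"
    using s by (auto simp: start_heads_def heads_def n_less_s)
  have lt1: "\<forall>i. ?h1 i < s" and lt: "\<forall>i. (?h0(4 := n)) i < s" "\<forall>i. (?h0(4 := n, 5 := n)) i < s"
    using lt0 n_less_s by auto
  have lt2: "\<forall>i. ?h2 i < s"
    using lt1 s by auto
  have small: "?h0 i = 0" if "i < 9" for i
    using that m by (auto simp: start_heads_def)
  have 1: "exec s (seqs make_ruler ?R) (?C0, ?h0) (?C1, ?h0)"
  proof (rule exec_make_rulers)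
    show "distinct ?R" by (auto simp: distinct_map inj_on_def)
    show "\<forall>t\<in>set ?R. ?C0 t = (\<lambda>_. Blank) \<and> ?h0 t = 0"
      using Rb by (auto simp: start_contents_def start_heads_def)
  qed (use lt0 small in \<open>auto simp: start_contents_def\<close>)
  have 2: "exec s (park 4) (?C1, ?h0) (?C1, ?h0(4 := n))"
    using lt0 small by (intro exec_park) auto
  have 3: "exec s (park 5) (?C1, ?h0(4 := n)) (?C1, ?h0(4 := n, 5 := n))"
    using lt small R by (intro exec_park) (simp_all only: if_True, auto)
  have 4: "exec s (park 7) (?C1, ?h0(4 := n, 5 := n)) (?C1, ?h1)"
    using lt small R by (intro exec_park) (simp_all only: if_True, auto)
  have 5: "exec s (seqs make_array ?A) (?C1, ?h1) (?C2, ?h2)"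
  proof (rule exec_make_arrays)
    show "distinct ?A" by (auto simp: distinct_map inj_on_def)
    show "\<forall>t\<in>set ?A. 5 < t \<and> t \<noteq> 7 \<and> ?C1 t = (\<lambda>_. Blank) \<and> ?h1 t = 0"
    proof
      fix t assume t: "t \<in> set ?A"
      have "?h1 t = 0" "?C0 t = (\<lambda>_. Blank)"
        using A[OF t] t by (auto simp: start_heads_def start_contents_def)
      then show "5 < t \<and> t \<noteq> 7 \<and> ?C1 t = (\<lambda>_. Blank) \<and> ?h1 t = 0"
        using A[OF t] by (simp only: if_False simp_thms)
    qed
  qed (use R small lt1 in \<open>simp_all only: if_True, auto\<close>)
  have C2: "?C2 = contents w (\<lambda>_. {}) Blank"
  proof
    fix i
    show "?C2 i = contents w (\<lambda>_. {}) Blank i"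
    proof (cases "i < 5 + 2 * m")
      case True
      then show ?thesis
      proof (cases rule: tape_cases)
        case 1 then show ?thesis by (auto simp: start_contents_def)
      next
        case 2 then show ?thesis using m by (auto simp: start_contents_def)
      next
        case 3
        then have "i \<notin> set ?A" using A by blast
        with 3 have "?C2 i = ruler n" by (simp only: if_True if_False)
        moreover have "contents w (\<lambda>_. {}) Blank i = ruler n"
          using 3 n by auto
        ultimately show ?thesis by simp
      next
        case 4
        then have "?C2 i = bits N {}" by (simp only: if_True)
        moreover have "contents w (\<lambda>_. {}) Blank i = bits N {}"
          using 4 N by auto
        ultimately show ?thesis by simp
      qed
    next
      case False
      then have "i \<notin> set ?A" "i \<notin> set ?R" using A Rb by blast+
      then have "?C2 i = ?C0 i" by (simp only: if_False)
      with False show ?thesis by (simp add: start_contents_def)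
    qed
  qed
  let ?h3 = "?h2(5 := 0)" and ?h4 = "?h2(5 := 0, 7 := 0)"
  have A57: "5 \<notin> set ?A" "7 \<notin> set ?A" "4 \<notin> set ?A"
    using A[of 5] A[of 7] A[of 4] by fastforce+
  have 6: "exec s (shift 5 [] []) (?C2, ?h2) (?C2, ?h3)"
    using lt2 unfolding C2 by (intro exec_shift) (auto simp: contents_def left_marked_ruler fun_eq_iff)
  have 7: "exec s (shift 7 [] []) (?C2, ?h3) (?C2, ?h4)"
    using lt2 s unfolding C2 by (intro exec_shift) (auto simp: contents_def left_marked_ruler fun_eq_iff)
  have h4: "?h4 = heads n (\<lambda>_. 0)"
  proof
    fix i
    show "?h4 i = heads n (\<lambda>_. 0) i"
    proof (cases "i < 5 + 2 * m")
      case True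
      then show ?thesis
      proof (cases rule: tape_cases)
        case 1 then show ?thesis using small by auto
      next
        case 2 then show ?thesis using small by auto
      next
        case 3
        then have "i \<notin> set ?A" using A by blast
        then have "?h4 i = (if i = 4 then n else 0)"
          using True A57 by (simp add: start_heads_def del: set_map)
        moreover have "heads n (\<lambda>_. 0) i = (if i = 4 then n else 0)"
          using 3 by (auto simp: heads_def)
        ultimately show ?thesis by simp
      next
        case 4
        then have "?h4 i = 1" using A57 by (simp only: if_True fun_upd_def) metis
        moreover have "heads n (\<lambda>_. 0) i = 1"
          using 4 by auto
        ultimately show ?thesis by simp
      qed
    next
      case False
      then have "i \<notin> set ?A" "i > 8" using A m by (blast, simp)
      then have "?h4 i = ?h0 i" by auto
      with False show ?thesis by (simp add: start_heads_def)
    qed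
  qed
  show ?thesis
    unfolding prepare_def
    using exec.Seq[OF 1 exec.Seq[OF 2 exec.Seq[OF 3 exec.Seq[OF 4 exec.Seq[OF 5 exec.Seq[OF 6 7]]]]]]
    unfolding C2 h4 .
qed

end

section \<open>Second-order properties of words are decidable in polynomial space\<close>

lemma below_moves: "tapes_below K (moves d ts) \<longleftrightarrow> 0 < K \<and> (\<forall>t\<in>set ts. t < K)"
  by (induction ts) auto

lemma below_shift: "tapes_below K (shift a us ds) \<longleftrightarrow> 0 < K \<and> a < K \<and> (\<forall>t\<in>set us \<union> set ds. t < K)"
  by (auto simp: shift_def below_moves)

lemma below_goto:
  "tapes_below K (goto T x y) \<longleftrightarrow> 4 < K \<and> T < K \<and> x < K \<and> y < K"
  "tapes_below K (goback T x y) \<longleftrightarrow> 4 < K \<and> T < K \<and> x < K \<and> y < K"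
  by (auto simp: goto_def goback_def advance_def retreat_def below_shift)

lemma below_eval_com: "wf_fmla m \<phi> \<Longrightarrow> tapes_below (5 + 2 * m) (eval_com \<phi>)"
  by (induction \<phi>) (auto simp: below_shift below_goto incr_def clear_def)

lemma below_seqs: "tapes_below K (seqs f ts) \<longleftrightarrow> 0 < K \<and> (\<forall>t\<in>set ts. tapes_below K (f t))"
  by (induction ts) auto

lemma below_prepare: "m \<ge> 2 \<Longrightarrow> tapes_below (5 + 2 * m) (prepare m)"
  by (auto simp: prepare_def below_seqs make_ruler_def make_array_def park_def below_shift below_goto)

theorem second_order_polynomial_space:
  assumes wf: "wf_fmla m \<phi>" and m: "m \<ge> 2"
  shows "\<exists>M p. turing_machine M \<and> (\<forall>w. w \<noteq> [] \<longrightarrow>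
    (accepts M w \<longleftrightarrow> sat w (\<lambda>_. 0) (\<lambda>_. {}) \<phi>) \<and> (rejects M w \<longleftrightarrow> \<not> sat w (\<lambda>_. 0) (\<lambda>_. {}) \<phi>) \<and>
    runs_in_space M w (poly p (length w)))"
proof (intro exI conjI allI impI)
  let ?K = "5 + 2 * m" and ?c = "prepare m ;; eval_com \<phi>"
  \<comment> \<open>The polynomial is (n + 1)^2 + 2: one cell for each pair of positions and one for
    each end mark.\<close>
  let ?M = "compile ?K ?c" and ?p = "[:3, 2, 1:] :: nat poly"
  show "turing_machine ?M"
    by (rule turing_machine_compile) simp
  fix w :: "token list" assume w: "w \<noteq> []"
  let ?n = "length w"
  let ?s = "cells w + 2" and ?b = "if sat w (\<lambda>_. 0) (\<lambda>_. {}) \<phi> then One else Blank"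
  have p: "?s = poly ?p ?n"
    by (simp add: power2_eq_square algebra_simps)
  have 1: "exec ?s (prepare m) (start_contents w m, start_heads ?n m)
      (contents w (\<lambda>_. {}) Blank, heads ?n (\<lambda>_. 0))"
    using exec_prepare[OF refl refl refl] w m by simp
  have 2: "exec ?s (eval_com \<phi>) (contents w (\<lambda>_. {}) Blank, heads ?n (\<lambda>_. 0)) (contents w (\<lambda>_. {}) ?b, heads ?n (\<lambda>_. 0))"
    using exec_eval_com[OF refl refl refl] w wf by simp
  have init: "initial_config ?M w = config_of ?K ?c ([?c], start_contents w m, start_heads ?n m)"
  proof -
    have "input_tape w # replicate (?K - 1) (input_tape []) =
        map (\<lambda>i. (start_contents w m i, start_heads ?n m i)) [0..<?K]"
      by (rule nth_equalityI)
        (auto simp: nth_Cons' start_contents_def start_heads_def input_tape_def simp del: upt_Suc)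
    then show ?thesis
      by (simp add: initial_config_def config_of_def compile_def Let_def del: upt_Suc)
  qed
  have below: "tapes_below ?K ?c" "?K \<ge> 2"
    using below_prepare[OF m] below_eval_com[OF wf] by auto
  note correct = compile_correct[OF below init exec.Seq[OF 1 2]]
  show "accepts ?M w \<longleftrightarrow> sat w (\<lambda>_. 0) (\<lambda>_. {}) \<phi>" "rejects ?M w \<longleftrightarrow> \<not> sat w (\<lambda>_. 0) (\<lambda>_. {}) \<phi>"
    using correct(1,2) by (auto simp: scan_def)
  show "runs_in_space ?M w (poly ?p ?n)"
    using correct(3) unfolding p .
qed

section \<open>The structure of words\<close>

definition letter :: "token list \<Rightarrow> token \<Rightarrow> nat \<Rightarrow> bool" where
  "letter w a p \<longleftrightarrow> p < length w \<and> w ! p = a"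

definition isbit :: "token list \<Rightarrow> nat \<Rightarrow> bool" where
  "isbit w p \<longleftrightarrow> letter w (TBit True) p \<or> letter w (TBit False) p"

text \<open>The place behind the numeral, possibly empty, that follows \<open>p\<close>: the first
  argument of the token at \<open>p\<close>, or the end of a leaf. Quantifiers are bounded by
  positions so that a formula can express this.\<close>

definition next_pos :: "token list \<Rightarrow> nat \<Rightarrow> nat \<Rightarrow> bool" where
  "next_pos w p m \<longleftrightarrow> p < m \<and> \<not> isbit w m \<and> (\<forall>k\<le>length w. p < k \<and> k < m \<longrightarrow> isbit w k)"

text \<open>The successor in terms of the order alone, since formulas have no arithmetic.\<close>

definition succ_pos :: "token list \<Rightarrow> nat \<Rightarrow> nat \<Rightarrow> bool" where
  "succ_pos w p m \<longleftrightarrow> p < m \<and> \<not> (\<exists>k\<le>length w. p < k \<and> k < m)"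

definition modal :: "token list \<Rightarrow> nat \<Rightarrow> bool" where
  "modal w p \<longleftrightarrow> letter w TEx p \<or> letter w TAll p"

definition leaf :: "token list \<Rightarrow> nat \<Rightarrow> bool" where
  "leaf w p \<longleftrightarrow> letter w TName p \<or> letter w TTop p \<or> letter w TBot p"

definition unary :: "token list \<Rightarrow> nat \<Rightarrow> bool" where
  "unary w p \<longleftrightarrow> letter w TNot p \<or> modal w p"

definition binary :: "token list \<Rightarrow> nat \<Rightarrow> bool" where
  "binary w p \<longleftrightarrow> letter w TAnd p \<or> letter w TOr p"

text \<open>\<open>ends w A\<close> determines \<open>A p q\<close> to mean that the concept starting at \<open>p\<close> ends before \<open>q\<close>.\<close>

definition ends :: "token list \<Rightarrow> (nat \<Rightarrow> nat \<Rightarrow> bool) \<Rightarrow> bool" where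
  "ends w A \<longleftrightarrow> (\<forall>p\<le>length w. \<forall>q\<le>length w.
     (leaf w p \<longrightarrow> (A p q \<longleftrightarrow> next_pos w p q)) \<and>
     (unary w p \<longrightarrow> (A p q \<longleftrightarrow> (\<exists>m\<le>length w. next_pos w p m \<and> A m q))) \<and>
     (binary w p \<longrightarrow> (A p q \<longleftrightarrow> (\<exists>m\<le>length w. next_pos w p m \<and> (\<exists>k\<le>length w. A m k \<and> A k q)))))"

text \<open>\<open>same w S\<close> determines \<open>S i j\<close> to mean that \<open>i\<close> and \<open>j\<close> are followed by the same numeral.\<close>

definition same :: "token list \<Rightarrow> (nat \<Rightarrow> nat \<Rightarrow> bool) \<Rightarrow> bool" where
  "same w S \<longleftrightarrow> (\<forall>i\<le>length w. \<forall>j\<le>length w. S i j \<longleftrightarrow>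
     (\<exists>i'\<le>length w. succ_pos w i i' \<and> (\<exists>j'\<le>length w. succ_pos w j j' \<and>
       (\<not> isbit w i' \<and> \<not> isbit w j' \<or>
        letter w (TBit True) i' \<and> letter w (TBit True) j' \<and> S i' j' \<or>
        letter w (TBit False) i' \<and> letter w (TBit False) j' \<and> S i' j'))))"

text \<open>
  A truth assignment \<open>V\<close> to the subconcepts treats \<open>\<forall>R.C\<close> as \<open>\<not> \<exists>R.\<not> C\<close>: at an occurrence \<open>p\<close> of
  a restriction, \<open>holds_ex\<close> is the value of \<open>\<exists>R.D\<close> and \<open>holds_arg\<close> that of \<open>D\<close>, where \<open>D\<close> is \<open>C\<close>
  or \<open>\<not> C\<close>.
\<close>

definition holds_ex :: "token list \<Rightarrow> (nat \<Rightarrow> bool) \<Rightarrow> nat \<Rightarrow> bool" where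
  "holds_ex w V p \<longleftrightarrow> letter w TEx p \<and> V p \<or> letter w TAll p \<and> \<not> V p"

definition holds_arg :: "token list \<Rightarrow> (nat \<Rightarrow> bool) \<Rightarrow> nat \<Rightarrow> bool" where
  "holds_arg w V p \<longleftrightarrow> (\<exists>m\<le>length w. next_pos w p m \<and> (letter w TEx p \<and> V m \<or> letter w TAll p \<and> \<not> V m))"

text \<open>
  \<open>Q i j\<close> says that some world satisfies the argument at \<open>i\<close> but not that at \<open>j\<close>; \<open>Q i i\<close> only
  says that some world satisfies the argument at \<open>i\<close>.
\<close>

definition world :: "token list \<Rightarrow> (nat \<Rightarrow> nat \<Rightarrow> bool) \<Rightarrow> (nat \<Rightarrow> nat \<Rightarrow> bool) \<Rightarrow> (nat \<Rightarrow> nat \<Rightarrow> bool) \<Rightarrow>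
    (nat \<Rightarrow> bool) \<Rightarrow> bool" where
  "world w A S Q V \<longleftrightarrow>
     (\<forall>p\<le>length w. \<forall>m\<le>length w. next_pos w p m \<longrightarrow>
        (letter w TTop p \<longrightarrow> V p) \<and> (letter w TBot p \<longrightarrow> \<not> V p) \<and>
        (letter w TNot p \<longrightarrow> (V p \<longleftrightarrow> \<not> V m)) \<and>
        (\<forall>k\<le>length w. A m k \<longrightarrow>
           (letter w TAnd p \<longrightarrow> (V p \<longleftrightarrow> V m \<and> V k)) \<and>
           (letter w TOr p \<longrightarrow> (V p \<longleftrightarrow> V m \<or> V k)) \<and>
           (letter w TSub p \<longrightarrow> (V m \<longrightarrow> V k)))) \<and>
     (\<forall>i\<le>length w. \<forall>j\<le>length w. S i j \<longrightarrow>
        (letter w TName i \<and> letter w TName j \<and> V i \<longrightarrow> V j) \<and>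
        (modal w j \<and> holds_ex w V i \<and> (i = j \<or> \<not> holds_ex w V j) \<longrightarrow> Q i j))"

text \<open>The worlds demanded by \<open>Q\<close> must respect \<open>Q\<close> themselves:
  \<open>Q\<close> is a post-fixed point of a monotone condition, not the result of a recursion.
  Position 0 is where \<open>C0\<close> begins.\<close>

definition consistent :: "token list \<Rightarrow> bool" where
  "consistent w \<longleftrightarrow> (\<exists>A S Q. ends w A \<and> same w S \<and> (\<exists>V. world w A S Q V \<and> V 0) \<and>
     (\<forall>i\<le>length w. \<forall>j\<le>length w. Q i j \<longrightarrow>
        (\<exists>V. world w A S Q V \<and> holds_arg w V i \<and> (i = j \<or> \<not> holds_arg w V j))))"

section \<open>Consistency as a second-order formula\<close>

definition "FOr \<phi> \<psi> = FNot (FAnd (FNot \<phi>) (FNot \<psi>))"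
definition "FImp \<phi> \<psi> = FNot (FAnd \<phi> (FNot \<psi>))"
definition "FIff \<phi> \<psi> = FAnd (FImp \<phi> \<psi>) (FImp \<psi> \<phi>)"
definition "AllF x \<phi> = FNot (ExF x (FNot \<phi>))"
definition "FEq x y = FAnd (FNot (Less x y)) (FNot (Less y x))"

text \<open>Variable 0 is never quantified and denotes position 0; variable 5 is local to the next two formulas.\<close>

definition "FBit x = FOr (Letter (TBit True) x) (Letter (TBit False) x)"
definition "FNext x y = FAnd (Less x y) (FAnd (FNot (FBit y)) (AllF 5 (FImp (FAnd (Less x 5) (Less 5 y)) (FBit 5))))"
definition "FSucc x y = FAnd (Less x y) (FNot (ExF 5 (FAnd (Less x 5) (Less 5 y))))"
definition "FModal x = FOr (Letter TEx x) (Letter TAll x)"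
definition "FLeaf x = FOr (Letter TName x) (FOr (Letter TTop x) (Letter TBot x))"
definition "FUnary x = FOr (Letter TNot x) (FModal x)"
definition "FBinary x = FOr (Letter TAnd x) (Letter TOr x)"

abbreviation "FA \<equiv> Rel 0"
abbreviation "FS \<equiv> Rel 1"
abbreviation "FQ \<equiv> Rel 2"
text \<open>A set of positions is column 0 of a binary relation, addressed through variable 0, which
  always denotes 0.\<close>

abbreviation "FV x \<equiv> Rel 3 x 0"

definition "FEnds = AllF 1 (AllF 2 (FAnd (FImp (FLeaf 1) (FIff (FA 1 2) (FNext 1 2)))
  (FAnd (FImp (FUnary 1) (FIff (FA 1 2) (ExF 3 (FAnd (FNext 1 3) (FA 3 2)))))
    (FImp (FBinary 1) (FIff (FA 1 2) (ExF 3 (FAnd (FNext 1 3) (ExF 4 (FAnd (FA 3 4) (FA 4 2))))))))))"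

definition "FSame = AllF 1 (AllF 2 (FIff (FS 1 2) (ExF 3 (FAnd (FSucc 1 3) (ExF 4 (FAnd (FSucc 2 4)
  (FOr (FAnd (FNot (FBit 3)) (FNot (FBit 4)))
    (FOr (FAnd (Letter (TBit True) 3) (FAnd (Letter (TBit True) 4) (FS 3 4)))
      (FAnd (Letter (TBit False) 3) (FAnd (Letter (TBit False) 4) (FS 3 4)))))))))))"

definition "FHoldsEx x = FOr (FAnd (Letter TEx x) (FV x)) (FAnd (Letter TAll x) (FNot (FV x)))"

definition "FHoldsArg x = ExF 3 (FAnd (FNext x 3)
  (FOr (FAnd (Letter TEx x) (FV 3)) (FAnd (Letter TAll x) (FNot (FV 3)))))"

definition "FWorld = FAnd
  (AllF 1 (AllF 3 (FImp (FNext 1 3)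
    (FAnd (FImp (Letter TTop 1) (FV 1)) (FAnd (FImp (Letter TBot 1) (FNot (FV 1)))
    (FAnd (FImp (Letter TNot 1) (FIff (FV 1) (FNot (FV 3))))
      (AllF 4 (FImp (FA 3 4)
        (FAnd (FImp (Letter TAnd 1) (FIff (FV 1) (FAnd (FV 3) (FV 4))))
        (FAnd (FImp (Letter TOr 1) (FIff (FV 1) (FOr (FV 3) (FV 4))))
          (FImp (Letter TSub 1) (FImp (FV 3) (FV 4)))))))))))))
  (AllF 1 (AllF 2 (FImp (FS 1 2)
    (FAnd (FImp (FAnd (Letter TName 1) (FAnd (Letter TName 2) (FV 1))) (FV 2))
      (FImp (FAnd (FModal 2) (FAnd (FHoldsEx 1) (FOr (FEq 1 2) (FNot (FHoldsEx 2))))) (FQ 1 2))))))"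

text \<open>Variables 6 and 7 are kept apart from those bound inside \<open>FWorld\<close> and
  \<open>FHoldsArg\<close>. Position 0 is named through variable 1 because \<open>FV 0\<close> would
  use variable 0 twice, which \<open>wf_fmla\<close> forbids.\<close>

definition "FConsistent = ExR 0 (ExR 1 (ExR 2 (FAnd FEnds (FAnd FSame
  (FAnd (ExR 3 (FAnd FWorld (ExF 1 (FAnd (FEq 1 0) (FV 1)))))
    (AllF 6 (AllF 7 (FImp (FQ 6 7)
      (ExR 3 (FAnd FWorld (FAnd (FHoldsArg 6) (FOr (FEq 6 7) (FNot (FHoldsArg 7)))))))))))))) "

lemmas fmla_defs = FOr_def FImp_def FIff_def AllF_def FEq_def FBit_def FNext_def FSucc_def FModal_def FLeaf_def FUnary_def FBinary_def FEnds_def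
  FSame_def FHoldsEx_def FHoldsArg_def FWorld_def FConsistent_def

lemma wf_FConsistent: "wf_fmla 8 FConsistent"
  by (simp add: fmla_defs)

section \<open>Relations on positions as tables\<close>

definition tab :: "token list \<Rightarrow> nat set \<Rightarrow> nat \<Rightarrow> nat \<Rightarrow> bool" where
  "tab w B p q \<longleftrightarrow> p * (length w + 1) + q \<in> B"

text \<open>Division by \<open>length w + 1\<close> recovers row and column, since a column is at
  most \<open>length w\<close>.\<close>

lemma tab_exists:
  "\<exists>B\<subseteq>{..<cells w}. \<forall>p\<le>length w. \<forall>q\<le>length w. tab w B p q \<longleftrightarrow> P p q"
proof (intro exI conjI allI impI)
  let ?n = "length w"
  let ?B = "{p * (?n + 1) + q |p q. p \<le> ?n \<and> q \<le> ?n \<and> P p q}"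
  have "p * (?n + 1) + q < cells w" if "p \<le> ?n" "q \<le> ?n" for p q
  proof -
    have "p * (?n + 1) + q \<le> ?n * (?n + 1) + ?n"
      using that by (intro add_mono mult_mono) auto
    then show ?thesis by (simp add: power2_eq_square)
  qed
  then show "?B \<subseteq> {..<cells w}" by auto
  fix p q assume pq: "p \<le> ?n" "q \<le> ?n"
  have "p' = p \<and> q' = q" if "p' * (?n + 1) + q' = p * (?n + 1) + q" "q' \<le> ?n" for p' q'
  proof -
    have "(p' * (?n + 1) + q') div (?n + 1) = p'" "(p * (?n + 1) + q) div (?n + 1) = p"
      using that(2) pq by (simp_all del: add_Suc_right Suc_eq_plus1)
    then have "p' = p" using that(1) by simp
    with that show ?thesis by simp
  qed
  then have "p * (?n + 1) + q \<in> ?B \<longleftrightarrow> P p q"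
    using pq by fastforce
  then show "tab w ?B p q \<longleftrightarrow> P p q"
    by (simp only: tab_def)
qed

lemma sat_connectives:
  "sat w e \<rho> (FOr \<phi> \<psi>) \<longleftrightarrow> sat w e \<rho> \<phi> \<or> sat w e \<rho> \<psi>"
  "sat w e \<rho> (FImp \<phi> \<psi>) \<longleftrightarrow> (sat w e \<rho> \<phi> \<longrightarrow> sat w e \<rho> \<psi>)"
  "sat w e \<rho> (FIff \<phi> \<psi>) \<longleftrightarrow> (sat w e \<rho> \<phi> \<longleftrightarrow> sat w e \<rho> \<psi>)"
  "sat w e \<rho> (AllF x \<phi>) \<longleftrightarrow> (\<forall>v\<le>length w. sat w (e(x := v)) \<rho> \<phi>)"
  "sat w e \<rho> (FEq x y) \<longleftrightarrow> e x = e y"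
  by (auto simp: FOr_def FImp_def FIff_def AllF_def FEq_def)

lemma sat_macros:
  "sat w e \<rho> (FBit x) \<longleftrightarrow> isbit w (e x)"
  "x \<noteq> 5 \<Longrightarrow> y \<noteq> 5 \<Longrightarrow> sat w e \<rho> (FNext x y) \<longleftrightarrow> next_pos w (e x) (e y)"
  "x \<noteq> 5 \<Longrightarrow> y \<noteq> 5 \<Longrightarrow> sat w e \<rho> (FSucc x y) \<longleftrightarrow> succ_pos w (e x) (e y)"
  "sat w e \<rho> (FModal x) \<longleftrightarrow> modal w (e x)"
  "sat w e \<rho> (FLeaf x) \<longleftrightarrow> leaf w (e x)"
  "sat w e \<rho> (FUnary x) \<longleftrightarrow> unary w (e x)"
  "sat w e \<rho> (FBinary x) \<longleftrightarrow> binary w (e x)"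
  by (auto simp: sat_connectives FBit_def FNext_def FSucc_def FModal_def FLeaf_def FUnary_def FBinary_def
    isbit_def next_pos_def succ_pos_def modal_def leaf_def unary_def binary_def letter_def)

lemma sat_letter_rel:
  "sat w e \<rho> (Letter a x) \<longleftrightarrow> letter w a (e x)"
  "sat w e \<rho> (Rel R x y) \<longleftrightarrow> tab w (\<rho> R) (e x) (e y)"
  by (simp_all add: letter_def tab_def)

declare sat.simps [simp del]

lemmas sat_simps = sat_connectives sat_macros sat_letter_rel sat.simps(2,4-7)

lemma sat_FEnds: "sat w e \<rho> FEnds \<longleftrightarrow> ends w (tab w (\<rho> 0))"
  by (simp add: FEnds_def ends_def sat_simps)

lemma sat_FSame: "sat w e \<rho> FSame \<longleftrightarrow> same w (tab w (\<rho> 1))"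
  by (simp add: FSame_def same_def sat_simps)

lemma sat_holds:
  assumes "e 0 = 0"
  shows "sat w e \<rho> (FHoldsEx x) \<longleftrightarrow> holds_ex w (\<lambda>p. tab w (\<rho> 3) p 0) (e x)"
    and "x \<noteq> 3 \<Longrightarrow> x \<noteq> 5 \<Longrightarrow> sat w e \<rho> (FHoldsArg x) \<longleftrightarrow> holds_arg w (\<lambda>p. tab w (\<rho> 3) p 0) (e x)"
  using assms by (simp_all add: FHoldsEx_def FHoldsArg_def holds_ex_def holds_arg_def sat_simps)

lemma sat_FWorld:
  assumes "e 0 = 0"
  shows "sat w e \<rho> FWorld \<longleftrightarrow>
    world w (tab w (\<rho> 0)) (tab w (\<rho> 1)) (tab w (\<rho> 2)) (\<lambda>p. tab w (\<rho> 3) p 0)"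
  using assms by (simp add: FWorld_def world_def sat_simps sat_holds)

lemma ends_cong:
  "\<forall>p\<le>length w. \<forall>q\<le>length w. A p q \<longleftrightarrow> A' p q \<Longrightarrow> ends w A \<longleftrightarrow> ends w A'"
  unfolding ends_def by (simp cong: conj_cong)

lemma same_cong:
  "\<forall>p\<le>length w. \<forall>q\<le>length w. S p q \<longleftrightarrow> S' p q \<Longrightarrow> same w S \<longleftrightarrow> same w S'"
  unfolding same_def by (simp cong: conj_cong)

lemma restriction_cong:
  assumes "\<forall>p\<le>length w. V p \<longleftrightarrow> V' p" "p \<le> length w"
  shows "holds_ex w V p \<longleftrightarrow> holds_ex w V' p" "holds_arg w V p \<longleftrightarrow> holds_arg w V' p"
  using assms unfolding holds_ex_def holds_arg_def by (auto cong: conj_cong)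

text \<open>All quantifiers in \<open>world\<close> are bounded by positions, so predicates may be
  exchanged for tables that agree with them there.\<close>

lemma world_cong:
  assumes "\<forall>p\<le>length w. \<forall>q\<le>length w. A p q \<longleftrightarrow> A' p q" "\<forall>p\<le>length w. \<forall>q\<le>length w. S p q \<longleftrightarrow> S' p q"
    "\<forall>p\<le>length w. \<forall>q\<le>length w. Q p q \<longleftrightarrow> Q' p q" "\<forall>p\<le>length w. V p \<longleftrightarrow> V' p"
  shows "world w A S Q V \<longleftrightarrow> world w A' S' Q' V'"
  unfolding world_def using assms restriction_cong[OF assms(4)] by (simp cong: conj_cong)

text \<open>Formulas quantify over tables, \<open>consistent\<close> over arbitrary predicates. One
  direction reads a table as a predicate, the other tabulates the predicates and uses the congruence
  lemmas.\<close>

lemma sat_FConsistent: "sat w (\<lambda>_. 0) (\<lambda>_. {}) FConsistent \<longleftrightarrow> consistent w"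
proof
  let ?W = "\<lambda>a s q v. world w (tab w a) (tab w s) (tab w q) (\<lambda>p. tab w v p 0)"
  assume "sat w (\<lambda>_. 0) (\<lambda>_. {}) FConsistent"
  then obtain a s q where 1: "ends w (tab w a)" "same w (tab w s)"
    and 2: "\<exists>v\<subseteq>{..<(Suc (length w))\<^sup>2}. ?W a s q v \<and> tab w v 0 0"
    and 3: "\<forall>i\<le>length w. \<forall>j\<le>length w. tab w q i j \<longrightarrow>
      (\<exists>v\<subseteq>{..<(Suc (length w))\<^sup>2}. ?W a s q v \<and>
        holds_arg w (\<lambda>p. tab w v p 0) i \<and> (i = j \<or> \<not> holds_arg w (\<lambda>p. tab w v p 0) j))"
    unfolding FConsistent_def
    by (simp add: sat_simps sat_FEnds sat_FSame sat_FWorld sat_holds) (elim exE conjE, rule that, assumption, assumption, intro exI conjI, assumption+)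
  show "consistent w"
    unfolding consistent_def
  proof (rule exI[of _ "tab w a"], rule exI[of _ "tab w s"], rule exI[of _ "tab w q"], intro conjI)
    show "ends w (tab w a)" "same w (tab w s)" by (fact 1)+
    show "\<exists>V. world w (tab w a) (tab w s) (tab w q) V \<and> V 0"
    proof -
      obtain v where "?W a s q v" "tab w v 0 0"
        using 2 by blast
      then show ?thesis
        by (intro exI[of _ "\<lambda>p. tab w v p 0"]) simp
    qed
    show "\<forall>i\<le>length w. \<forall>j\<le>length w. tab w q i j \<longrightarrow>
      (\<exists>V. world w (tab w a) (tab w s) (tab w q) V \<and> holds_arg w V i \<and> (i = j \<or> \<not> holds_arg w V j))"
    proof (intro allI impI)
      fix i j assume "i \<le> length w" "j \<le> length w" "tab w q i j"
      with 3 obtain v where "?W a s q v \<and>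
        holds_arg w (\<lambda>p. tab w v p 0) i \<and> (i = j \<or> \<not> holds_arg w (\<lambda>p. tab w v p 0) j)" by blast
      then show "\<exists>V. world w (tab w a) (tab w s) (tab w q) V \<and> holds_arg w V i \<and> (i = j \<or> \<not> holds_arg w V j)"
        by (rule exI[of _ "\<lambda>p. tab w v p 0"])
    qed
  qed
next
  let ?n = "length w"
  let ?W = "\<lambda>a s q v. world w (tab w a) (tab w s) (tab w q) (\<lambda>p. tab w v p 0)"
  assume "consistent w"
  then obtain A S Q V0 where c: "ends w A" "same w S" "world w A S Q V0" "V0 0"
    and real: "\<And>i j. i \<le> ?n \<Longrightarrow> j \<le> ?n \<Longrightarrow> Q i j \<Longrightarrow>
        \<exists>V. world w A S Q V \<and> holds_arg w V i \<and> (i = j \<or> \<not> holds_arg w V j)"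
    unfolding consistent_def by blast
  obtain a where a: "a \<subseteq> {..<cells w}" "\<forall>p\<le>?n. \<forall>q\<le>?n. tab w a p q \<longleftrightarrow> A p q"
    using tab_exists[of w A] by blast
  obtain s where s: "s \<subseteq> {..<cells w}" "\<forall>p\<le>?n. \<forall>q\<le>?n. tab w s p q \<longleftrightarrow> S p q"
    using tab_exists[of w S] by blast
  obtain q where q: "q \<subseteq> {..<cells w}" "\<forall>p\<le>?n. \<forall>q'\<le>?n. tab w q p q' \<longleftrightarrow> Q p q'"
    using tab_exists[of w Q] by blast
  have V: "\<exists>v\<subseteq>{..<cells w}. ?W a s q v \<and>
      (\<forall>p\<le>?n. tab w v p 0 \<longleftrightarrow> V p)" if "world w A S Q V" for V
  proof -
    obtain v where v: "v \<subseteq> {..<cells w}" "\<forall>p\<le>?n. \<forall>q\<le>?n. tab w v p q \<longleftrightarrow> V p"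
      using tab_exists[of w "\<lambda>p _. V p"] by blast
    then have "\<forall>p\<le>?n. tab w v p 0 \<longleftrightarrow> V p" by blast
    with world_cong[OF a(2) s(2) q(2) this] that v(1) show ?thesis by blast
  qed
  have 1: "ends w (tab w a)" "same w (tab w s)"
    using c ends_cong[OF a(2)] same_cong[OF s(2)] by blast+
  have 2: "\<exists>v\<subseteq>{..<cells w}. ?W a s q v \<and> tab w v 0 0"
    using V[OF c(3)] c(4) by blast
  have 3: "\<exists>v\<subseteq>{..<cells w}. ?W a s q v \<and>
      holds_arg w (\<lambda>p. tab w v p 0) i \<and> (i = j \<or> \<not> holds_arg w (\<lambda>p. tab w v p 0) j)"
    if ij: "i \<le> ?n" "j \<le> ?n" "tab w q i j" for i j
  proof -
    obtain V where "world w A S Q V" "holds_arg w V i" "i = j \<or> \<not> holds_arg w V j"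
      using real ij q(2) by blast
    moreover from V[OF this(1)] obtain v where "v \<subseteq> {..<cells w}"
      "?W a s q v" "\<forall>p\<le>?n. tab w v p 0 \<longleftrightarrow> V p" by blast
    ultimately show ?thesis
      using restriction_cong(2)[of w "\<lambda>p. tab w v p 0" V] ij by blast
  qed
  show "sat w (\<lambda>_. 0) (\<lambda>_. {}) FConsistent"
    unfolding FConsistent_def sat_simps
    by (rule exI[of _ a], rule conjI[OF a(1)], rule exI[of _ s], rule conjI[OF s(1)],
      rule exI[of _ q], rule conjI[OF q(1)])
      (use 1 2 3 in \<open>simp add: sat_simps sat_FEnds sat_FSame sat_FWorld sat_holds\<close>)
qed

section \<open>Occurrences of concepts in the input\<close>

text \<open>The guard for unique readability: in front of such a rest, a numeral is a maximal run of
  bits.\<close>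

definition ends_numeral :: "token list \<Rightarrow> bool" where
  "ends_numeral zs \<longleftrightarrow> zs = [] \<or> hd zs \<notin> range TBit"

lemma ends_numeral_simps [simp]:
  "ends_numeral []" "ends_numeral (t # zs) \<longleftrightarrow> t \<notin> range TBit"
  by (auto simp: ends_numeral_def)

lemma encode_name_bits: "set (encode_name a) \<subseteq> range TBit"
proof (induction a rule: encode_name.induct)
  case (1 a)
  then show ?case
    by (subst encode_name.simps) auto
qed

lemma encode_name_inj: "encode_name a = encode_name b \<Longrightarrow> a = b"
proof (induction a arbitrary: b rule: encode_name.induct)
  case (1 a)
  show ?case
  proof (cases "a = 0")
    case True
    then show ?thesis using "1.prems"
      by (subst (asm) (1 2) encode_name.simps) (simp split: if_splits)
  next
    case False
    with "1.prems" have b: "b \<noteq> 0" "odd a = odd b" "encode_name (a div 2) = encode_name (b div 2)"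
      by (subst (asm) (1 2) encode_name.simps, simp split: if_splits)+
    then have "a div 2 = b div 2"
      using "1.IH" False by blast
    with b(2) show ?thesis by (metis odd_two_times_div_two_succ even_two_times_div_two)
  qed
qed

lemma takeWhile_numeral:
  assumes "set bs \<subseteq> range TBit" "ends_numeral zs"
  shows "takeWhile (\<lambda>t. t \<in> range TBit) (bs @ zs) = bs"
proof -
  have "takeWhile (\<lambda>t. t \<in> range TBit) zs = []"
    using assms(2) by (cases zs) auto
  then show ?thesis
    using assms(1) by (subst takeWhile_append2) auto
qed

lemma encode_name_append_inj:
  assumes "encode_name a @ zs = encode_name b @ zs'" "ends_numeral zs" "ends_numeral zs'"
  shows "a = b \<and> zs = zs'"
proof -
  have "encode_name a = encode_name b"
    using takeWhile_numeral[OF encode_name_bits assms(2)] takeWhile_numeral[OF encode_name_bits assms(3)] assms(1)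
    by metis
  then show ?thesis
    using assms(1) encode_name_inj by auto
qed

lemma hd_encode_concept:
  "\<exists>t ts. encode_concept C = t # ts \<and> t \<notin> range TBit \<and> t \<noteq> TSub"
  by (cases C) auto

lemma ends_numeral_encode [simp]: "ends_numeral (encode_concept C @ zs)"
  using hd_encode_concept[of C] by auto

text \<open>The first token determines the constructor, after which the arguments are peeled off one
  by one. The rests are arbitrary because the second argument belongs to the rest of the
  first.\<close>

lemma encode_concept_inj:
  "encode_concept C @ zs = encode_concept D @ zs' \<Longrightarrow> ends_numeral zs \<Longrightarrow> ends_numeral zs' \<Longrightarrow>
    C = D \<and> zs = zs'"
proof (induction C arbitrary: D zs zs')
  case (Atom a)
  then show ?case by (cases D) (auto dest: encode_name_append_inj)
next
  case CTop
  then show ?case by (cases D) auto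
next
  case CBot
  then show ?case by (cases D) auto
next
  case (CNot C)
  then show ?case by (cases D) auto
next
  case (CAnd C1 C2)
  from CAnd.prems show ?case by (cases D) (auto dest!: CAnd.IH)
next
  case (COr C1 C2)
  from COr.prems show ?case by (cases D) (auto dest!: COr.IH)
next
  case (CEx r C)
  then show ?case by (cases D) (auto dest!: encode_name_append_inj)
next
  case (CAll r C)
  then show ?case by (cases D) (auto dest!: encode_name_append_inj)
qed

definition occ :: "token list \<Rightarrow> nat \<Rightarrow> (nat, nat) concept \<Rightarrow> bool" where
  "occ w p C \<longleftrightarrow> (\<exists>zs. drop p w = encode_concept C @ zs \<and> ends_numeral zs)"

abbreviation len :: "(nat, nat) concept \<Rightarrow> nat" where
  "len C \<equiv> length (encode_concept C)"

lemma occ_unique: "occ w p C \<Longrightarrow> occ w p D \<Longrightarrow> C = D"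
  unfolding occ_def using encode_concept_inj by metis

lemma drop_eq_append:
  assumes "drop p w = xs @ zs"
  shows "drop (p + length xs) w = zs"
  using assms by (metis add.commute append_eq_conv_conj drop_drop)

lemma occ_shift:
  "drop p w = xs @ encode_concept C @ zs \<Longrightarrow> ends_numeral zs \<Longrightarrow> occ w (p + length xs) C"
  using drop_eq_append unfolding occ_def by blast

lemma occ_sub:
  "occ w p (CNot C) \<Longrightarrow> occ w (p + 1) C"
  "occ w p (CAnd C D) \<Longrightarrow> occ w (p + 1) C"
  "occ w p (CAnd C D) \<Longrightarrow> occ w (p + 1 + len C) D"
  "occ w p (COr C D) \<Longrightarrow> occ w (p + 1) C"
  "occ w p (COr C D) \<Longrightarrow> occ w (p + 1 + len C) D"
  "occ w p (CEx r C) \<Longrightarrow> occ w (p + 1 + length (encode_name r)) C"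
  "occ w p (CAll r C) \<Longrightarrow> occ w (p + 1 + length (encode_name r)) C"
  using occ_shift[of p w "[TNot]" C] occ_shift[of p w "[TAnd]" C] occ_shift[of p w "TAnd # encode_concept C" D]
    occ_shift[of p w "[TOr]" C] occ_shift[of p w "TOr # encode_concept C" D]
    occ_shift[of p w "TEx # encode_name r" C] occ_shift[of p w "TAll # encode_name r" C]
  by (auto simp: occ_def[of w p])

lemma occ_le: "occ w p C \<Longrightarrow> p + len C \<le> length w"
proof -
  assume "occ w p C"
  then obtain zs where zs: "drop p w = encode_concept C @ zs"
    by (auto simp: occ_def)
  then have "length w - p = len C + length zs"
    by (metis length_append length_drop)
  moreover have "len C > 0"
    using hd_encode_concept[of C] by auto
  ultimately show ?thesis by linarith
qed

lemma letter_drop: "letter w a p \<longleftrightarrow> (\<exists>ts. drop p w = a # ts)"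
proof
  assume "letter w a p"
  then show "\<exists>ts. drop p w = a # ts"
    by (auto simp: letter_def Cons_nth_drop_Suc[symmetric])
next
  assume "\<exists>ts. drop p w = a # ts"
  then obtain ts where ts: "drop p w = a # ts" by blast
  then have "p < length w" by (metis drop_all list.distinct(1) not_le)
  with ts show "letter w a p"
    by (auto simp: letter_def Cons_nth_drop_Suc[symmetric])
qed

lemma letter_unique: "letter w a p \<Longrightarrow> letter w b p \<Longrightarrow> a = b"
  by (auto simp: letter_def)

lemma isbit_iff: "isbit w p \<longleftrightarrow> p < length w \<and> w ! p \<in> range TBit"
  unfolding isbit_def letter_def by (metis (full_types) rangeE range_eqI)

lemma occ_letter:
  assumes "occ w p C"
  shows "letter w a p \<longleftrightarrow> a = hd (encode_concept C)"
proof -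
  have "letter w (hd (encode_concept C)) p"
    using assms hd_encode_concept[of C] by (auto simp: letter_drop occ_def)
  then show ?thesis
    using letter_unique by blast
qed

lemma next_pos_iff:
  assumes w: "drop p w = t # bs @ zs" and bs: "set bs \<subseteq> range TBit" and zs: "ends_numeral zs"
    and m: "m \<le> length w"
  shows "next_pos w p m \<longleftrightarrow> m = p + 1 + length bs"
proof -
  let ?m = "p + 1 + length bs"
  have d: "drop (Suc p) w = bs @ zs" "drop ?m w = zs"
    using drop_eq_append[of p w "[t]"] drop_eq_append[of p w "t # bs"] w by (auto simp: add.commute)
  have p: "p < length w"
    using w by (metis drop_all list.distinct(1) not_le)
  have len: "length w = ?m + length zs"
    using arg_cong[OF d(1), of length] p by simp
  have 1: "isbit w k" if "p < k" "k < ?m" for k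
  proof -
    have lt: "k - Suc p < length bs"
      using that by linarith
    have "w ! k = drop (Suc p) w ! (k - Suc p)"
      using that p by simp
    also have "\<dots> = bs ! (k - Suc p)"
      using lt by (simp add: d nth_append)
    also have "\<dots> \<in> set bs"
      using lt by (rule nth_mem)
    finally show ?thesis
      using bs that len by (auto simp: isbit_iff)
  qed
  have "w ! ?m = hd zs" if "zs \<noteq> []"
    using that d(2) hd_drop_conv_nth[of ?m w] len by auto
  then have 2: "\<not> isbit w ?m"
    using zs len unfolding isbit_iff ends_numeral_def by (cases "zs = []") auto
  show ?thesis
  proof
    assume "next_pos w p m"
    then have "p < m" "\<not> isbit w m" "\<forall>k\<le>length w. p < k \<and> k < m \<longrightarrow> isbit w k"
      by (auto simp: next_pos_def)
    then have "\<not> m < ?m" "\<not> ?m < m"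
      using 1 2 len by auto
    then show "m = ?m" by simp
  next
    assume "m = ?m"
    then show "next_pos w p m"
      using 1 2 by (auto simp: next_pos_def)
  qed
qed

fun name_bits :: "(nat, nat) concept \<Rightarrow> token list" where
  "name_bits (Atom a) = encode_name a"
| "name_bits (CEx r C) = encode_name r"
| "name_bits (CAll r C) = encode_name r"
| "name_bits _ = []"

lemma occ_name_bits:
  assumes "occ w p C"
  shows "\<exists>zs. drop p w = hd (encode_concept C) # name_bits C @ zs \<and> ends_numeral zs \<and> set (name_bits C) \<subseteq> range TBit"
proof -
  obtain zs where "drop p w = encode_concept C @ zs" "ends_numeral zs"
    using assms by (auto simp: occ_def)
  then show ?thesis
    using encode_name_bits by (cases C) auto
qed

lemma next_pos_occ:
  assumes "occ w p C" "m \<le> length w"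
  shows "next_pos w p m \<longleftrightarrow> m = p + 1 + length (name_bits C)"
  using occ_name_bits[OF assms(1)] next_pos_iff[OF _ _ _ assms(2)] by blast

text \<open>The cases are those distinguished by \<open>ends\<close>; each records where the parts
  lie and how the lengths add up.\<close>

lemma occ_shape:
  assumes "occ w p C"
  obtains "leaf w p" "len C = 1 + length (name_bits C)"
    | D where "unary w p" "size D < size C" "occ w (p + 1 + length (name_bits C)) D"
        "len C = 1 + length (name_bits C) + len D"
    | D E where "binary w p" "size D < size C" "size E < size C" "occ w (p + 1) D" "occ w (p + 1 + len D) E"
        "len C = 1 + len D + len E" "name_bits C = []"
proof (cases C)
  case (CNot D)
  then show thesis
    using that(2)[of D] assms occ_letter[OF assms] occ_sub(1)[of w p D] by (simp add: unary_def)
next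
  case (CAnd D E)
  then show thesis
    using that(3)[of D E] assms occ_letter[OF assms] occ_sub(2,3)[of w p D E] by (simp add: binary_def)
next
  case (COr D E)
  then show thesis
    using that(3)[of D E] assms occ_letter[OF assms] occ_sub(4,5)[of w p D E] by (simp add: binary_def)
next
  case (CEx r D)
  then show thesis
    using that(2)[of D] assms occ_letter[OF assms] occ_sub(6)[of w p r D] by (simp add: unary_def modal_def)
next
  case (CAll r D)
  then show thesis
    using that(2)[of D] assms occ_letter[OF assms] occ_sub(7)[of w p r D] by (simp add: unary_def modal_def)
qed (use that(1) occ_letter[OF assms] in \<open>auto simp: leaf_def\<close>)

text \<open>\<open>ends\<close> ties the end of a concept to the ends of its parts, so induction on
  the size leaves no freedom at an occurrence.\<close>

lemma ends_occ:
  assumes A: "ends w A"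
  shows "occ w p C \<Longrightarrow> q \<le> length w \<Longrightarrow> A p q \<longleftrightarrow> q = p + len C"
proof (induction "size C" arbitrary: C p q rule: less_induct)
  case less
  note o = less.prems(1) and q = less.prems(2)
  note next_p = next_pos_occ[OF o] and le = occ_le[OF o]
  then have p: "p \<le> length w" by simp
  from o show ?case
  proof (cases rule: occ_shape)
    case 1
    then have "A p q \<longleftrightarrow> next_pos w p q"
      using A p q by (simp add: ends_def)
    with 1 show ?thesis
      using next_p q by simp
  next
    case (2 D)
    then have "A p q \<longleftrightarrow> (\<exists>m\<le>length w. next_pos w p m \<and> A m q)"
      using A p q by (simp add: ends_def)
    with 2 show ?thesis
      using next_p le less.hyps[OF 2(2,3) q] by (simp add: add.assoc cong: conj_cong)
  next
    case (3 D E)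
    then have "A p q \<longleftrightarrow> (\<exists>m\<le>length w. next_pos w p m \<and> (\<exists>k\<le>length w. A m k \<and> A k q))"
      using A p q by (simp add: ends_def)
    with 3 show ?thesis
      using next_p le less.hyps[OF 3(2,4)] less.hyps[OF 3(3,5) q] by (simp add: add.assoc cong: conj_cong)
  qed
qed

section \<open>Equality of numerals\<close>

definition numeral_at :: "token list \<Rightarrow> nat \<Rightarrow> token list" where
  "numeral_at w i = takeWhile (\<lambda>t. t \<in> range TBit) (drop i w)"

lemma numeral_at_rec:
  "numeral_at w i = (if isbit w i then w ! i # numeral_at w (Suc i) else [])"
proof (cases "i < length w")
  case True
  then have "drop i w = w ! i # drop (Suc i) w"
    by (simp add: Cons_nth_drop_Suc)
  then show ?thesis
    using True by (simp add: numeral_at_def isbit_iff)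
qed (simp add: numeral_at_def isbit_iff)

lemma numeral_at_occ: "occ w p C \<Longrightarrow> numeral_at w (Suc p) = name_bits C"
proof -
  assume "occ w p C"
  then obtain zs where zs: "drop p w = [hd (encode_concept C)] @ (name_bits C @ zs)" "ends_numeral zs"
      "set (name_bits C) \<subseteq> range TBit"
    using occ_name_bits by fastforce
  from drop_eq_append[OF zs(1)] show ?thesis
    using takeWhile_numeral zs(2,3) by (simp add: numeral_at_def)
qed

lemma succ_pos_iff: "p \<le> length w \<Longrightarrow> m \<le> length w \<Longrightarrow> succ_pos w p m \<longleftrightarrow> m = Suc p"
  by (auto simp: succ_pos_def)

lemma same_step:
  assumes "i \<le> length w" "j \<le> length w"
  shows "(\<exists>i'\<le>length w. succ_pos w i i' \<and> (\<exists>j'\<le>length w. succ_pos w j j' \<and> P i' j')) \<longleftrightarrow>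
    i < length w \<and> j < length w \<and> P (Suc i) (Suc j)"
  using assms by (auto simp: succ_pos_iff Suc_le_eq cong: conj_cong)

lemma numeral_at_eq_step:
  "numeral_at w i = numeral_at w j \<longleftrightarrow> \<not> isbit w i \<and> \<not> isbit w j \<or>
     letter w (TBit True) i \<and> letter w (TBit True) j \<and> numeral_at w (Suc i) = numeral_at w (Suc j) \<or>
     letter w (TBit False) i \<and> letter w (TBit False) j \<and> numeral_at w (Suc i) = numeral_at w (Suc j)"
  by (subst (1 2) numeral_at_rec) (auto simp: isbit_def letter_def)

text \<open>The recursion in \<open>same\<close> moves both positions to the right, so it has
  exactly one solution, found by induction on the distance to the end. Position
  \<open>length w\<close> has no successor and is related to nothing.\<close>

lemma same_iff:
  "same w S \<longleftrightarrow> (\<forall>i\<le>length w. \<forall>j\<le>length w. S i j \<longleftrightarrow>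
     i < length w \<and> j < length w \<and> numeral_at w (Suc i) = numeral_at w (Suc j))"
proof
  assume S: "same w S"
  have "S i j \<longleftrightarrow> i < length w \<and> j < length w \<and> numeral_at w (Suc i) = numeral_at w (Suc j)"
    if "i \<le> length w" "j \<le> length w" for i j
    using that
  proof (induction "length w - i" arbitrary: i j rule: less_induct)
    case less
    have step: "S i j \<longleftrightarrow> i < length w \<and> j < length w \<and>
       (\<not> isbit w (Suc i) \<and> \<not> isbit w (Suc j) \<or>
        letter w (TBit True) (Suc i) \<and> letter w (TBit True) (Suc j) \<and> S (Suc i) (Suc j) \<or>
        letter w (TBit False) (Suc i) \<and> letter w (TBit False) (Suc j) \<and> S (Suc i) (Suc j))"
      using S less.prems unfolding same_def by (subst same_step[symmetric]) auto
    have "S (Suc i) (Suc j) \<longleftrightarrow> numeral_at w (Suc (Suc i)) = numeral_at w (Suc (Suc j))"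
      if "letter w a (Suc i)" "letter w b (Suc j)" for a b
      using less.hyps[of "Suc i" "Suc j"] that by (auto simp: letter_def)
    then show ?case
      unfolding step numeral_at_eq_step[of w "Suc i" "Suc j"] by blast
  qed
  then show "\<forall>i\<le>length w. \<forall>j\<le>length w. S i j \<longleftrightarrow>
     i < length w \<and> j < length w \<and> numeral_at w (Suc i) = numeral_at w (Suc j)" by blast
next
  assume S: "\<forall>i\<le>length w. \<forall>j\<le>length w. S i j \<longleftrightarrow>
     i < length w \<and> j < length w \<and> numeral_at w (Suc i) = numeral_at w (Suc j)"
  show "same w S"
    unfolding same_def
  proof (intro allI impI)
    fix i j assume ij: "i \<le> length w" "j \<le> length w"
    show "S i j \<longleftrightarrow> (\<exists>i'\<le>length w. succ_pos w i i' \<and> (\<exists>j'\<le>length w. succ_pos w j j' \<and>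
       (\<not> isbit w i' \<and> \<not> isbit w j' \<or>
        letter w (TBit True) i' \<and> letter w (TBit True) j' \<and> S i' j' \<or>
        letter w (TBit False) i' \<and> letter w (TBit False) j' \<and> S i' j')))"
    proof -
      have 1: "S i j \<longleftrightarrow> i < length w \<and> j < length w \<and> numeral_at w (Suc i) = numeral_at w (Suc j)"
        using S ij by simp
      have 2: "S (Suc i) (Suc j) \<longleftrightarrow> numeral_at w (Suc (Suc i)) = numeral_at w (Suc (Suc j))"
        if "letter w a (Suc i)" "letter w b (Suc j)" for a b
        using S that by (auto simp: letter_def)
      show ?thesis
        unfolding same_step[OF ij] 1 numeral_at_eq_step[of w "Suc i" "Suc j"] using 2 by blast
    qed
  qed
qed

section \<open>Parsing an arbitrary position of the input\<close>

lemma over_signature_simps [simp]: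
  "over_signature CN RN (Atom a) \<longleftrightarrow> a \<in> CN" "over_signature CN RN CTop" "over_signature CN RN CBot"
  "over_signature CN RN (CNot C) \<longleftrightarrow> over_signature CN RN C"
  "over_signature CN RN (CAnd C D) \<longleftrightarrow> over_signature CN RN C \<and> over_signature CN RN D"
  "over_signature CN RN (COr C D) \<longleftrightarrow> over_signature CN RN C \<and> over_signature CN RN D"
  "over_signature CN RN (CEx r C) \<longleftrightarrow> r \<in> RN \<and> over_signature CN RN C"
  "over_signature CN RN (CAll r C) \<longleftrightarrow> r \<in> RN \<and> over_signature CN RN C"
  by (auto simp: over_signature_def)

text \<open>Every token that is not a bit starts a concept. Quantifying over the continuation
  \<open>zs\<close> is what lets the property pass through concatenation.\<close>

definition parsed :: "nat set \<Rightarrow> nat set \<Rightarrow> token list \<Rightarrow> bool" where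
  "parsed CN RN xs \<longleftrightarrow> (\<forall>p zs. p < length xs \<longrightarrow> ends_numeral zs \<longrightarrow> xs ! p \<in> range TBit \<or>
     (\<exists>D zs'. over_signature CN RN D \<and> drop p (xs @ zs) = encode_concept D @ zs' \<and> ends_numeral zs'))"

lemma parsed_bits: "set bs \<subseteq> range TBit \<Longrightarrow> parsed CN RN bs"
  unfolding parsed_def by (metis nth_mem subsetD)

lemma parsed_append:
  assumes "parsed CN RN xs" "parsed CN RN (encode_concept D)"
  shows "parsed CN RN (xs @ encode_concept D)"
  unfolding parsed_def
proof (intro allI impI)
  fix p zs assume p: "p < length (xs @ encode_concept D)" and zs: "ends_numeral zs"
  show "(xs @ encode_concept D) ! p \<in> range TBit \<or> (\<exists>D' zs'. over_signature CN RN D' \<and>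
      drop p ((xs @ encode_concept D) @ zs) = encode_concept D' @ zs' \<and> ends_numeral zs')"
  proof (cases "p < length xs")
    case True
    then show ?thesis
      using assms(1)[unfolded parsed_def, rule_format, of p "encode_concept D @ zs"]
      by (simp add: nth_append)
  next
    case False
    then show ?thesis
      using assms(2)[unfolded parsed_def, rule_format, of "p - length xs" zs] p zs
      by (simp add: nth_append)
  qed
qed

lemma parsed_Cons:
  assumes "encode_concept C = t # xs" "over_signature CN RN C" "parsed CN RN xs"
  shows "parsed CN RN (encode_concept C)"
  unfolding parsed_def
proof (intro allI impI)
  fix p zs assume p: "p < len C" and zs: "ends_numeral zs"
  show "encode_concept C ! p \<in> range TBit \<or> (\<exists>D zs'. over_signature CN RN D \<and>
      drop p (encode_concept C @ zs) = encode_concept D @ zs' \<and> ends_numeral zs')"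
  proof (cases p)
    case 0
    then show ?thesis using assms(2) zs by auto
  next
    case (Suc p')
    then show ?thesis
      using assms(3)[unfolded parsed_def, rule_format, of p' zs] p zs assms(1) by simp
  qed
qed

lemma parsed_encode: "over_signature CN RN C \<Longrightarrow> parsed CN RN (encode_concept C)"
proof (induction C)
  case (Atom a)
  show ?case
    by (rule parsed_Cons[OF encode_concept.simps(1) Atom parsed_bits[OF encode_name_bits]])
next
  case CTop
  show ?case
    by (rule parsed_Cons) (auto simp: parsed_def)
next
  case CBot
  show ?case
    by (rule parsed_Cons) (auto simp: parsed_def)
next
  case (CNot C)
  then show ?case
    by (intro parsed_Cons[OF encode_concept.simps(4) CNot.prems] parsed_append parsed_bits[OF encode_name_bits]) auto
next
  case (CAnd C D)
  then show ?case
    by (intro parsed_Cons[OF encode_concept.simps(5) CAnd.prems] parsed_append parsed_bits[OF encode_name_bits]) auto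
next
  case (COr C D)
  then show ?case
    by (intro parsed_Cons[OF encode_concept.simps(6) COr.prems] parsed_append parsed_bits[OF encode_name_bits]) auto
next
  case (CEx r C)
  then show ?case
    by (intro parsed_Cons[OF encode_concept.simps(7) CEx.prems] parsed_append parsed_bits[OF encode_name_bits]) auto
next
  case (CAll r C)
  then show ?case
    by (intro parsed_Cons[OF encode_concept.simps(8) CAll.prems] parsed_append parsed_bits[OF encode_name_bits]) auto
qed

lemmas drop_encode_cases = parsed_encode[unfolded parsed_def, rule_format]

abbreviation encode_axioms :: "(nat, nat) concept_axiom list \<Rightarrow> token list" where
  "encode_axioms axs \<equiv> concat (map (\<lambda>(E, F). TSub # encode_concept E @ encode_concept F) axs)"

lemma ends_numeral_axioms [simp]: "ends_numeral (encode_axioms axs)"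
  by (cases axs) auto

lemma drop_axioms_cases:
  "\<forall>(E, F)\<in>set axs. over_signature CN RN E \<and> over_signature CN RN F \<Longrightarrow> p < length (encode_axioms axs) \<Longrightarrow>
    encode_axioms axs ! p \<in> range TBit \<or>
    (\<exists>E F zs. (E, F) \<in> set axs \<and> drop p (encode_axioms axs) = TSub # encode_concept E @ encode_concept F @ zs \<and>
       ends_numeral zs) \<or>
    (\<exists>D zs. over_signature CN RN D \<and> drop p (encode_axioms axs) = encode_concept D @ zs \<and> ends_numeral zs)"
proof (induction axs arbitrary: p)
  case (Cons ax axs)
  obtain E F where ax: "ax = (E, F)" by (cases ax)
  have E: "over_signature CN RN E" and F: "over_signature CN RN F"
    using Cons.prems(1) ax by auto
  consider "p = 0" | p' where "p = Suc p'" "p' < len E"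
    | p' where "p = Suc (len E + p')" "p' < len F"
    | p' where "p = Suc (len E + len F + p')"
  proof -
    consider "p = 0" | "p = Suc (p - 1)" "p - 1 < len E"
      | "p = Suc (len E + (p - 1 - len E))" "p - 1 - len E < len F"
      | "p = Suc (len E + len F + (p - 1 - len E - len F))"
      by linarith
    then show thesis by cases (use that in blast)+
  qed
  then show ?case
  proof cases
    case 1
    then show ?thesis
      by (intro disjI2 disjI1 exI[of _ E] exI[of _ F] exI[of _ "encode_axioms axs"]) (simp add: ax)
  next
    case 2
    then show ?thesis
      using drop_encode_cases[OF E, of p' "encode_concept F @ encode_axioms axs"]
      by (auto simp: ax nth_append)
  next
    case 3
    then show ?thesis
      using drop_encode_cases[OF F, of p' "encode_axioms axs"]
      by (auto simp: ax nth_append)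
  next
    case 4
    have eq: "drop p (encode_axioms (ax # axs)) = drop p' (encode_axioms axs)"
      "encode_axioms (ax # axs) ! p = encode_axioms axs ! p'"
      using 4 by (simp_all add: ax nth_append)
    have "p' < length (encode_axioms axs)"
      using 4 Cons.prems(2) by (simp add: ax)
    from Cons.IH[OF _ this] Cons.prems(1) show ?thesis
      unfolding eq by (metis (no_types, lifting) list.set_intros(2))
  qed
qed simp

lemma axiom_position:
  "(E, F) \<in> set axs \<Longrightarrow> \<exists>p zs. drop p (encode_axioms axs) = TSub # encode_concept E @ encode_concept F @ zs \<and>
    ends_numeral zs"
proof (induction axs)
  case (Cons ax axs)
  show ?case
  proof (cases "ax = (E, F)")
    case True
    then show ?thesis by (intro exI[of _ 0] exI[of _ "encode_axioms axs"]) simp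
  next
    case False
    then obtain p zs where p: "drop p (encode_axioms axs) = TSub # encode_concept E @ encode_concept F @ zs" "ends_numeral zs"
      using Cons by auto
    obtain G H where ax: "ax = (G, H)" by (cases ax)
    have "drop (Suc (len G + len H + p)) (encode_axioms (ax # axs)) = drop p (encode_axioms axs)"
      by (simp add: ax)
    then show ?thesis using p by metis
  qed
qed simp

locale encoded_input =
  fixes CN RN :: "nat set" and C0 :: "(nat, nat) concept" and axs :: "(nat, nat) concept_axiom list"
  assumes C0_sig: "over_signature CN RN C0"
    and axs_sig: "\<forall>(E, F)\<in>set axs. over_signature CN RN E \<and> over_signature CN RN F"
begin

definition w :: "token list" where "w = encode_input C0 axs"

abbreviation n :: nat where "n \<equiv> length w"

lemma w_eq: "w = encode_concept C0 @ encode_axioms axs"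
  by (simp add: w_def encode_input_def)

lemma occ_C0: "occ w 0 C0"
  by (auto simp: occ_def w_eq)

text \<open>\<open>ends\<close> and \<open>world\<close> speak of all positions with a given letter;
  this turns such a position into an occurrence of a concept or an axiom.\<close>

lemma position_cases:
  assumes "p < n"
  obtains "isbit w p"
    | E F where "(E, F) \<in> set axs" "letter w TSub p" "occ w (p + 1) E" "occ w (p + 1 + len E) F"
    | C where "over_signature CN RN C" "occ w p C"
proof (cases "p < len C0")
  case True
  then have "w ! p = encode_concept C0 ! p"
    by (simp add: w_eq nth_append)
  then show thesis
    using drop_encode_cases[OF C0_sig True, of "encode_axioms axs"] that(1,3) assms
    by (auto simp: isbit_iff occ_def w_eq[symmetric])
next
  case False
  let ?p = "p - len C0"
  have p: "?p < length (encode_axioms axs)" "drop p w = drop ?p (encode_axioms axs)" "w ! p = encode_axioms axs ! ?p"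
    using False assms by (auto simp: w_eq nth_append)
  consider "w ! p \<in> range TBit"
    | E F zs where "(E, F) \<in> set axs" "drop p w = TSub # encode_concept E @ encode_concept F @ zs" "ends_numeral zs"
    | D zs where "over_signature CN RN D" "drop p w = encode_concept D @ zs" "ends_numeral zs"
    using drop_axioms_cases[OF axs_sig p(1)] unfolding p(2,3) by blast
  then show thesis
  proof cases
    case 1
    then show thesis using that(1) assms by (simp add: isbit_iff)
  next
    case 2
    have "occ w (p + 1) E"
      using occ_shift[of p w "[TSub]" E "encode_concept F @ zs"] 2 by simp
    moreover have "occ w (p + 1 + len E) F"
      using occ_shift[of p w "TSub # encode_concept E" F zs] 2 by simp
    ultimately show thesis
      using that(2) 2 by (auto simp: letter_drop)
  next
    case 3
    then show thesis using that(3) by (auto simp: occ_def)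
  qed
qed

lemma axiom_occ:
  assumes "(E, F) \<in> set axs"
  obtains p where "p < n" "letter w TSub p" "occ w (p + 1) E" "occ w (p + 1 + len E) F"
proof -
  obtain p zs where p: "drop p (encode_axioms axs) = TSub # encode_concept E @ encode_concept F @ zs" "ends_numeral zs"
    using axiom_position[OF assms] by blast
  let ?p = "len C0 + p"
  have d: "drop ?p w = TSub # encode_concept E @ encode_concept F @ zs"
    using p by (simp add: w_eq)
  then have l: "letter w TSub ?p" by (auto simp: letter_drop)
  have "occ w (?p + 1) E"
    using occ_shift[of ?p w "[TSub]" E "encode_concept F @ zs"] d p by simp
  moreover have "occ w (?p + 1 + len E) F"
    using occ_shift[of ?p w "TSub # encode_concept E" F zs] d p by simp
  ultimately show thesis
    using that[of ?p] l by (simp add: letter_def)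
qed

lemma next_pos_TSub:
  assumes "letter w TSub p" "occ w (p + 1) E" "m \<le> n"
  shows "next_pos w p m \<longleftrightarrow> m = p + 1"
proof -
  obtain ts where ts: "drop p w = TSub # ts"
    using assms(1) by (auto simp: letter_drop)
  then have "drop (p + 1) w = ts"
    using drop_eq_append[of p w "[TSub]" ts] by simp
  then have "ends_numeral ts"
    using assms(2) by (auto simp: occ_def)
  then show ?thesis
    using next_pos_iff[of p w TSub "[]" ts m] ts assms(3) by simp
qed

end

section \<open>Consistency and satisfiability\<close>

lemma holds_occ:
  assumes "occ w p (CEx r C)"
  shows "holds_ex w V p \<longleftrightarrow> V p" "holds_arg w V p \<longleftrightarrow> V (p + 1 + length (encode_name r))"
  using occ_letter[OF assms] next_pos_occ[OF assms] occ_le[OF assms]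
  by (simp_all add: holds_ex_def holds_arg_def cong: conj_cong)

lemma not_holds_occ:
  assumes "occ w p (CAll r C)"
  shows "holds_ex w V p \<longleftrightarrow> \<not> V p" "holds_arg w V p \<longleftrightarrow> \<not> V (p + 1 + length (encode_name r))"
  using occ_letter[OF assms] next_pos_occ[OF assms] occ_le[OF assms]
  by (simp_all add: holds_ex_def holds_arg_def cong: conj_cong)

lemma world_occ:
  assumes V: "world w A S Q V" and A: "ends w A"
  shows "occ w p CTop \<Longrightarrow> V p" "occ w p CBot \<Longrightarrow> \<not> V p"
    "occ w p (CNot C) \<Longrightarrow> V p \<longleftrightarrow> \<not> V (p + 1)"
    "occ w p (CAnd C D) \<Longrightarrow> V p \<longleftrightarrow> V (p + 1) \<and> V (p + 1 + len C)"
    "occ w p (COr C D) \<Longrightarrow> V p \<longleftrightarrow> V (p + 1) \<or> V (p + 1 + len C)"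
proof -
  have next_V: "(letter w TTop p \<longrightarrow> V p) \<and> (letter w TBot p \<longrightarrow> \<not> V p) \<and>
      (letter w TNot p \<longrightarrow> (V p \<longleftrightarrow> \<not> V m))" if "p \<le> length w" "m \<le> length w" "next_pos w p m" for m
    using V that unfolding world_def by blast
  have next_V2: "(letter w TAnd p \<longrightarrow> (V p \<longleftrightarrow> V m \<and> V k)) \<and> (letter w TOr p \<longrightarrow> (V p \<longleftrightarrow> V m \<or> V k))"
    if "p \<le> length w" "m \<le> length w" "next_pos w p m" "k \<le> length w" "A m k" for m k
    using V that unfolding world_def by blast
  show "V p" if o: "occ w p CTop"
    using next_V[of "p + 1"] next_pos_occ[OF o, of "p + 1"] occ_letter[OF o] occ_le[OF o] by simp
  show "\<not> V p" if o: "occ w p CBot"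
    using next_V[of "p + 1"] next_pos_occ[OF o, of "p + 1"] occ_letter[OF o] occ_le[OF o] by simp
  show "V p \<longleftrightarrow> \<not> V (p + 1)" if o: "occ w p (CNot C)"
    using next_V[of "p + 1"] next_pos_occ[OF o, of "p + 1"] occ_letter[OF o] occ_le[OF o] by simp
  show "V p \<longleftrightarrow> V (p + 1) \<and> V (p + 1 + len C)" if o: "occ w p (CAnd C D)"
    using next_V2[of "p + 1" "p + 1 + len C"] next_pos_occ[OF o, of "p + 1"] occ_letter[OF o] occ_le[OF o]
      ends_occ[OF A occ_sub(2)[OF o], of "p + 1 + len C"] by simp
  show "V p \<longleftrightarrow> V (p + 1) \<or> V (p + 1 + len C)" if o: "occ w p (COr C D)"
    using next_V2[of "p + 1" "p + 1 + len C"] next_pos_occ[OF o, of "p + 1"] occ_letter[OF o] occ_le[OF o]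
      ends_occ[OF A occ_sub(4)[OF o], of "p + 1 + len C"] by simp
qed

definition role_at :: "token list \<Rightarrow> nat \<Rightarrow> nat \<Rightarrow> bool" where
  "role_at w r p \<longleftrightarrow> (\<exists>C. occ w p (CEx r C) \<or> occ w p (CAll r C))"

lemma role_at_props:
  assumes "role_at w r p"
  shows "p < length w" "modal w p" "numeral_at w (Suc p) = encode_name r"
proof -
  obtain C where "occ w p (CEx r C) \<or> occ w p (CAll r C)"
    using assms by (auto simp: role_at_def)
  then show "p < length w" "modal w p" "numeral_at w (Suc p) = encode_name r"
    using occ_le[of w p "CEx r C"] occ_le[of w p "CAll r C"] occ_letter[of w p "CEx r C"] occ_letter[of w p "CAll r C"]
      numeral_at_occ[of w p "CEx r C"] numeral_at_occ[of w p "CAll r C"]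
    by (auto simp: modal_def)
qed

section \<open>From a consistent word to a neighbourhood model\<close>

context encoded_input
begin

sublocale full_category CN RN C0 "set axs"
  using C0_sig axs_sig by unfold_locales auto

theorem consistent_satisfiable:
  assumes "consistent w"
  shows "\<not> cat_unsatisfiable CN RN C0 (set axs)"
proof -
  obtain A S Q V0 where A: "ends w A" and S: "same w S" and V0: "world w A S Q V0" "V0 0"
    and real: "\<And>i j. i \<le> n \<Longrightarrow> j \<le> n \<Longrightarrow> Q i j \<Longrightarrow>
        \<exists>V. world w A S Q V \<and> holds_arg w V i \<and> (i = j \<or> \<not> holds_arg w V j)"
    using assms unfolding consistent_def by blast
  \<comment> \<open>All admissible assignments are worlds, so every witness supplied by
    \<open>real\<close> is automatically one.\<close>
  define W where "W = {V. world w A S Q V}"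
  define \<nu> where "\<nu> a = {V \<in> W. \<exists>p. occ w p (Atom a) \<and> V p}" for a
  define arg where "arg p = {V \<in> W. holds_arg w V p}" for p
  \<comment> \<open>Every restriction true at \<open>V\<close> contributes the whole extension of
    its argument as a single neighbourhood.\<close>
  define \<rho> where "\<rho> r = {(V, arg p) |V p. V \<in> W \<and> role_at w r p \<and> holds_ex w V p}" for r
  have label: "(letter w TName i \<and> letter w TName j \<and> V i \<longrightarrow> V j) \<and>
        (modal w j \<and> holds_ex w V i \<and> (i = j \<or> \<not> holds_ex w V j) \<longrightarrow> Q i j)"
    if "V \<in> W" "i < n" "j < n" "numeral_at w (Suc i) = numeral_at w (Suc j)" for V i j
  proof -
    have "S i j"
      using S that(2-4) by (auto simp: same_iff)
    moreover have "i \<le> n" "j \<le> n"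
      using that by auto
    moreover have "world w A S Q V"
      using that(1) by (simp add: W_def)
    then have "\<forall>i\<le>n. \<forall>j\<le>n. S i j \<longrightarrow>
        (letter w TName i \<and> letter w TName j \<and> V i \<longrightarrow> V j) \<and>
        (modal w j \<and> holds_ex w V i \<and> (i = j \<or> \<not> holds_ex w V j) \<longrightarrow> Q i j)"
      unfolding world_def by (rule conjunct2)
    ultimately show ?thesis by blast
  qed
  \<comment> \<open>The diagonal entry \<open>Q p p\<close> supplies a world in
    \<open>arg p\<close>.\<close>
  have nonempty: "arg p \<noteq> {}" if "V \<in> W" "role_at w r p" "holds_ex w V p" for V r p
    using label[OF that(1), of p p] role_at_props[OF that(2)] that(3) real[of p p]
    by (auto simp: arg_def W_def)
  interpret neighbourhood_model W \<nu> \<rho>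
  proof
    show "\<nu> a \<subseteq> W" for a by (auto simp: \<nu>_def)
    show "V \<in> W \<and> N \<subseteq> W \<and> N \<noteq> {}" if "(V, N) \<in> \<rho> r" for V N r
      using that nonempty by (auto simp: \<rho>_def arg_def)
  qed
  have modal: "(\<exists>N. (V, N) \<in> \<rho> r \<and> N \<subseteq> arg p) \<longleftrightarrow> holds_ex w V p" if V: "V \<in> W" and p: "role_at w r p" for V r p
  proof
    assume "holds_ex w V p"
    then show "\<exists>N. (V, N) \<in> \<rho> r \<and> N \<subseteq> arg p"
      using V p by (auto simp: \<rho>_def)
  next
    assume "\<exists>N. (V, N) \<in> \<rho> r \<and> N \<subseteq> arg p"
    then obtain i where i: "role_at w r i" "holds_ex w V i" "arg i \<subseteq> arg p"
      by (auto simp: \<rho>_def)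
    show "holds_ex w V p"
    proof (rule ccontr)
      \<comment> \<open>A true restriction \<open>i\<close> and a false one \<open>p\<close> with
        the same role force \<open>Q i p\<close>, hence a world in \<open>arg i\<close> outside
        \<open>arg p\<close>.\<close>
      assume no: "\<not> holds_ex w V p"
      then have "Q i p"
        using label[OF V, of i p] i role_at_props[OF i(1)] role_at_props[OF p] by auto
      then obtain U where "world w A S Q U" "holds_arg w U i" "\<not> holds_arg w U p"
        using real[of i p] no i(2) role_at_props[OF i(1)] role_at_props[OF p] by auto
      then show False
        using i(3) by (auto simp: arg_def W_def)
    qed
  qed
  have truth: "V p \<longleftrightarrow> V \<in> ce (obj_of C)" if "occ w p C" "V \<in> W" for V p C
    using that
  proof (induction C arbitrary: p V)
    case (Atom a)
    \<comment> \<open>\<open>S\<close> relates all occurrences of a name, so its truth value does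
      not depend on the occurrence.\<close>
    have "V p" if q: "occ w q (Atom a)" "V q" for q
      using label[OF Atom(2), of q p] that occ_letter[OF q(1)] occ_letter[OF Atom(1)]
        numeral_at_occ[OF q(1)] numeral_at_occ[OF Atom(1)] occ_le[OF q(1)] occ_le[OF Atom(1)]
      by auto
    then show ?case
      using Atom by (auto simp: \<nu>_def)
  next
    case CTop
    then show ?case using world_occ(1)[OF _ A, of S Q V p] by (simp add: W_def)
  next
    case CBot
    then show ?case using world_occ(2)[OF _ A, of S Q V p] by (simp add: W_def)
  next
    case (CNot C)
    then show ?case
      using world_occ(3)[OF _ A, of S Q V p C] CNot.IH[OF occ_sub(1)] by (simp add: W_def)
  next
    case (CAnd C D)
    then show ?case
      using world_occ(4)[OF _ A, of S Q V p C D] CAnd.IH(1)[OF occ_sub(2)] CAnd.IH(2)[OF occ_sub(3)]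
      by (simp add: W_def)
  next
    case (COr C D)
    then show ?case
      using world_occ(5)[OF _ A, of S Q V p C D] COr.IH(1)[OF occ_sub(4)] COr.IH(2)[OF occ_sub(5)]
      by (simp add: W_def)
  next
    case (CEx r C)
    have "arg p = ce (obj_of C)"
      using holds_occ(2)[OF CEx(2)] CEx.IH[OF occ_sub(6)[OF CEx(2)]] ext_sub(1)[of "obj_of C"]
      by (auto simp: arg_def)
    moreover have "role_at w r p"
      using CEx(2) by (auto simp: role_at_def)
    ultimately show ?case
      using modal[OF CEx(3), of r p] holds_occ(1)[OF CEx(2)] by simp
  next
    case (CAll r C)
    have "arg p = W - ce (obj_of C)"
      using not_holds_occ(2)[OF CAll(2)] CAll.IH[OF occ_sub(7)[OF CAll(2)]]
      by (auto simp: arg_def)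
    moreover have "role_at w r p"
      using CAll(2) by (auto simp: role_at_def)
    ultimately show ?case
      using modal[OF CAll(3), of r p] not_holds_occ(1)[OF CAll(2)] CAll(3) by simp
  qed
  have ax: "ce (obj_of E) \<subseteq> ce (obj_of F)" if EF: "(E, F) \<in> set axs" for E F
  proof
    fix V assume V: "V \<in> ce (obj_of E)"
    then have VW: "V \<in> W" using ext_sub(1) by blast
    obtain p where p: "p < n" "letter w TSub p" "occ w (p + 1) E" "occ w (p + 1 + len E) F"
      using axiom_occ[OF EF] .
    have le: "p + 1 + len E \<le> n"
      using occ_le[OF p(3)] by simp
    have "next_pos w p (p + 1)" "A (p + 1) (p + 1 + len E)"
      using next_pos_TSub[OF p(2,3)] ends_occ[OF A p(3)] le by auto
    moreover have "p \<le> n" "p + 1 \<le> n" using le by auto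
    ultimately have "V (p + 1) \<longrightarrow> V (p + 1 + len E)"
      using VW p(2) le unfolding W_def world_def by blast
    then show "V \<in> ce (obj_of F)"
      using truth[OF p(3) VW] truth[OF p(4) VW] V by blast
  qed
  have "V0 \<in> ce (obj_of C0)"
    using truth[OF occ_C0] V0 by (simp add: W_def)
  \<comment> \<open>No condition on the objects enters \<open>arrow_sound\<close>, so the model
    excludes the arrow in every ontology category.\<close>
  then show ?thesis
    using arrow_sound[of "set axs" _ _ "obj_of C0" Bot] ax
    unfolding cat_unsatisfiable_def ontology_category_def by fastforce
qed

end

section \<open>From ultrafilters to a consistent word\<close>

context encoded_input
begin

notation carrow (infix "\<leadsto>" 50)

text \<open>At most one concept occurs at a position, so it must be the one that
  \<open>position_cases\<close> provides.\<close>

lemma occ_signature: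
  assumes "occ w p C"
  shows "over_signature CN RN C"
proof -
  have p: "p < n"
    using occ_le[OF assms] hd_encode_concept[of C] by auto
  obtain t ts where t: "encode_concept C = t # ts" "t \<notin> range TBit" "t \<noteq> TSub"
    using hd_encode_concept by blast
  then have "letter w t p"
    using occ_letter[OF assms] by simp
  with t have "\<not> isbit w p" "\<not> letter w TSub p"
    by (auto simp: isbit_def letter_def)
  with p show ?thesis
    by (cases rule: position_cases) (use occ_unique[OF assms] in auto)
qed

lemma letter_occ:
  assumes "letter w t p" "t \<notin> range TBit" "t \<noteq> TSub"
  obtains C where "occ w p C" "t = hd (encode_concept C)"
proof -
  have "p < n" "\<not> isbit w p" "\<not> letter w TSub p"
    using assms by (auto simp: isbit_def letter_def)
  then obtain C where "occ w p C"
    by (cases rule: position_cases) auto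
  then show thesis
    using that occ_letter assms(1) by blast
qed

definition concept_ends :: "nat \<Rightarrow> nat \<Rightarrow> bool" where
  "concept_ends p q \<longleftrightarrow> (\<exists>C. occ w p C \<and> q = p + len C)"

lemma concept_ends_occ: "occ w p C \<Longrightarrow> concept_ends p q \<longleftrightarrow> q = p + len C"
  using occ_unique unfolding concept_ends_def by blast

lemma ends_concept_ends: "ends w concept_ends"
  unfolding ends_def
proof (intro allI impI conjI)
  fix p q assume pq: "p \<le> n" "q \<le> n"
  show "concept_ends p q \<longleftrightarrow> next_pos w p q" if leaf: "leaf w p"
  proof -
    obtain C where C: "occ w p C" "hd (encode_concept C) \<in> {TName, TTop, TBot}"
      using leaf unfolding leaf_def by (auto elim!: letter_occ)
    then show ?thesis
      using concept_ends_occ[OF C(1)] next_pos_occ[OF C(1) pq(2)] by (cases C) auto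
  qed
  show "concept_ends p q \<longleftrightarrow> (\<exists>m\<le>n. next_pos w p m \<and> concept_ends m q)" if un: "unary w p"
  proof -
    obtain C where C: "occ w p C" "hd (encode_concept C) \<in> {TNot, TEx, TAll}"
      using un unfolding unary_def modal_def by (auto elim!: letter_occ)
    then obtain D where D: "occ w (p + 1 + length (name_bits C)) D" "len C = 1 + length (name_bits C) + len D"
      using occ_sub by (cases C) fastforce+
    then show ?thesis
      using concept_ends_occ[OF C(1)] concept_ends_occ[OF D(1)] next_pos_occ[OF C(1)] occ_le[OF C(1)]
      by (simp add: add.assoc cong: conj_cong)
  qed
  show "concept_ends p q \<longleftrightarrow> (\<exists>m\<le>n. next_pos w p m \<and> (\<exists>k\<le>n. concept_ends m k \<and> concept_ends k q))"
    if bin: "binary w p"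
  proof -
    obtain C where C: "occ w p C" "hd (encode_concept C) \<in> {TAnd, TOr}"
      using bin unfolding binary_def by (auto elim!: letter_occ)
    then obtain D E where D: "occ w (p + 1) D" "occ w (p + 1 + len D) E" "len C = 1 + len D + len E" "name_bits C = []"
      using occ_sub by (cases C) fastforce+
    then show ?thesis
      using concept_ends_occ[OF C(1)] concept_ends_occ[OF D(1)] concept_ends_occ[OF D(2)]
        next_pos_occ[OF C(1)] occ_le[OF C(1)]
      by (simp add: add.assoc cong: conj_cong)
  qed
qed

definition same_numeral :: "nat \<Rightarrow> nat \<Rightarrow> bool" where
  "same_numeral i j \<longleftrightarrow> i < n \<and> j < n \<and> numeral_at w (Suc i) = numeral_at w (Suc j)"

lemma same_same_numeral: "same w same_numeral"
  by (simp add: same_iff same_numeral_def)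

definition arg_at :: "nat \<Rightarrow> nat \<Rightarrow> (nat, nat) cobj \<Rightarrow> bool" where
  "arg_at r p Y \<longleftrightarrow> (\<exists>C. occ w p (CEx r C) \<and> Y = obj_of C \<or> occ w p (CAll r C) \<and> Y = Neg (obj_of C))"

text \<open>The canonical \<open>Q\<close>: pairs whose arrow is missing in the full category. Since
  \<open>Y \<leadsto> Y\<close> always exists, the diagonal asks instead that \<open>Y\<close> not
  collapse.\<close>

definition realizable :: "nat \<Rightarrow> nat \<Rightarrow> bool" where
  "realizable i j \<longleftrightarrow> (\<exists>r Y Z. arg_at r i Y \<and> arg_at r j Z \<and> (if i = j then \<not> Y \<leadsto> Bot else \<not> Y \<leadsto> Z))"

definition truth :: "(nat, nat) cobj set \<Rightarrow> nat \<Rightarrow> bool" where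
  "truth F p \<longleftrightarrow> (\<exists>C. occ w p C \<and> obj_of C \<in> F)"

lemma truth_occ: "occ w p C \<Longrightarrow> truth F p \<longleftrightarrow> obj_of C \<in> F"
  using occ_unique unfolding truth_def by blast

lemma modal_arg_at:
  assumes "modal w p"
  obtains r Y where "arg_at r p Y"
proof -
  obtain C where C: "occ w p C" "hd (encode_concept C) \<in> {TEx, TAll}"
    using assms unfolding modal_def by (auto elim!: letter_occ)
  then show thesis
    using that by (cases C) (auto simp: arg_at_def)
qed

lemma arg_at_props:
  assumes "arg_at r p Y"
  shows "Y \<in> OC" "RName r \<in> OR" "role_at w r p"
  using assms occ_signature obj_of_OC by (fastforce simp: arg_at_def role_at_def)+

lemma truth_arg_at:
  assumes F: "ultra F" and Y: "arg_at r p Y"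
  shows "holds_ex w (truth F) p \<longleftrightarrow> Exists (RName r) Y \<in> F" "holds_arg w (truth F) p \<longleftrightarrow> Y \<in> F"
proof -
  obtain C where "occ w p (CEx r C) \<and> Y = obj_of C \<or> occ w p (CAll r C) \<and> Y = Neg (obj_of C)"
    using Y by (auto simp: arg_at_def)
  then have "(holds_ex w (truth F) p \<longleftrightarrow> Exists (RName r) Y \<in> F) \<and> (holds_arg w (truth F) p \<longleftrightarrow> Y \<in> F)"
  proof
    assume o: "occ w p (CEx r C) \<and> Y = obj_of C"
    then show ?thesis
      using holds_occ[of w p r C "truth F"] truth_occ[of p "CEx r C" F] truth_occ[OF occ_sub(6), of p r C F] by simp
  next
    assume o: "occ w p (CAll r C) \<and> Y = Neg (obj_of C)"
    then have "RName r \<in> OR" "obj_of C \<in> OC"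
      using arg_at_props[OF Y] by auto
    then show ?thesis
      using o not_holds_occ[of w p r C "truth F"] truth_occ[of p "CAll r C" F] truth_occ[OF occ_sub(7), of p r C F]
        ultra_Forall[OF F] ultra_Neg[OF F] by simp
  qed
  then show "holds_ex w (truth F) p \<longleftrightarrow> Exists (RName r) Y \<in> F" "holds_arg w (truth F) p \<longleftrightarrow> Y \<in> F"
    by auto
qed

text \<open>Contraposition: an arrow \<open>Y \<leadsto> Z\<close> would carry the truth of
  \<exists>R.Y over to \<exists>R.Z by \<open>Exists_mono\<close>, and
  \<open>Y \<leadsto> Bot\<close> would make it false by \<open>Exists_Bot\<close>. Equal numerals
  ensure that the roles agree.\<close>

lemma realizable_label:
  assumes F: "ultra F" and ij: "same_numeral i j" "modal w j" "holds_ex w (truth F) i" "i = j \<or> \<not> holds_ex w (truth F) j"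
  shows "realizable i j"
proof -
  have "modal w i"
    using ij(3) by (auto simp: holds_ex_def modal_def)
  then obtain r Y where Y: "arg_at r i Y" by (rule modal_arg_at)
  obtain r' Z where Z: "arg_at r' j Z" using ij(2) by (rule modal_arg_at)
  have "encode_name r = encode_name r'"
    using ij(1) role_at_props(3)[OF arg_at_props(3)[OF Y]] role_at_props(3)[OF arg_at_props(3)[OF Z]]
    by (simp add: same_numeral_def)
  then have r: "r' = r" using encode_name_inj by blast
  have exY: "Exists (RName r) Y \<in> F"
    using truth_arg_at(1)[OF F Y] ij(3) by blast
  have "\<not> Y \<leadsto> Bot"
    using Exists_Bot arg_at_props(2)[OF Y] exY ultra_up[OF F] ultra_Bot[OF F] by blast
  moreover have "\<not> Y \<leadsto> Z" if "i \<noteq> j"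
    using that ij(4) truth_arg_at(1)[OF F Z] exY r Exists_mono arg_at_props(2)[OF Y] ultra_up[OF F] by blast
  ultimately show ?thesis
    using Y Z r unfolding realizable_def by auto
qed

text \<open>The Boolean constraints are the laws of ultrafilters, axioms are arrows and ultrafilters
  are closed upwards, and the condition on restrictions is \<open>realizable_label\<close>.\<close>

lemma world_truth:
  assumes F: "ultra F"
  shows "world w concept_ends same_numeral realizable (truth F)"
  unfolding world_def
proof (intro conjI allI impI; (elim conjE)?)
  fix p m assume pm: "p \<le> n" "m \<le> n" "next_pos w p m"
  have m: "m = p + 1 + length (name_bits C)" if "occ w p C" for C
    using next_pos_occ[OF that pm(2)] pm(3) by blast
  show "truth F p" if "letter w TTop p"
    using that
  proof (rule letter_occ)
    fix C assume "occ w p C" "TTop = hd (encode_concept C)"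
    then show ?thesis
      using truth_occ[of p C F] ultra_Top[OF F] by (cases C) auto
  qed auto
  show "\<not> truth F p" if "letter w TBot p"
    using that
  proof (rule letter_occ)
    fix C assume "occ w p C" "TBot = hd (encode_concept C)"
    then show ?thesis
      using truth_occ[of p C F] ultra_Bot[OF F] by (cases C) auto
  qed auto
  show "truth F p \<longleftrightarrow> \<not> truth F m" if "letter w TNot p"
    using that
  proof (rule letter_occ)
    fix C assume C: "occ w p C" "TNot = hd (encode_concept C)"
    then obtain D where D: "C = CNot D" by (cases C) auto
    then have o: "occ w m D"
      using occ_sub(1)[of w p D] C m[OF C(1)] by simp
    then show ?thesis
      using truth_occ[OF C(1)] truth_occ[OF o] D ultra_Neg[OF F obj_of_OC[OF occ_signature[OF o]]] by simp
  qed auto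
  fix k assume k: "k \<le> n" "concept_ends m k"
  show "truth F p \<longleftrightarrow> truth F m \<and> truth F k" if "letter w TAnd p"
    using that
  proof (rule letter_occ)
    fix C assume C: "occ w p C" "TAnd = hd (encode_concept C)"
    then obtain D E where D: "C = CAnd D E" by (cases C) auto
    then have o: "occ w m D"
      using occ_sub(2)[of w p D E] C m[OF C(1)] by simp
    then have "k = m + len D" using concept_ends_occ k(2) by blast
    then have o': "occ w k E"
      using D occ_sub(3)[of w p D E] C m[OF C(1)] by simp
    show ?thesis
      using truth_occ[OF C(1)] truth_occ[OF o] truth_occ[OF o'] D
        ultra_Conj[OF F obj_of_OC[OF occ_signature[OF o]] obj_of_OC[OF occ_signature[OF o']]] by simp
  qed auto
  show "truth F p \<longleftrightarrow> truth F m \<or> truth F k" if "letter w TOr p"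
    using that
  proof (rule letter_occ)
    fix C assume C: "occ w p C" "TOr = hd (encode_concept C)"
    then obtain D E where D: "C = COr D E" by (cases C) auto
    then have o: "occ w m D"
      using occ_sub(4)[of w p D E] C m[OF C(1)] by simp
    then have "k = m + len D" using concept_ends_occ k(2) by blast
    then have o': "occ w k E"
      using D occ_sub(5)[of w p D E] C m[OF C(1)] by simp
    show ?thesis
      using truth_occ[OF C(1)] truth_occ[OF o] truth_occ[OF o'] D
        ultra_Disj[OF F obj_of_OC[OF occ_signature[OF o]] obj_of_OC[OF occ_signature[OF o']]] by simp
  qed auto
  show "truth F k" if sub: "letter w TSub p" and mF: "truth F m"
  proof -
    have "p < n" "\<not> isbit w p"
      using sub by (auto simp: letter_def isbit_def)
    then obtain E G where EG: "(E, G) \<in> set axs" "occ w (p + 1) E" "occ w (p + 1 + len E) G"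
    proof (cases rule: position_cases)
      case (3 C)
      then show thesis
        using occ_letter[OF 3(2)] sub hd_encode_concept[of C] by auto
    qed auto
    have m': "m = p + 1"
      using next_pos_TSub[OF sub EG(2) pm(2)] pm(3) by blast
    then have "k = p + 1 + len E"
      using concept_ends_occ[OF EG(2)] k(2) by simp
    moreover have "obj_of E \<leadsto> obj_of G"
      using EG(1) by (rule axiom_arrow)
    ultimately show ?thesis
      using truth_occ[OF EG(2)] truth_occ[OF EG(3)] m' mF ultra_up[OF F, of "obj_of E" "obj_of G"] by simp
  qed
next
  fix i j assume ij: "i \<le> n" "j \<le> n" "same_numeral i j"
  show "truth F j" if i: "letter w TName i" "truth F i" and j: "letter w TName j"
  proof -
    obtain C where C: "occ w i C" "TName = hd (encode_concept C)" by (rule letter_occ[OF i(1)]) auto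
    obtain D where D: "occ w j D" "TName = hd (encode_concept D)" by (rule letter_occ[OF j]) auto
    obtain a b where ab: "C = Atom a" "D = Atom b" using C(2) D(2) by (cases C; cases D) auto
    have "encode_name a = encode_name b"
      using ij(3) numeral_at_occ[OF C(1)] numeral_at_occ[OF D(1)] ab by (simp add: same_numeral_def)
    then have "a = b" by (rule encode_name_inj)
    then show ?thesis
      using i(2) truth_occ[OF C(1)] truth_occ[OF D(1)] ab by simp
  qed
  show "realizable i j" if "modal w j" "holds_ex w (truth F) i" "i = j \<or> \<not> holds_ex w (truth F) j"
    using realizable_label[OF F ij(3) that] .
qed

theorem satisfiable_consistent:
  assumes "\<not> cat_unsatisfiable CN RN C0 (set axs)"
  shows "consistent w"
  unfolding consistent_def
proof (rule exI[of _ concept_ends], rule exI[of _ same_numeral], rule exI[of _ realizable],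
    intro conjI allI impI ends_concept_ends same_same_numeral)
  have "\<not> obj_of C0 \<leadsto> Bot"
    using assms full_arrow_unsatisfiable by blast
  then obtain F where F: "ultra F" "obj_of C0 \<in> F"
    using ultra_exists obj_of_OC[OF C0_sig] by blast
  then show "\<exists>V. world w concept_ends same_numeral realizable V \<and> V 0"
    using world_truth truth_occ[OF occ_C0] by blast
next
  fix i j assume "realizable i j"
  then obtain r Y Z where Y: "arg_at r i Y" and Z: "arg_at r j Z" and
      no: "if i = j then \<not> Y \<leadsto> Bot else \<not> Y \<leadsto> Z"
    by (auto simp: realizable_def)
  note oc = arg_at_props(1)[OF Y] arg_at_props(1)[OF Z]
  \<comment> \<open>A missing arrow is witnessed by an ultrafilter, which becomes the world required
    for the entry.\<close>
  have "\<exists>F. ultra F \<and> Y \<in> F \<and> (i = j \<or> Z \<notin> F)"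
  proof (cases "i = j")
    case True
    then show ?thesis using no ultra_exists[OF oc(1)] by auto
  next
    case False
    then show ?thesis using no ultra_separates[OF oc] ultra_Neg[OF _ oc(2)] by auto
  qed
  then obtain F where F: "ultra F" "Y \<in> F" "i = j \<or> Z \<notin> F" by blast
  then show "\<exists>V. world w concept_ends same_numeral realizable V \<and> holds_arg w V i \<and> (i = j \<or> \<not> holds_arg w V j)"
    using world_truth[OF F(1)] truth_arg_at(2)[OF F(1) Y] truth_arg_at(2)[OF F(1) Z]
    by (intro exI[of _ "truth F"]) auto
qed

end

theorem theorem3:
  fixes CN RN :: "nat set"
  assumes "CN \<noteq> {}" and "RN \<noteq> {}"
  shows "\<exists>(M :: token tm) (p :: nat poly). turing_machine M \<and>
    (\<forall>C0 axs.
       over_signature CN RN C0 \<and>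
       (\<forall>(E, F)\<in>set axs. over_signature CN RN E \<and> over_signature CN RN F) \<longrightarrow>
       (let w = encode_input C0 axs in
          (accepts M w \<longleftrightarrow> cat_unsatisfiable CN RN C0 (set axs)) \<and>
          (rejects M w \<longleftrightarrow> \<not> cat_unsatisfiable CN RN C0 (set axs)) \<and>
          runs_in_space M w (poly p (length w))))"
proof -
  \<comment> \<open>The machine accepts unsatisfiable inputs, hence the negation; 8 covers the
    variables 0 to 7 and the relations 0 to 3.\<close>
  have "wf_fmla 8 (FNot FConsistent)"
    using wf_FConsistent by simp
  then obtain M p where M: "turing_machine M" and dec: "\<And>w. w \<noteq> [] \<Longrightarrow>
      (accepts M w \<longleftrightarrow> \<not> consistent w) \<and> (rejects M w \<longleftrightarrow> consistent w) \<and> runs_in_space M w (poly p (length w))"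
    using second_order_polynomial_space[of 8 "FNot FConsistent"] sat_FConsistent
    by (auto simp: sat.simps)
  have "(accepts M w \<longleftrightarrow> cat_unsatisfiable CN RN C0 (set axs)) \<and>
        (rejects M w \<longleftrightarrow> \<not> cat_unsatisfiable CN RN C0 (set axs)) \<and> runs_in_space M w (poly p (length w))"
    if "over_signature CN RN C0" "\<forall>(E, F)\<in>set axs. over_signature CN RN E \<and> over_signature CN RN F"
      "w = encode_input C0 axs" for C0 axs w
  proof -
    interpret encoded_input CN RN C0 axs
      using that by unfold_locales
    \<comment> \<open>Every concept has a first token, so the excluded empty word is never an
      input.\<close>
    have "encode_input C0 axs \<noteq> []"
      using hd_encode_concept[of C0] by (auto simp: encode_input_def)
    then show ?thesis
      using dec[of "encode_input C0 axs"] consistent_satisfiable satisfiable_consistent that(3)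
      unfolding w_def by blast
  qed
  with M show ?thesis
    unfolding Let_def by blast
qed

end
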